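(* Let $n\ge1$, $\sigma\in J_n^+$, $\Lambda$ a continuous positive function on $[0,\infty)$, $\underline\vartheta,\overline\vartheta>0$, and let $V=V(x)\ge0$ be continuous and time-independent with $V(x)\ge\underline\vartheta\Lambda(t)|x|^\sigma$ for $|x|\ge1,t>0$ and $V(x)\le\overline\vartheta\Lambda(t)|x|^\sigma$ for $x\in\mathbb{R}^n,t>0$. Let $0<p<\varepsilon_0\underline\vartheta/\overline\vartheta$ ($p<1$), with $\varepsilon_0>0$ any constant such that $\int_{\{|x-y|\ge1\}}B(y)|x-y|^{\sigma+d}dy\ge\varepsilon_0|x|^{\sigma+d}$ for all $x$ and all $d\in[0,\frac{\sigma p}{1-p}]$, and let $a\ge\frac{\sigma}{1-p}$. Let $u_{*V}$ be the maximal s-solution of the problem $\partial_tu-\Delta\partial_tu=\Delta u+V u^p$, $u(\cdot,0)=0$. Then a function $0\le u\in\mathcal{Z}_{\infty,a}$ is a nontrivial (i.e. not identically zero) s-solution of this zero-data problem if and only if $u(x,t)=u_{*V}(x,[t-\kappa]_+)$ for some constant $\kappa\ge0$.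
   Context: $J_n^+=\{0\}\cup[1,\infty)$ if $n=1$, $[0,\infty)$ if $n\ge2$. $[s]_+=\max\{s,0\}$. $B=\mathcal{F}^{-1}((1+|\xi|^2)^{-1})$, $\mathcal{B}\varphi=B*\varphi$. $BC_a$: continuous functions with $|\varphi(x)|\le C|x|^a$ for large $|x|$; $\mathcal{Z}_{\infty,a}=C([0,\infty);BC_a)$. An s-solution of the zero-data problem is $0\le u$ with $\mu=e^tu\in\mathcal{Z}_{\infty,a}$ and $\mu(t)=\int_0^t\mathcal{B}\mu(\tau)d\tau+\int_0^te^{(1-p)\tau}\mathcal{B}[V\mu^p](\tau)d\tau$. A maximal s-solution is an s-solution dominating every s-solution pointwise; under the stated hypotheses it exists and is unique (a result of the same paper), and it is denoted $u_{*V}$. *)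

theory Defs
  imports "HOL-Analysis.Analysis"
begin

text \<open>Real power with the convention 0^0 = 1 (so |x|^sigma with sigma = 0 equals 1 everywhere).\<close>
definition rpow :: "real \<Rightarrow> real \<Rightarrow> real" where
  "rpow r e = (if r = 0 then (if e = 0 then 1 else 0) else r powr e)"

definition Jplus :: "nat \<Rightarrow> real set" where
  "Jplus n = (if n = 1 then {0} \<union> {1..} else {0..})"

text \<open>B is the Bessel kernel F^{-1}((1+|xi|^2)^{-1}): an integrable real function whose
  Fourier transform (convention F f(xi) = int e^{-i x.xi} f(x) dx) is (1+|xi|^2)^{-1}.
  B is thereby determined almost everywhere, which is all that matters below.\<close>
definition is_bessel_kernel :: "(real^'n \<Rightarrow> real) \<Rightarrow> bool" where
  "is_bessel_kernel B \<longleftrightarrow> integrable lebesgue B \<and>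
     (\<forall>\<xi>::real^'n. (\<integral>x. cis (- (x \<bullet> \<xi>)) * complex_of_real (B x) \<partial>lebesgue)
                   = complex_of_real (1 / (1 + (norm \<xi>)\<^sup>2)))"

definition bconv :: "(real^'n \<Rightarrow> real) \<Rightarrow> (real^'n \<Rightarrow> real) \<Rightarrow> real^'n \<Rightarrow> real" where
  "bconv B \<phi> x = (\<integral>y. B (x - y) * \<phi> y \<partial>lebesgue)"

definition BC :: "real \<Rightarrow> (real^'n \<Rightarrow> real) set" where
  "BC a = {\<phi>. continuous_on UNIV \<phi> \<and>
              (\<exists>C R. \<forall>x. norm x \<ge> R \<longrightarrow> \<bar>\<phi> x\<bar> \<le> C * rpow (norm x) a)}"

definition BC_norm :: "real \<Rightarrow> (real^'n \<Rightarrow> real) \<Rightarrow> real" where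
  "BC_norm a \<phi> = (SUP x. \<bar>\<phi> x\<bar> / (1 + norm x) powr a)"

definition Zinf :: "real \<Rightarrow> (real^'n \<Rightarrow> real \<Rightarrow> real) set" where
  "Zinf a = {u. (\<forall>t\<ge>0. (\<lambda>x. u x t) \<in> BC a) \<and>
               (\<forall>t\<ge>0. ((\<lambda>s. BC_norm a (\<lambda>x. u x s - u x t)) \<longlongrightarrow> 0) (at t within {0..}))}"

text \<open>s-solution of the zero-data problem
  d_t u - Delta d_t u = Delta u + V u^p, u(.,0) = 0.\<close>
definition s_solution ::
  "(real^'n \<Rightarrow> real) \<Rightarrow> (real^'n \<Rightarrow> real) \<Rightarrow> real \<Rightarrow> real \<Rightarrow> (real^'n \<Rightarrow> real \<Rightarrow> real) \<Rightarrow> bool" where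
  "s_solution B V p a u \<longleftrightarrow>
     (\<forall>x. \<forall>t\<ge>0. 0 \<le> u x t) \<and>
     (let \<mu> = (\<lambda>x t. exp t * u x t) in
        \<mu> \<in> Zinf a \<and>
        (\<forall>x. \<forall>t\<ge>0. \<mu> x t =
            (LINT \<tau>:{0..t}|lborel. bconv B (\<lambda>y. \<mu> y \<tau>) x)
          + (LINT \<tau>:{0..t}|lborel. exp ((1 - p) * \<tau>) * bconv B (\<lambda>y. V y * (\<mu> y \<tau>) powr p) x)))"

definition maximal_s_solution ::
  "(real^'n \<Rightarrow> real) \<Rightarrow> (real^'n \<Rightarrow> real) \<Rightarrow> real \<Rightarrow> real \<Rightarrow> (real^'n \<Rightarrow> real \<Rightarrow> real) \<Rightarrow> bool" where
  "maximal_s_solution B V p a u \<longleftrightarrow> s_solution B V p a u \<and>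
     (\<forall>w. s_solution B V p a w \<longrightarrow> (\<forall>x. \<forall>t\<ge>0. w x t \<le> u x t))"

end

theory Submission
  imports Defs "HOL-Probability.Probability"
begin

text \<open>
  The Bessel kernel \<open>B\<close> is the superposition of the Gaussian heat kernels \<open>h\<^sub>s\<close> with weight
  \<open>e\<^sup>-\<^sup>s ds\<close>; this identification rests on the injectivity of the Fourier transform on integrable
  functions, and it yields positivity, exponential moments and an exponential lower bound of \<open>B\<close>.

  Write \<open>\<mu> = e\<^sup>t u\<close> and let \<open>w(x,t) = (\<epsilon>\<^sub>0 vl (e\<^bsup>(1-p)t\<^esup> - 1))\<^bsup>1/(1-p)\<^esup> |x|\<^bsup>\<sigma>/(1-p)\<^esup>\<close>, where
  \<open>vl |x|\<^sup>\<sigma> \<le> V \<le> vu |x|\<^sup>\<sigma>\<close>. The hypothesis on \<open>\<epsilon>\<^sub>0\<close> makes \<open>w\<close> a subsolution of the integral equation.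
  A solution which is nonzero at arbitrarily small positive times lies above \<open>w\<close>: it dominates a multiple
  of \<open>e\<^bsup>-lam|x|\<^esup>\<close>, and feeding a bound \<open>C f\<close> into the integral equation replaces \<open>C\<close> by \<open>\<kappa> C\<^sup>p\<close>, whose
  iterates forget the initial constant, while the profile \<open>f\<close> improves first from \<open>e\<^bsup>-lam|x|\<^esup>\<close> to \<open>1\<close> and
  then from \<open>1\<close> to \<open>|x|\<^bsup>\<sigma>/(1-p)\<^esup>\<close>.

  Above \<open>w\<close> the nonlinearity is Lipschitz with a constant like \<open>p vu / (\<epsilon>\<^sub>0 vl (1-p) t)\<close> as \<open>t \<rightarrow> 0\<close>. Since
  \<open>p vu < \<epsilon>\<^sub>0 vl\<close>, the integral operator is a contraction for the norm with weight
  \<open>t\<^bsup>1/(1-p)\<^esup> e\<^bsup>Lt\<^esup> (R+|x|)\<^sup>a\<close> with \<open>R\<close> and \<open>L\<close> large. This gives a solution above \<open>w\<close>, so the maximal one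
  lies above \<open>w\<close>, and it gives uniqueness among such solutions. As \<open>V\<close> does not depend on time, an arbitrary
  nontrivial solution shifted by the last time up to which it vanishes is one of these.
\<close>

section \<open>Fourier analysis and the Bessel kernel\<close>

text \<open>The obstacle is that \<open>m powr p\<close> with \<open>p < 1\<close> is not Lipschitz
  at 0: the zero solution can branch at every time, so uniqueness can hold only above a positive
  barrier. The temporal weight is dictated by the singular Lipschitz constant. Integrating
  \<open>q * b / t\<close> against \<open>t powr b\<close>, with \<open>b = 1 / (1 - p)\<close>,
  returns \<open>q * t powr b\<close>, so the contraction factor is essentially
  \<open>q = p * vu / (\<epsilon>0 * vl)\<close>. The bounded part of the Lipschitz constant is
  absorbed by a large \<open>L\<close>, the loss from convolving the spatial weight by a large
  \<open>R\<close>. The difference of two solutions has finite weighted norm only because the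
  equation itself forces every solution to be of order \<open>t powr b\<close>. The exponents
  allowed in the hypothesis on \<open>\<epsilon>0\<close> are those met when the profile exponent is
  improved by \<open>d -> \<sigma> + d * p\<close>, starting from 0 and tending to
  \<open>\<sigma> / (1 - p)\<close>. Since \<open>B\<close> is known only almost everywhere, all
  estimates are made for a Borel representative \<open>K\<close> whose lower bound holds at every
  point.\<close>

lemma
  fixes f :: "'a::euclidean_space \<Rightarrow> real \<Rightarrow> 'b::{real_normed_field,banach,second_countable_topology}"
  assumes f: "\<And>b. b \<in> Basis \<Longrightarrow> integrable lborel (f b)"
  shows integrable_lborel_prod: "integrable lborel (\<lambda>x. \<Prod>b\<in>Basis. f b (x \<bullet> b))"
    and integral_lborel_prod:
      "(LBINT x. (\<Prod>b\<in>Basis. f b (x \<bullet> b))) = (\<Prod>b\<in>Basis. LBINT t. f b t)"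
proof -
  interpret product_sigma_finite "\<lambda>b::'a. lborel :: real measure" ..
  have [measurable]: "f b \<in> borel_measurable borel" if "b \<in> Basis" for b
    using f[OF that] by auto
  let ?T = "\<lambda>g::'a \<Rightarrow> real. \<Sum>b\<in>Basis. g b *\<^sub>R b"
  have T: "?T \<in> (\<Pi>\<^sub>M b\<in>Basis. lborel) \<rightarrow>\<^sub>M borel"
    by measurable
  have eq: "(\<Prod>b\<in>Basis. f b (?T g \<bullet> b)) = (\<Prod>b\<in>Basis. f b (g b))" for g
    by (intro prod.cong refl) (simp add: inner_sum_left_Basis)
  show "integrable lborel (\<lambda>x. \<Prod>b\<in>Basis. f b (x \<bullet> b))"
    by (subst lborel_eq, subst integrable_distr_eq[OF T])
       (auto simp: eq intro!: product_integrable_prod f)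
  show "(LBINT x. (\<Prod>b\<in>Basis. f b (x \<bullet> b))) = (\<Prod>b\<in>Basis. LBINT t. f b t)"
    by (subst lborel_eq, subst integral_distr[OF T])
       (auto simp: eq intro!: product_integral_prod f)
qed

lemma borel_measurable_cis [measurable]: "cis \<in> borel_measurable borel"
  by (intro borel_measurable_continuous_onI continuous_intros)

section \<open>Gaussian heat kernels and their Fourier transforms\<close>

text \<open>The fundamental solution of the heat equation at time \<open>s\<close>. It is written as
  a product of normal densities of variance \<open>2 * s\<close> so that integrals against it split
  over the coordinates.\<close>

definition heat :: "real \<Rightarrow> 'a::euclidean_space \<Rightarrow> real" where
  "heat s x = (\<Prod>b\<in>Basis. normal_density 0 (sqrt (2 * s)) (x \<bullet> b))"

lemma heat_nonneg [simp]: "0 \<le> heat s x"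
  by (simp add: heat_def prod_nonneg)

lemma borel_measurable_heat [measurable]: "heat s \<in> borel_measurable borel"
  unfolding heat_def by measurable

lemma heat_eq:
  fixes x :: "'a::euclidean_space"
  assumes "0 < s"
  shows "heat s x = (1 / sqrt (4 * pi * s)) ^ DIM('a) * exp (- (norm x)\<^sup>2 / (4 * s))"
proof -
  have "(norm x)\<^sup>2 = (\<Sum>b\<in>Basis. (x \<bullet> b)\<^sup>2)"
    unfolding power2_norm_eq_inner by (subst euclidean_inner) (simp add: power2_eq_square)
  then have "- (norm x)\<^sup>2 / (4 * s) = (\<Sum>b\<in>Basis. - (x \<bullet> b)\<^sup>2 / (4 * s))"
    by (simp add: sum_divide_distrib sum_negf)
  then have "exp (- (norm x)\<^sup>2 / (4 * s)) = (\<Prod>b\<in>Basis. exp (- (x \<bullet> b)\<^sup>2 / (4 * s)))"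
    by (simp add: exp_sum)
  then show ?thesis
    using assms unfolding heat_def normal_density_def
    by (simp add: prod.distrib mult_ac power_divide prod_dividef)
qed

text \<open>After the substitution x -> \<sigma> x the integral is the characteristic function of
  the standard normal law at \<open>- \<sigma> * t\<close>.\<close>

lemma normal_density_fourier:
  assumes "0 < \<sigma>"
  shows "(LBINT x. cis (- (x * t)) * complex_of_real (normal_density 0 \<sigma> x)) = exp (- (\<sigma> * t)\<^sup>2 / 2)"
proof -
  have "(LBINT x. cis (- (x * t)) * complex_of_real (normal_density 0 \<sigma> x))
      = \<sigma> * (LBINT x. cis (- ((0 + \<sigma> * x) * t)) * complex_of_real (normal_density 0 \<sigma> (0 + \<sigma> * x)))"
    using assms by (subst lborel_integral_real_affine[of \<sigma> _ 0]) (auto simp: scaleR_conv_of_real)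
  also have "\<dots> = (LBINT x. \<sigma> * (cis (- ((0 + \<sigma> * x) * t)) * complex_of_real (normal_density 0 \<sigma> (0 + \<sigma> * x))))"
    by simp
  also have "\<dots> = (LBINT x. std_normal_density x *\<^sub>R cis (- \<sigma> * t * x))"
  proof (intro Bochner_Integration.integral_cong refl)
    fix x
    have "\<sigma> * normal_density 0 \<sigma> (\<sigma> * x) = std_normal_density x"
      using assms by (simp add: normal_density_def power_mult_distrib real_sqrt_mult)
    then have "complex_of_real \<sigma> * complex_of_real (normal_density 0 \<sigma> (\<sigma> * x)) = std_normal_density x"
      by (metis of_real_mult)
    then show "\<sigma> * (cis (- ((0 + \<sigma> * x) * t)) * complex_of_real (normal_density 0 \<sigma> (0 + \<sigma> * x)))
        = std_normal_density x *\<^sub>R cis (- \<sigma> * t * x)"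
      by (simp add: scaleR_conv_of_real mult_ac)
  qed
  also have "\<dots> = char std_normal_distribution (- \<sigma> * t)"
    unfolding char_def
    by (subst integral_density) (auto simp: cis_conv_exp mult_ac)
  finally show ?thesis
    by (simp add: char_std_normal_distribution power_mult_distrib exp_of_real)
qed

lemma cis_sum: "finite A \<Longrightarrow> cis (sum f A) = (\<Prod>i\<in>A. cis (f i))"
  by (induction A rule: finite_induct) (auto simp: cis_mult[symmetric])

lemma
  fixes \<xi> :: "'a::euclidean_space"
  assumes s: "0 < s"
  shows integrable_heat: "integrable lborel (heat s :: 'a \<Rightarrow> real)"
    and integral_heat: "(LBINT x. heat s (x::'a)) = 1"
    and heat_fourier: "(LBINT x. cis (- (x \<bullet> \<xi>)) * complex_of_real (heat s x))
                        = exp (- s * (norm \<xi>)\<^sup>2)"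
proof -
  have [simp]: "0 < sqrt (2 * s)" using s by simp
  show "integrable lborel (heat s :: 'a \<Rightarrow> real)"
    unfolding heat_def[abs_def] by (rule integrable_lborel_prod) (use s in simp)
  show "(LBINT x. heat s (x::'a)) = 1"
    unfolding heat_def by (subst integral_lborel_prod) (use s in simp_all)
  have eq: "cis (- (x \<bullet> \<xi>)) * complex_of_real (heat s x)
     = (\<Prod>b\<in>Basis. cis (- ((x \<bullet> b) * (\<xi> \<bullet> b))) * complex_of_real (normal_density 0 (sqrt (2 * s)) (x \<bullet> b)))" for x
    by (simp add: heat_def prod.distrib euclidean_inner[of x \<xi>] sum_negf[symmetric] cis_sum)
  have int: "integrable lborel (\<lambda>x. cis (- (x * c)) * complex_of_real (normal_density 0 (sqrt (2 * s)) x))" for c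
    by (rule Bochner_Integration.integrable_bound[of _ "normal_density 0 (sqrt (2 * s))"])
       (use s in \<open>auto simp: norm_mult\<close>)
  have n2: "(norm \<xi>)\<^sup>2 = (\<Sum>b\<in>Basis. (\<xi> \<bullet> b)\<^sup>2)"
    unfolding power2_norm_eq_inner by (subst euclidean_inner) (simp add: power2_eq_square)
  show "(LBINT x. cis (- (x \<bullet> \<xi>)) * complex_of_real (heat s x)) = exp (- s * (norm \<xi>)\<^sup>2)"
    unfolding eq using s
    by (subst integral_lborel_prod[OF int])
       (simp_all add: normal_density_fourier power_mult_distrib n2 sum_distrib_left sum_negf[symmetric] exp_sum)
qed

section \<open>Injectivity of the Fourier transform on integrable functions\<close>

text \<open>The Gaussian is itself a Fourier transform:
  \<open>exp (- r * (norm (x - y))\<^sup>2)\<close> is the integral over \<xi> of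
  \<open>cis (- (\<xi> \<bullet> (x - y))) * heat r \<xi>\<close>. Exchanging the integrals puts the
  Fourier transform of \<open>f\<close> inside, which vanishes.\<close>

lemma gaussian_test_eq_0:
  fixes f :: "'a::euclidean_space \<Rightarrow> real"
  assumes f: "integrable lborel f"
    and F: "\<And>\<xi>. (LBINT x. cis (- (x \<bullet> \<xi>)) * complex_of_real (f x)) = 0"
    and r: "0 < r"
  shows "(LBINT y. f y * exp (- r * (norm (x - y))\<^sup>2)) = 0"
proof -
  have [measurable]: "f \<in> borel_measurable borel" using f by auto
  define k where "k = (\<lambda>y \<xi>. complex_of_real (f y) * (cis (- (\<xi> \<bullet> (x - y))) * complex_of_real (heat r \<xi>)))"
  have nk: "norm (k y \<xi>) = norm (f y) * heat r \<xi>" for y \<xi>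
    by (simp add: k_def norm_mult)
  have [measurable]: "case_prod k \<in> borel_measurable (lborel \<Otimes>\<^sub>M lborel)"
    unfolding k_def by measurable
  have k0: "(LBINT y. k y \<xi>) = 0" for \<xi>
  proof -
    have e: "cis (- (\<xi> \<bullet> (x - y))) = cis (- (\<xi> \<bullet> x)) * cis (- (y \<bullet> (- \<xi>)))" for y
      by (simp add: cis_mult inner_diff_right inner_commute)
    have "k y \<xi> = (cis (- (\<xi> \<bullet> x)) * heat r \<xi>) * (cis (- (y \<bullet> (- \<xi>))) * f y)" for y
      unfolding k_def e by (simp add: mult_ac)
    then show ?thesis
      using F[of "- \<xi>"] by simp
  qed
  have "complex_of_real (LBINT y. f y * exp (- r * (norm (x - y))\<^sup>2))
      = (LBINT y. complex_of_real (f y) * exp (- r * (norm (x - y))\<^sup>2))"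
    by (subst integral_complex_of_real[symmetric]) (simp add: exp_of_real)
  also have "\<dots> = (LBINT y. \<integral>\<xi>. k y \<xi> \<partial>lborel)"
    unfolding k_def by (subst heat_fourier[OF r, symmetric]) simp
  also have "\<dots> = (LBINT \<xi>. \<integral>y. k y \<xi> \<partial>lborel)"
  proof (rule lborel_pair.Fubini_integral[symmetric], rule lborel_pair.Fubini_integrable)
    show "integrable lborel (\<lambda>y. LBINT \<xi>. norm (case (y, \<xi>) of (x, xa) \<Rightarrow> k x xa))"
      using f by (simp add: nk integral_heat[OF r])
    show "AE y in lborel. integrable lborel (\<lambda>\<xi>. case (y, \<xi>) of (x, xa) \<Rightarrow> k x xa)"
    proof (rule AE_I2)
      fix y
      show "integrable lborel (\<lambda>\<xi>. case (y, \<xi>) of (x, xa) \<Rightarrow> k x xa)"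
        by (rule Bochner_Integration.integrable_bound[where f="\<lambda>\<xi>. norm (f y) * heat r \<xi>"])
           (simp_all add: nk integrable_heat[OF r])
    qed
  qed (simp add: k_def)
  also have "\<dots> = 0" by (simp add: k0)
  finally show ?thesis by simp
qed

text \<open>The indicator of the box is smoothed by Gaussians of width about 1/k. Each smoothed
  function \<open>H k\<close> is a superposition of translated Gaussians, so \<open>f\<close>
  integrates to 0 against it. Dominated convergence gives the limit, because the indicator is
  continuous off the frontier of the box, a null set.\<close>

lemma integral_box_eq_0:
  fixes f :: "'a::euclidean_space \<Rightarrow> real"
  assumes f: "integrable lborel f"
    and F: "\<And>\<xi>. (LBINT x. cis (- (x \<bullet> \<xi>)) * complex_of_real (f x)) = 0"
  shows "(LBINT y. f y * indicator (box l u) y) = 0"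
proof -
  have [measurable]: "f \<in> borel_measurable borel" using f by auto
  define \<phi> :: "'a \<Rightarrow> real" where "\<phi> = indicator (box l u)"
  have [measurable]: "\<phi> \<in> borel_measurable borel" by (simp add: \<phi>_def)
  have \<phi>01: "\<bar>\<phi> x\<bar> \<le> 1" for x by (auto simp: \<phi>_def indicator_def)
  \<comment> \<open>At time 1/4 the Gaussian exponent is exactly \<open>- (norm z)\<^sup>2\<close>
    and the normalising factor is a power of \<open>1 / sqrt pi\<close>.\<close>
  define g :: "'a \<Rightarrow> real" where "g = heat (1/4)"
  have g: "integrable lborel g" "(LBINT x. g x) = 1" "\<And>x. 0 \<le> g x"
    and [measurable]: "g \<in> borel_measurable borel"
    by (simp_all add: g_def integrable_heat integral_heat)
  define H where "H = (\<lambda>k y. LBINT z. \<phi> (y + (1 / real (Suc k)) *\<^sub>R z) * g z)"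
  have [measurable]: "H k \<in> borel_measurable borel" for k
    unfolding H_def by measurable
  have H_le: "\<bar>H k y\<bar> \<le> 1" for k y
  proof -
    have "\<bar>H k y\<bar> \<le> (LBINT z. \<bar>\<phi> (y + (1 / real (Suc k)) *\<^sub>R z) * g z\<bar>)"
      unfolding H_def by (rule integral_abs_bound)
    also have "\<dots> \<le> (LBINT z. g z)"
      by (rule integral_mono') (use g \<phi>01 in \<open>auto simp: abs_mult intro: mult_left_le_one_le\<close>)
    finally show ?thesis using g by simp
  qed
  have H0: "(LBINT y. f y * H k y) = 0" for k
  proof -
    define c where "c = real (Suc k)"
    have c: "0 < c" by (simp add: c_def)
    define C where "C = c ^ DIM('a) * (1 / sqrt pi) ^ DIM('a)"
    have Hk: "H k y = (LBINT x. C * (\<phi> x * exp (- c\<^sup>2 * (norm (x - y))\<^sup>2)))" for y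
    proof -
      \<comment> \<open>Substitution z = c (x - y): it moves the dependence on \<open>y\<close> from
        the indicator to the Gaussian.\<close>
      have "H k y = (LBINT x. c ^ DIM('a) *\<^sub>R (\<phi> (y + (1 / c) *\<^sub>R ((- c) *\<^sub>R y + c *\<^sub>R x)) * g ((- c) *\<^sub>R y + c *\<^sub>R x)))"
        unfolding H_def c_def[symmetric]
        using c by (subst lborel_affine[of c "(- c) *\<^sub>R y"])
             (simp_all add: integral_density integral_distr)
      also have "\<dots> = (LBINT x. C * (\<phi> x * exp (- c\<^sup>2 * (norm (x - y))\<^sup>2)))"
      proof (intro Bochner_Integration.integral_cong refl)
        fix x
        have e: "(- c) *\<^sub>R y + c *\<^sub>R x = c *\<^sub>R (x - y)" by (simp add: scaleR_diff_right)
        show "c ^ DIM('a) *\<^sub>R (\<phi> (y + (1 / c) *\<^sub>R ((- c) *\<^sub>R y + c *\<^sub>R x)) * g ((- c) *\<^sub>R y + c *\<^sub>R x))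
          = C * (\<phi> x * exp (- c\<^sup>2 * (norm (x - y))\<^sup>2))"
          unfolding e using c by (simp add: C_def g_def heat_eq power_mult_distrib)
      qed
      finally show ?thesis .
    qed
    have \<phi>int: "integrable lborel \<phi>"
      unfolding \<phi>_def by (intro integrable_real_indicator) (simp_all add: emeasure_lborel_box_eq)
    have "(LBINT y. f y * H k y)
        = (LBINT y. \<integral>x. C * (\<phi> x * (f y * exp (- c\<^sup>2 * (norm (x - y))\<^sup>2))) \<partial>lborel)"
      unfolding Hk by (subst integral_mult_right_zero[symmetric]) (simp add: mult_ac)
    also have "\<dots> = (LBINT x. \<integral>y. C * (\<phi> x * (f y * exp (- c\<^sup>2 * (norm (x - y))\<^sup>2))) \<partial>lborel)"
    proof (rule lborel_pair.Fubini_integral[symmetric])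
      have "integrable (lborel \<Otimes>\<^sub>M lborel) (\<lambda>(y, x). f y * \<phi> x)"
      proof (rule lborel_pair.Fubini_integrable)
        show "AE x in lborel. integrable lborel (\<lambda>y. case (x, y) of (y, x) \<Rightarrow> f y * \<phi> x)"
          using \<phi>int by simp
        show "integrable lborel (\<lambda>x. LBINT y. norm (case (x, y) of (y, x) \<Rightarrow> f y * \<phi> x))"
          using f by (simp add: abs_mult)
      qed measurable
      then have "integrable (lborel \<Otimes>\<^sub>M lborel) (\<lambda>z. C * (case z of (y, x) \<Rightarrow> f y * \<phi> x))"
        by simp
      then show "integrable (lborel \<Otimes>\<^sub>M lborel) (\<lambda>(y, x). C * (\<phi> x * (f y * exp (- c\<^sup>2 * (norm (x - y))\<^sup>2))))"
      proof (rule Bochner_Integration.integrable_bound)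
        show "AE z in lborel \<Otimes>\<^sub>M lborel. norm (case z of (y, x) \<Rightarrow> C * (\<phi> x * (f y * exp (- c\<^sup>2 * (norm (x - y))\<^sup>2))))
          \<le> norm (C * (case z of (y, x) \<Rightarrow> f y * \<phi> x))"
        proof (rule AE_I2, clarify)
          fix y x :: 'a
          have "\<bar>C\<bar> * (\<bar>\<phi> x\<bar> * (\<bar>f y\<bar> * exp (- c\<^sup>2 * (norm (x - y))\<^sup>2))) \<le> \<bar>C\<bar> * (\<bar>\<phi> x\<bar> * (\<bar>f y\<bar> * 1))"
            by (intro mult_left_mono) auto
          then show "norm (C * (\<phi> x * (f y * exp (- c\<^sup>2 * (norm (x - y))\<^sup>2)))) \<le> norm (C * (f y * \<phi> x))"
            by (simp add: abs_mult mult_ac)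
        qed
      qed measurable
    qed
    also have "\<dots> = 0"
      using gaussian_test_eq_0[OF f F, of "c\<^sup>2"] c by simp
    finally show ?thesis .
  qed
  have "(\<lambda>k. LBINT y. f y * H k y) \<longlonglongrightarrow> (LBINT y. f y * \<phi> y)"
  proof (rule integral_dominated_convergence[where w="\<lambda>y. \<bar>f y\<bar>"])
    have "frontier (box l u) \<in> null_sets lebesgue"
      by (simp add: negligible_convex_frontier flip: negligible_iff_null_sets)
    then have "AE y in lborel. y \<notin> frontier (box l u)"
      by (intro AE_not_in) (simp add: null_sets_completion_iff borel_closed frontier_closed)
    then show "AE y in lborel. (\<lambda>k. f y * H k y) \<longlonglongrightarrow> f y * \<phi> y"
    proof eventually_elim
      fix y assume y: "y \<notin> frontier (box l u)"
      then have cont: "isCont \<phi> y" by (simp add: \<phi>_def isCont_indicator)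
      have "(\<lambda>k. H k y) \<longlonglongrightarrow> (LBINT z. \<phi> y * g z)"
        unfolding H_def
      proof (rule integral_dominated_convergence[where w=g])
        show "AE z in lborel. (\<lambda>k. \<phi> (y + (1 / real (Suc k)) *\<^sub>R z) * g z) \<longlonglongrightarrow> \<phi> y * g z"
        proof (rule AE_I2)
          fix z :: 'a
          have "(\<lambda>k. y + (1 / real (Suc k)) *\<^sub>R z) \<longlonglongrightarrow> y + 0 *\<^sub>R z"
            by (intro tendsto_intros LIMSEQ_Suc[OF lim_1_over_n])
          then have "(\<lambda>k. \<phi> (y + (1 / real (Suc k)) *\<^sub>R z)) \<longlonglongrightarrow> \<phi> y"
            using isCont_tendsto_compose[OF cont] by simp
          then show "(\<lambda>k. \<phi> (y + (1 / real (Suc k)) *\<^sub>R z) * g z) \<longlonglongrightarrow> \<phi> y * g z"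
            by (intro tendsto_intros)
        qed
        show "AE z in lborel. norm (\<phi> (y + (1 / real (Suc k)) *\<^sub>R z) * g z) \<le> g z" for k
        proof (rule AE_I2)
          fix z
          show "norm (\<phi> (y + (1 / real (Suc k)) *\<^sub>R z) * g z) \<le> g z"
            using mult_left_le_one_le[OF g(3)[of z] abs_ge_zero \<phi>01] g(3)[of z] by (simp add: abs_mult)
        qed
      qed (use g in simp_all)
      then show "(\<lambda>k. f y * H k y) \<longlonglongrightarrow> f y * \<phi> y"
        using g by (auto intro!: tendsto_intros)
    qed
    show "AE y in lborel. norm (f y * H k y) \<le> \<bar>f y\<bar>" for k
    proof (rule AE_I2)
      fix y
      show "norm (f y * H k y) \<le> \<bar>f y\<bar>"
        using mult_left_le[OF H_le abs_ge_zero] by (simp add: abs_mult)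
    qed
  qed (use f in simp_all)
  then have "(\<lambda>k. 0) \<longlonglongrightarrow> (LBINT y. f y * \<phi> y)" by (simp add: H0)
  then show ?thesis unfolding \<phi>_def by (simp add: LIMSEQ_const_iff)
qed

text \<open>The Borel sets over which \<open>f\<close> integrates to 0 form a Dynkin system
  containing the boxes, which are stable under intersection and generate. The complement step uses
  that the total integral is 0, being the Fourier transform at the origin.\<close>

lemma AE_eq_0_if_fourier_eq_0:
  fixes f :: "'a::euclidean_space \<Rightarrow> real"
  assumes f: "integrable lborel f"
    and F: "\<And>\<xi>. (LBINT x. cis (- (x \<bullet> \<xi>)) * complex_of_real (f x)) = 0"
  shows "AE x in lborel. f x = 0"
proof -
  let ?E = "range (\<lambda>(a, b). box a b::'a set)"
  have si: "set_integrable lborel A f" if "A \<in> sets borel" for A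
    using integrable_mult_indicator[of A lborel f] that f by (simp add: set_integrable_def)
  have int0: "(LINT x|lborel. f x) = 0"
    using F[of 0] by (simp flip: cis_zero)
  have stable: "Int_stable ?E" and sub: "?E \<subseteq> Pow UNIV" by (auto simp: Int_stable_def box_Int_box)
  have "(LINT x:A|lborel. f x) = 0" if "A \<in> sigma_sets UNIV ?E" for A
    using stable sub that
  proof (induction rule: sigma_sets_induct_disjoint)
    case (basic A)
    then show ?case
      using integral_box_eq_0[OF f F] by (auto simp: set_lebesgue_integral_def mult.commute)
  next
    case (compl A)
    then have A: "A \<in> sets borel" by (simp add: borel_eq_box)
    have "(LINT x:UNIV|lborel. f x) = (LINT x:A|lborel. f x) + (LINT x:UNIV - A|lborel. f x)"
      by (subst set_integral_Un[symmetric]) (use A si in auto)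
    with compl show ?case by (simp add: int0 set_lebesgue_integral_def[of _ UNIV])
  next
    case (union A)
    then have A: "A i \<in> sets borel" for i by (auto simp: borel_eq_box)
    show ?case
      using union A si by (subst lebesgue_integral_countable_add) (auto simp: disjoint_family_on_def)
  qed (simp add: set_lebesgue_integral_def)
  then have "(LINT x:A|lborel. f x) = (LINT x:A|lborel. 0)" if "A \<in> sets lborel" for A
    using that by (simp add: borel_eq_box set_lebesgue_integral_def)
  from density_unique_real[OF f _ this] show ?thesis by simp
qed

section \<open>The Bessel kernel as a superposition of heat kernels\<close>

lemma has_bochner_integral_exp_decay:
  fixes c :: real
  assumes "0 < c"
  shows "has_bochner_integral lborel (\<lambda>s. indicator {0<..} s * exp (- (c * s))) (1 / c)"
proof -
  have "(\<integral>\<^sup>+s. ennreal (exp (- (c * s))) * indicator {0..} s \<partial>lborel) = ennreal (0 - (- (exp (- (c * 0)) / c)))"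
  proof (rule nn_integral_FTC_atLeast[where F="\<lambda>s. - (exp (- (c * s)) / c)"])
    have "((\<lambda>s. - (exp (- (c * s)) / c)) \<longlongrightarrow> - (0 / c)) at_top"
    proof (intro tendsto_intros filterlim_compose[OF exp_at_bot])
      show "LIM s at_top. - (c * s) :> at_bot"
        using assms by (simp add: filterlim_uminus_at_bot filterlim_tendsto_pos_mult_at_top[OF tendsto_const _ filterlim_ident])
    qed (use assms in auto)
    then show "((\<lambda>s. - (exp (- (c * s)) / c)) \<longlongrightarrow> 0) at_top" by simp
  qed (use assms in \<open>auto intro!: derivative_eq_intros\<close>)
  also have "\<dots> = ennreal (1 / c)" by simp
  also have "(\<integral>\<^sup>+s. ennreal (exp (- (c * s))) * indicator {0..} s \<partial>lborel)
      = (\<integral>\<^sup>+s. ennreal (indicator {0<..} s * exp (- (c * s))) \<partial>lborel)"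
  proof (rule nn_integral_cong_AE)
    show "AE s in lborel. ennreal (exp (- (c * s))) * indicator {0..} s = ennreal (indicator {0<..} s * exp (- (c * s)))"
      using AE_lborel_singleton[of "0::real"] by eventually_elim (auto simp: indicator_def)
  qed
  finally show ?thesis
    using assms by (intro has_bochner_integral_nn_integral) auto
qed

text \<open>The norm is at most the sum of the absolute coordinates, so the exponential factors over
  the coordinates, and \<open>exp (\<bar>\<epsilon>\<bar> * \<bar>t\<bar>)\<close> is at most the
  sum of the two one-sided exponentials in \<open>q\<close>. Completing the square turns each tilted
  normal density into a shifted one times \<open>exp (\<epsilon>\<^sup>2 * s)\<close>.\<close>

lemma
  fixes s \<epsilon> :: real
  assumes s: "0 < s"
  shows integrable_heat_exp: "integrable lborel (\<lambda>x::'a::euclidean_space. heat s x * exp (\<epsilon> * norm x))"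
    and integral_heat_exp_le:
      "(LBINT (x::'a). heat s x * exp (\<epsilon> * norm x)) \<le> 2 ^ DIM('a) * exp (DIM('a) * \<epsilon>\<^sup>2 * s)"
proof -
  define q where "q = (\<lambda>t::real. normal_density 0 (sqrt (2 * s)) t * (exp (\<bar>\<epsilon>\<bar> * t) + exp (- (\<bar>\<epsilon>\<bar> * t))))"
  have shift: "normal_density 0 (sqrt (2 * s)) t * exp (c * t) = exp (c\<^sup>2 * s) * normal_density (2 * s * c) (sqrt (2 * s)) t" for c t
    using s by (simp add: normal_density_def exp_add[symmetric] mult_exp_exp field_simps power2_eq_square)
  have q_eq: "q = (\<lambda>t. exp (\<epsilon>\<^sup>2 * s) * normal_density (2 * s * \<bar>\<epsilon>\<bar>) (sqrt (2 * s)) t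
             + exp (\<epsilon>\<^sup>2 * s) * normal_density (2 * s * - \<bar>\<epsilon>\<bar>) (sqrt (2 * s)) t)"
    unfolding q_def distrib_left using shift[of _ "\<bar>\<epsilon>\<bar>"] shift[of _ "- \<bar>\<epsilon>\<bar>"] by simp
  have q: "integrable lborel q" "(LBINT t. q t) = 2 * exp (\<epsilon>\<^sup>2 * s)"
    unfolding q_eq using s by simp_all
  have Q: "integrable lborel (\<lambda>x::'a. \<Prod>b\<in>Basis. q (x \<bullet> b))"
    "(LBINT (x::'a). (\<Prod>b\<in>Basis. q (x \<bullet> b))) = (2 * exp (\<epsilon>\<^sup>2 * s)) ^ DIM('a)"
    using integrable_lborel_prod[of "\<lambda>_. q"] integral_lborel_prod[of "\<lambda>_. q"] q by simp_all
  have le: "heat s x * exp (\<epsilon> * norm x) \<le> (\<Prod>b\<in>Basis. q (x \<bullet> b))" for x :: 'a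
  proof -
    have "\<epsilon> * norm x \<le> \<bar>\<epsilon>\<bar> * norm x" by (simp add: mult_right_mono)
    also have "\<dots> \<le> \<bar>\<epsilon>\<bar> * (\<Sum>b\<in>Basis. \<bar>x \<bullet> b\<bar>)" by (intro mult_left_mono norm_le_l1) auto
    finally have "exp (\<epsilon> * norm x) \<le> (\<Prod>b\<in>Basis. exp (\<bar>\<epsilon>\<bar> * \<bar>x \<bullet> b\<bar>))"
      by (simp add: exp_sum[symmetric] sum_distrib_left)
    then have "heat s x * exp (\<epsilon> * norm x) \<le> heat s x * (\<Prod>b\<in>Basis. exp (\<bar>\<epsilon>\<bar> * \<bar>x \<bullet> b\<bar>))"
      by (rule mult_left_mono) simp
    also have "\<dots> \<le> (\<Prod>b\<in>Basis. q (x \<bullet> b))"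
      unfolding heat_def prod.distrib[symmetric] q_def
      by (intro prod_mono conjI mult_left_mono mult_nonneg_nonneg) (auto simp: abs_if)
    finally show ?thesis .
  qed
  show int: "integrable lborel (\<lambda>x::'a. heat s x * exp (\<epsilon> * norm x))"
    by (rule Bochner_Integration.integrable_bound[OF Q(1)]) (auto intro!: AE_I2 order_trans[OF le])
  have "(LBINT (x::'a). heat s x * exp (\<epsilon> * norm x)) \<le> (LBINT (x::'a). (\<Prod>b\<in>Basis. q (x \<bullet> b)))"
    by (intro integral_mono int Q le)
  also have "\<dots> = 2 ^ DIM('a) * exp (DIM('a) * \<epsilon>\<^sup>2 * s)"
    unfolding Q by (simp add: power_mult_distrib exp_of_nat_mult[symmetric] mult_ac)
  finally show "(LBINT (x::'a). heat s x * exp (\<epsilon> * norm x)) \<le> 2 ^ DIM('a) * exp (DIM('a) * \<epsilon>\<^sup>2 * s)" .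
qed

text \<open>In dimension at least two the integral diverges at the origin, where the value is then 0 by convention;
  the pointwise lower bound below therefore holds only almost everywhere.\<close>

definition bessel_kernel :: "'a::euclidean_space \<Rightarrow> real" where
  "bessel_kernel x = (LBINT s. indicator {0<..} s * (exp (- s) * heat s x))"

lemma borel_measurable_bessel_kernel [measurable]:
  "bessel_kernel \<in> borel_measurable (borel :: 'a::euclidean_space measure)"
  unfolding bessel_kernel_def heat_def normal_density_def by measurable

text \<open>The bound on \<epsilon> keeps the exponential moment of the heat kernel below a multiple
  of \<open>exp (s / 2)\<close>, so that the weight \<open>exp (- s)\<close> still leaves an
  integrable \<open>exp (- s / 2)\<close>.\<close>

lemma integrable_subordinated_heat_exp:
  fixes \<epsilon> :: real
  assumes \<epsilon>: "DIM('a) * \<epsilon>\<^sup>2 \<le> 1/2"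
  shows "integrable (lborel \<Otimes>\<^sub>M lborel)
    (\<lambda>(s, x::'a::euclidean_space). indicator {0<..} s * (exp (- s) * (heat s x * exp (\<epsilon> * norm x))))"
    (is "integrable _ ?k")
proof (rule lborel_pair.Fubini_integrable)
  show [measurable]: "?k \<in> borel_measurable (lborel \<Otimes>\<^sub>M lborel)"
    unfolding heat_def normal_density_def by measurable
  show "AE s in lborel. integrable lborel (\<lambda>x::'a. ?k (s, x))"
  proof (rule AE_I2)
    fix s :: real
    show "integrable lborel (\<lambda>x::'a. ?k (s, x))"
      by (cases "0 < s") (simp_all add: integrable_heat_exp)
  qed
  have J: "0 \<le> (LBINT (x::'a). norm (?k (s, x))) \<and>
      (LBINT (x::'a). norm (?k (s, x))) \<le> 2 ^ DIM('a) * (indicator {0<..} s * exp (- (1/2 * s)))" for s :: real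
  proof (cases "0 < s")
    case True
    have "DIM('a) * \<epsilon>\<^sup>2 * s \<le> 1/2 * s" using \<epsilon> True by (intro mult_right_mono) auto
    then have "exp (- s) * exp (DIM('a) * \<epsilon>\<^sup>2 * s) \<le> exp (- (1/2 * s))"
      by (simp add: mult_exp_exp)
    then have "exp (- s) * (2 ^ DIM('a) * exp (DIM('a) * \<epsilon>\<^sup>2 * s)) \<le> 2 ^ DIM('a) * exp (- (1/2 * s))"
      by (simp add: mult.left_commute)
    moreover have "exp (- s) * (LBINT (x::'a). heat s x * exp (\<epsilon> * norm x))
        \<le> exp (- s) * (2 ^ DIM('a) * exp (DIM('a) * \<epsilon>\<^sup>2 * s))"
      by (intro mult_left_mono integral_heat_exp_le True) auto
    ultimately have "exp (- s) * (LBINT (x::'a). heat s x * exp (\<epsilon> * norm x)) \<le> 2 ^ DIM('a) * exp (- (1/2 * s))"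
      by (rule order_trans[rotated])
    then show ?thesis using True by (simp add: abs_mult)
  qed simp
  have "integrable lborel (\<lambda>s::real. 2 ^ DIM('a) * (indicator {0<..} s * exp (- (1/2 * s))))"
    using has_bochner_integral_exp_decay[of "1/2"] by (intro integrable_mult_right) (auto simp: has_bochner_integral_iff)
  then show "integrable lborel (\<lambda>s. LBINT (x::'a). norm (?k (s, x)))"
  proof (rule Bochner_Integration.integrable_bound)
    show "AE s in lborel. norm (LBINT (x::'a). norm (?k (s, x)))
       \<le> norm (2 ^ DIM('a) * (indicator {0<..} s * exp (- (1/2 * s))) :: real)"
      using J by (intro AE_I2) (smt (verit) real_norm_def)
  qed measurable
qed

lemma integrable_subordinated_heat:
  "integrable (lborel \<Otimes>\<^sub>M lborel) (\<lambda>(s, x::'a::euclidean_space). indicator {0<..} s * (exp (- s) * heat s x))"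
  using integrable_subordinated_heat_exp[of 0, where 'a='a] by simp

text \<open>By Fubini this is the identity
  \<open>1 / (1 + r) = \<integral> exp (- s) * exp (- s * r) ds\<close> over s > 0, with
  \<open>r\<close> the squared norm of \<xi>.\<close>

lemma bessel_kernel_fourier:
  fixes \<xi> :: "'a::euclidean_space"
  shows "(LBINT x. cis (- (x \<bullet> \<xi>)) * complex_of_real (bessel_kernel x)) = 1 / (1 + (norm \<xi>)\<^sup>2)"
proof -
  define k where "k = (\<lambda>s (x::'a). indicator {0<..} s * (exp (- s) * heat s x) :: real)"
  have [measurable]: "case_prod k \<in> borel_measurable (lborel \<Otimes>\<^sub>M lborel)"
    unfolding k_def heat_def normal_density_def by measurable
  have "(LBINT x. cis (- (x \<bullet> \<xi>)) * complex_of_real (bessel_kernel x))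
     = (LBINT x. \<integral>s. cis (- (x \<bullet> \<xi>)) * complex_of_real (k s x) \<partial>lborel)"
    unfolding bessel_kernel_def k_def by (simp flip: integral_complex_of_real)
  also have "\<dots> = (LBINT s. \<integral>x. cis (- (x \<bullet> \<xi>)) * complex_of_real (k s x) \<partial>lborel)"
  proof (rule lborel_pair.Fubini_integral)
    have "integrable (lborel \<Otimes>\<^sub>M lborel) (case_prod k)"
      using integrable_subordinated_heat[where 'a='a] by (simp add: k_def)
    then show "integrable (lborel \<Otimes>\<^sub>M lborel) (\<lambda>(s, x). cis (- (x \<bullet> \<xi>)) * complex_of_real (k s x))"
      by (rule Bochner_Integration.integrable_bound) (auto simp: norm_mult case_prod_beta)
  qed
  also have "\<dots> = (LBINT s. complex_of_real (indicator {0<..} s * exp (- ((1 + (norm \<xi>)\<^sup>2) * s))))"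
  proof (intro Bochner_Integration.integral_cong refl)
    fix s :: real
    show "(LBINT x. cis (- (x \<bullet> \<xi>)) * complex_of_real (k s x))
      = complex_of_real (indicator {0<..} s * exp (- ((1 + (norm \<xi>)\<^sup>2) * s)))"
    proof (cases "0 < s")
      case True
      have "(LBINT x. cis (- (x \<bullet> \<xi>)) * complex_of_real (k s x))
        = (LBINT x. exp (- s) * (cis (- (x \<bullet> \<xi>)) * complex_of_real (heat s x)))"
        using True by (simp add: k_def mult_ac exp_of_real flip: of_real_exp)
      also have "\<dots> = exp (- s) * exp (- s * (norm \<xi>)\<^sup>2)"
        by (subst integral_mult_right_zero, subst heat_fourier[OF True]) (simp add: exp_of_real)
      finally show ?thesis using True by (simp add: mult_exp_exp algebra_simps flip: exp_of_real exp_add)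
    qed (simp add: k_def)
  qed
  also have "\<dots> = 1 / (1 + (norm \<xi>)\<^sup>2)"
    using has_bochner_integral_exp_decay[of "1 + (norm \<xi>)\<^sup>2"] sum_power2_gt_zero_iff[of 1 "norm \<xi>"]
    by (subst integral_complex_of_real) (simp add: has_bochner_integral_iff)
  finally show ?thesis .
qed

text \<open>Only the times \<open>s\<close> between \<open>r + 1\<close> and \<open>r + 2\<close>,
  where \<open>r = norm x\<close>, are kept. There \<open>exp (- s)\<close> and the Gaussian factor
  each cost one \<open>exp (- r)\<close>, and the normalising factor costs one per dimension, whence
  the rate \<open>DIM('a) + 2\<close>. Fubini provides integrability in \<open>s\<close> for almost
  every \<open>x\<close>.\<close>

lemma AE_bessel_kernel_ge:
  "AE x::'a::euclidean_space in lborel.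
     exp (- 2) * (1 / (8 * pi)) ^ DIM('a) * exp (- (real DIM('a) + 2) * norm x) \<le> bessel_kernel x"
  using lborel_pair.AE_integrable_snd[OF integrable_subordinated_heat[where 'a='a]]
proof eventually_elim
  fix x :: 'a
  assume int: "integrable lborel (\<lambda>s. indicator {0<..} s * (exp (- s) * heat s x))"
  define r where "r = norm x"
  have r: "0 \<le> r" by (simp add: r_def)
  define l where "l = exp (- 2) * (1 / (8 * pi)) ^ DIM('a) * exp (- (real DIM('a) + 2) * r)"
  have "l = (LBINT s. indicator {r + 1..r + 2} s * l)" by simp
  also have "\<dots> \<le> bessel_kernel x"
    unfolding bessel_kernel_def
  proof (intro integral_mono int)
    show "integrable lborel (\<lambda>s. indicat_real {r + 1..r + 2} s * l)"
      by (intro integrable_mult_left integrable_real_indicator) auto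
    fix s :: real
    show "indicator {r + 1..r + 2} s * l \<le> indicator {0<..} s * (exp (- s) * heat s x)"
    proof (cases "s \<in> {r + 1..r + 2}")
      case True
      then have s: "0 < s" "r + 1 \<le> s" "s \<le> r + 2" using r by auto
      have e1: "exp (- 2) * exp (- r) \<le> exp (- s)" using s by (simp add: mult_exp_exp)
      have "r * r \<le> r * s" using s r by (intro mult_left_mono) auto
      then have e2: "exp (- r) \<le> exp (- r\<^sup>2 / (4 * s))"
      proof -
        have "r\<^sup>2 \<le> r * (4 * s)"
          using \<open>r * r \<le> r * s\<close> mult_nonneg_nonneg[OF r, of s] s by (simp add: power2_eq_square)
        then have "r\<^sup>2 / (4 * s) \<le> r" using s by (simp add: divide_le_eq)
        then show ?thesis by simp
      qed
      have p3: "3 < pi" by (rule pi_gt3)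
      have "1 * 1 \<le> 4 * pi * s" using p3 s r by (intro mult_mono) auto
      then have "sqrt (4 * pi * s) \<le> 4 * pi * s"
        using mult_left_mono[of 1 "4 * pi * s" "4 * pi * s"] by (intro real_le_lsqrt) (auto simp: power2_eq_square)
      also have "\<dots> \<le> 4 * pi * (r + 2)" using s by simp
      also have "\<dots> \<le> 8 * pi * (1 + r)" using r by (simp add: algebra_simps)
      also have "\<dots> \<le> 8 * pi * exp r" by (intro mult_left_mono exp_ge_add_one_self) auto
      finally have sq: "sqrt (4 * pi * s) \<le> 8 * pi * exp r" .
      have "1 / (8 * pi) * exp (- r) = 1 / (8 * pi * exp r)"
        by (simp add: exp_minus field_simps)
      also have "\<dots> \<le> 1 / sqrt (4 * pi * s)" using s by (intro divide_left_mono sq) auto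
      finally have e3: "(1 / (8 * pi) * exp (- r)) ^ DIM('a) \<le> (1 / sqrt (4 * pi * s)) ^ DIM('a)"
        by (rule power_mono) simp
      have "l = (exp (- 2) * exp (- r)) * ((1 / (8 * pi) * exp (- r)) ^ DIM('a) * exp (- r))"
      proof -
        have "exp (- (real DIM('a) + 2) * r) = exp (- r) * (exp (- r) ^ DIM('a) * exp (- r))"
          by (simp add: exp_of_nat_mult[symmetric] mult_exp_exp algebra_simps)
        then show ?thesis by (simp add: l_def power_mult_distrib power_divide mult_ac)
      qed
      also have "\<dots> \<le> exp (- s) * heat s x"
        unfolding heat_eq[OF s(1)] r_def[symmetric]
        using s by (intro mult_mono e1 e2 e3) auto
      finally show ?thesis using True s by simp
    qed simp
  qed
  finally show "exp (- 2) * (1 / (8 * pi)) ^ DIM('a) * exp (- (real DIM('a) + 2) * norm x) \<le> bessel_kernel x"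
    by (simp add: l_def r_def)
qed

lemma integrable_bessel_kernel_exp:
  fixes \<epsilon> :: real
  assumes \<epsilon>: "DIM('a) * \<epsilon>\<^sup>2 \<le> 1/2"
  shows "integrable lborel (\<lambda>x::'a::euclidean_space. bessel_kernel x * exp (\<epsilon> * norm x))"
proof -
  have "(LBINT s. indicator {0<..} s * (exp (- s) * (heat s x * exp (\<epsilon> * norm x))))
     = bessel_kernel x * exp (\<epsilon> * norm x)" for x :: 'a
    unfolding bessel_kernel_def by (subst integral_mult_left_zero[symmetric]) (simp add: mult_ac)
  then show ?thesis
    using lborel_pair.integrable_snd[OF integrable_subordinated_heat_exp[OF assms]] by simp
qed

text \<open>The given kernel is only Lebesgue measurable. It is replaced by a Borel function
  \<open>B'\<close> agreeing with it almost everywhere; the difference of \<open>B'\<close> and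
  \<open>bessel_kernel\<close> then has vanishing Fourier transform.\<close>

lemma is_bessel_kernel_AE_eq:
  assumes B: "is_bessel_kernel (B :: real^'n \<Rightarrow> real)"
  shows "AE x in lborel. B x = bessel_kernel x"
proof -
  have Bm: "B \<in> borel_measurable lebesgue" and Bi: "integrable lebesgue B"
    using B by (auto simp: is_bessel_kernel_def)
  obtain B' where [measurable]: "B' \<in> borel_measurable borel" and BB': "AE x in lborel. B x = B' x"
    using completion_ex_borel_measurable_real[OF Bm] by auto
  have BB'': "AE x in lebesgue. B x = B' x" by (rule AE_completion[OF BB'])
  have "integrable lebesgue B'"
    by (subst integrable_cong_AE[OF _ Bm]) (use BB'' Bi in \<open>auto intro: measurable_completion\<close>)
  then have B'i: "integrable lborel B'" by (simp add: integrable_completion)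
  have Gi: "integrable lborel (bessel_kernel :: real^'n \<Rightarrow> real)"
    using integrable_bessel_kernel_exp[of 0, where 'a="real^'n"] by simp
  have F: "(LBINT x. cis (- (x \<bullet> \<xi>)) * complex_of_real (B' x)) = 1 / (1 + (norm \<xi>)\<^sup>2)" for \<xi>
  proof -
    have "(LBINT x. cis (- (x \<bullet> \<xi>)) * complex_of_real (B' x))
      = (\<integral>x. cis (- (x \<bullet> \<xi>)) * complex_of_real (B' x) \<partial>lebesgue)"
      by (rule integral_completion[symmetric]) measurable
    also have "\<dots> = (\<integral>x. cis (- (x \<bullet> \<xi>)) * complex_of_real (B x) \<partial>lebesgue)"
    proof (rule integral_cong_AE)
      show "AE x in lebesgue. cis (- (x \<bullet> \<xi>)) * complex_of_real (B' x) = cis (- (x \<bullet> \<xi>)) * complex_of_real (B x)"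
        using BB'' by eventually_elim simp
      have c: "(\<lambda>x. cis (- (x \<bullet> \<xi>))) \<in> borel_measurable lebesgue"
        by (rule measurable_completion) measurable
      show "(\<lambda>x. cis (- (x \<bullet> \<xi>)) * complex_of_real (B x)) \<in> borel_measurable lebesgue"
        using c Bm by measurable
      show "(\<lambda>x. cis (- (x \<bullet> \<xi>)) * complex_of_real (B' x)) \<in> borel_measurable lebesgue"
        by (rule measurable_completion) measurable
    qed
    finally show ?thesis using B by (simp add: is_bessel_kernel_def)
  qed
  have ci: "integrable lborel (\<lambda>x. cis (- (x \<bullet> \<xi>)) * complex_of_real (f x))" if "integrable lborel f" for f and \<xi> :: "real^'n"
    by (rule Bochner_Integration.integrable_bound[OF that]) (use that in \<open>auto simp: norm_mult\<close>)
  have "AE x in lborel. B' x - bessel_kernel x = 0"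
  proof (rule AE_eq_0_if_fourier_eq_0)
    show "integrable lborel (\<lambda>x. B' x - bessel_kernel x)" using B'i Gi by simp
    fix \<xi> :: "real^'n"
    show "(LBINT x. cis (- (x \<bullet> \<xi>)) * complex_of_real (B' x - bessel_kernel x)) = 0"
      using F[of \<xi>] bessel_kernel_fourier[of \<xi>] ci[OF B'i, of \<xi>] ci[OF Gi, of \<xi>]
      by (simp add: right_diff_distrib)
  qed
  with BB' show ?thesis by eventually_elim simp
qed

lemma integral_bessel_kernel: "(LBINT (x::'a::euclidean_space). bessel_kernel x) = 1"
proof -
  have "complex_of_real (LBINT (x::'a). bessel_kernel x) = complex_of_real 1"
    using bessel_kernel_fourier[of "0::'a"] by simp
  then show ?thesis by (simp only: of_real_eq_iff)
qed

section \<open>Powers, growth conditions and time integrals\<close>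

lemma rpow_nonneg [simp]: "0 \<le> rpow r e"
  by (simp add: rpow_def)

lemma rpow_0_right [simp]: "rpow r 0 = 1"
  by (simp add: rpow_def)

lemma rpow_eq_powr: "0 < e \<Longrightarrow> rpow r e = r powr e"
  by (simp add: rpow_def)

lemma rpow_add: "0 \<le> d \<Longrightarrow> 0 \<le> e \<Longrightarrow> rpow r (d + e) = rpow r d * rpow r e"
  by (auto simp: rpow_def powr_add)

lemma rpow_powr: "0 < p \<Longrightarrow> rpow r e powr p = rpow r (e * p)"
  by (simp add: rpow_def powr_powr)

lemma rpow_ge_1: "1 \<le> r \<Longrightarrow> 0 \<le> e \<Longrightarrow> 1 \<le> rpow r e"
  by (simp add: rpow_def ge_one_powr_ge_zero)

lemma rpow_le: "0 \<le> r \<Longrightarrow> 0 \<le> e \<Longrightarrow> rpow r e \<le> (1 + r) powr e"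
  by (auto simp: rpow_def powr_mono2)

lemma continuous_on_rpow [continuous_intros]:
  assumes "continuous_on S f" "\<And>x. x \<in> S \<Longrightarrow> 0 \<le> f x" "0 \<le> e"
  shows "continuous_on S (\<lambda>x. rpow (f x) e)"
proof (cases "e = 0")
  case False
  then show ?thesis
    using assms by (simp add: rpow_eq_powr) (intro continuous_on_powr' continuous_intros, auto)
qed simp

abbreviation wt :: "real \<Rightarrow> 'a::real_normed_vector \<Rightarrow> real" where
  "wt m x \<equiv> (1 + norm x) powr m"

lemma one_plus_norm_neq_0 [simp]: "1 + norm x \<noteq> 0"
  using norm_ge_zero[of x] by linarith

lemma rpow_norm_le_wt: "0 \<le> e \<Longrightarrow> e \<le> m \<Longrightarrow> rpow (norm x) e \<le> wt m x"
  by (rule order_trans[OF rpow_le powr_mono]) auto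

lemma borel_measurable_rpow_norm:
  "0 \<le> e \<Longrightarrow> (\<lambda>y::'a::real_normed_vector. rpow (norm y) e) \<in> borel_measurable borel"
  by (intro borel_measurable_continuous_onI continuous_on_rpow continuous_intros) auto

lemma weight_le_wt:
  assumes "0 \<le> m" "1 \<le> R"
  shows "(R + norm x) powr m \<le> R powr m * wt m x"
proof -
  have "R * 1 + 1 * norm x \<le> R * 1 + R * norm x" using assms by (intro add_left_mono mult_right_mono) auto
  then have "(R + norm x) powr m \<le> (R * (1 + norm x)) powr m"
    using assms by (intro powr_mono2) (auto simp: distrib_left)
  then show ?thesis using assms by (simp add: powr_mult)
qed

section \<open>Time integrals by the fundamental theorem of calculus\<close>

text \<open>The derivative is required only in the open interval, because it is applied to powers
  such as \<open>t powr b\<close>, whose derivative is available only where the base is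
  positive.\<close>

lemma set_integral_FTC:
  fixes f F :: "real \<Rightarrow> real"
  assumes "a \<le> b" and F: "continuous_on {a..b} F" and f: "continuous_on {a..b} f"
    and D: "\<And>x. a < x \<Longrightarrow> x < b \<Longrightarrow> (F has_real_derivative f x) (at x)"
  shows "(LINT x:{a..b}|lborel. f x) = F b - F a"
proof -
  have "(f has_integral (F b - F a)) {a..b}"
    using assms by (intro fundamental_theorem_of_calculus_interior)
      (auto simp: has_real_derivative_iff_has_vector_derivative)
  then show ?thesis
    using set_borel_integral_eq_integral(2)[OF borel_integrable_atLeastAtMost'[OF f]] by (simp add: integral_unique)
qed

lemma set_integral_le_FTC:
  fixes f F F' :: "real \<Rightarrow> real"
  assumes ab: "a \<le> b" and F: "continuous_on {a..b} F" and f: "continuous_on {a..b} f" and F': "continuous_on {a..b} F'"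
    and D: "\<And>x. a < x \<Longrightarrow> x < b \<Longrightarrow> (F has_real_derivative F' x) (at x)"
    and le: "\<And>x. a \<le> x \<Longrightarrow> x \<le> b \<Longrightarrow> f x \<le> F' x"
  shows "(LINT x:{a..b}|lborel. f x) \<le> F b - F a"
proof -
  have "(LINT x:{a..b}|lborel. f x) \<le> (LINT x:{a..b}|lborel. F' x)"
    using f F' le by (intro set_integral_mono borel_integrable_atLeastAtMost') auto
  also have "\<dots> = F b - F a" by (rule set_integral_FTC[OF ab F F' D])
  finally show ?thesis .
qed

lemma set_integral_ge_FTC:
  fixes f F F' :: "real \<Rightarrow> real"
  assumes ab: "a \<le> b" and F: "continuous_on {a..b} F" and f: "continuous_on {a..b} f" and F': "continuous_on {a..b} F'"
    and D: "\<And>x. a < x \<Longrightarrow> x < b \<Longrightarrow> (F has_real_derivative F' x) (at x)"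
    and le: "\<And>x. a \<le> x \<Longrightarrow> x \<le> b \<Longrightarrow> F' x \<le> f x"
  shows "F b - F a \<le> (LINT x:{a..b}|lborel. f x)"
proof -
  have "F b - F a = (LINT x:{a..b}|lborel. F' x)" by (rule set_integral_FTC[OF ab F F' D, symmetric])
  also have "\<dots> \<le> (LINT x:{a..b}|lborel. f x)"
    using f F' le by (intro set_integral_mono borel_integrable_atLeastAtMost') auto
  finally show ?thesis .
qed

lemma set_integral_combine:
  fixes f :: "real \<Rightarrow> real"
  assumes "a \<le> b" "b \<le> c" and f: "continuous_on {a..c} f"
  shows "(LINT x:{a..c}|lborel. f x) = (LINT x:{a..b}|lborel. f x) + (LINT x:{b..c}|lborel. f x)"
proof -
  have c: "continuous_on {a..b} f" "continuous_on {b..c} f"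
    using assms by (auto intro: continuous_on_subset)
  show ?thesis
    using Henstock_Kurzweil_Integration.integral_combine[OF assms(1,2) integrable_continuous_interval[OF f]]
    by (simp add: set_borel_integral_eq_integral(2)[OF borel_integrable_atLeastAtMost'] c f)
qed

section \<open>Jointly continuous functions of polynomial growth\<close>

text \<open>A convergent sequence and its limit lie in one common bounded piece, so sequential
  continuity there is enough. On bounded pieces uniform majorants and uniform limits are at
  hand.\<close>

lemma continuous_on_half_spaceI:
  fixes g :: "'a::real_normed_vector \<times> real \<Rightarrow> 'b::metric_space"
  assumes "\<And>r. 0 \<le> r \<Longrightarrow> continuous_on (cball 0 r \<times> {0..r}) g"
  shows "continuous_on (UNIV \<times> {0..}) g"
  unfolding continuous_on_sequentially
proof (intro allI ballI impI)
  fix z :: "nat \<Rightarrow> 'a \<times> real" and l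
  assume l: "l \<in> UNIV \<times> {0..}" and z: "(\<forall>n. z n \<in> UNIV \<times> {0..}) \<and> z \<longlonglongrightarrow> l"
  then obtain r where r: "0 < r" "\<And>n. norm (z n) \<le> r"
    using convergent_imp_Bseq[of z] by (auto simp: convergent_def Bseq_def)
  have nl: "norm l \<le> r"
    using z r by (intro LIMSEQ_le_const2[OF tendsto_norm]) auto
  have mem: "w \<in> cball 0 r \<times> {0..r}" if "norm w \<le> r" "w \<in> UNIV \<times> {0..}" for w :: "'a \<times> real"
    using that norm_fst_le[of "fst w" "snd w"] norm_snd_le[of "snd w" "fst w"] by (cases w) auto
  show "(g \<circ> z) \<longlonglongrightarrow> g l"
    using assms[of r] r mem[OF nl l] mem[OF r(2)] z
    unfolding continuous_on_sequentially by auto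
qed

text \<open>A substitute for \<open>Zinf\<close> that is stable under convolution, time integration
  and limits: bounds uniform on compact time intervals replace continuity in time with respect to
  the weighted norm.\<close>

definition tame :: "real \<Rightarrow> (real^'n \<Rightarrow> real \<Rightarrow> real) \<Rightarrow> bool" where
  "tame m f \<longleftrightarrow> continuous_on (UNIV \<times> {0..}) (\<lambda>(x, t). f x t) \<and>
     (\<forall>T. \<exists>M. \<forall>x. \<forall>t\<in>{0..T}. \<bar>f x t\<bar> \<le> M * wt m x)"

lemma tame_bound:
  assumes "tame m f"
  obtains M where "0 < M" "\<And>x t. 0 \<le> t \<Longrightarrow> t \<le> T \<Longrightarrow> \<bar>f x t\<bar> \<le> M * wt m x"
proof -
  obtain M where M: "\<And>x t. 0 \<le> t \<Longrightarrow> t \<le> T \<Longrightarrow> \<bar>f x t\<bar> \<le> M * wt m x"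
    using assms unfolding tame_def by fastforce
  have "\<bar>f x t\<bar> \<le> (\<bar>M\<bar> + 1) * wt m x" if "0 \<le> t" "t \<le> T" for x t
  proof -
    have "M * wt m x \<le> (\<bar>M\<bar> + 1) * wt m x" by (intro mult_right_mono) auto
    with M[OF that, of x] show ?thesis by linarith
  qed
  then show thesis by (intro that[of "\<bar>M\<bar> + 1"]) auto
qed

lemma tame_continuous_compose:
  assumes "tame m f" "continuous_on S g" "continuous_on S h" "\<And>z. z \<in> S \<Longrightarrow> 0 \<le> h z"
  shows "continuous_on S (\<lambda>z. f (g z) (h z))"
proof -
  have "continuous_on S (\<lambda>z. (\<lambda>(x, t). f x t) (g z, h z))"
    using assms by (intro continuous_on_compose2[of "UNIV \<times> {0..}" "\<lambda>(x, t). f x t" S "\<lambda>z. (g z, h z)"] continuous_intros)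
       (auto simp: tame_def)
  then show ?thesis by simp
qed

lemma tame_continuous_space: "tame m f \<Longrightarrow> 0 \<le> t \<Longrightarrow> continuous_on S (\<lambda>x. f x t)"
  by (rule tame_continuous_compose[OF _ continuous_on_id continuous_on_const])

lemma tame_continuous_time: "tame m f \<Longrightarrow> S \<subseteq> {0..} \<Longrightarrow> continuous_on S (\<lambda>t. f x t)"
  by (rule tame_continuous_compose[OF _ continuous_on_const continuous_on_id]) auto

lemma tame_measurable: "tame m f \<Longrightarrow> 0 \<le> t \<Longrightarrow> (\<lambda>x. f x t) \<in> borel_measurable borel"
  by (intro borel_measurable_continuous_onI tame_continuous_space)

lemma tame_add:
  assumes f: "tame m f" and g: "tame m g"
  shows "tame m (\<lambda>x t. f x t + g x t)"
  unfolding tame_def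
proof (intro conjI allI)
  show "continuous_on (UNIV \<times> {0..}) (\<lambda>(x, t). f x t + g x t)"
    unfolding case_prod_beta
    by (intro continuous_intros tame_continuous_compose[OF f] tame_continuous_compose[OF g]) auto
  fix T
  obtain M N where M: "\<And>x t. 0 \<le> t \<Longrightarrow> t \<le> T \<Longrightarrow> \<bar>f x t\<bar> \<le> M * wt m x"
    and N: "\<And>x t. 0 \<le> t \<Longrightarrow> t \<le> T \<Longrightarrow> \<bar>g x t\<bar> \<le> N * wt m x"
    using tame_bound[OF f] tame_bound[OF g] by metis
  have "\<bar>f x t + g x t\<bar> \<le> (M + N) * wt m x" if "t \<in> {0..T}" for x t
    using that M[of t x] N[of t x] by (simp add: distrib_right)
  then show "\<exists>M. \<forall>x. \<forall>t\<in>{0..T}. \<bar>f x t + g x t\<bar> \<le> M * wt m x" by blast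
qed

lemma tame_mult_time:
  assumes f: "tame m f" and c: "continuous_on {0..} c"
  shows "tame m (\<lambda>x t. c t * f x t)"
  unfolding tame_def
proof (intro conjI allI)
  show "continuous_on (UNIV \<times> {0..}) (\<lambda>(x, t). c t * f x t)"
    unfolding case_prod_beta
    by (intro continuous_intros tame_continuous_compose[OF f] continuous_on_compose2[OF c]) auto
  fix T
  obtain M where M: "0 < M" "\<And>x t. 0 \<le> t \<Longrightarrow> t \<le> T \<Longrightarrow> \<bar>f x t\<bar> \<le> M * wt m x"
    using tame_bound[OF f] by metis
  have "compact (c ` {0..T})"
    by (intro compact_continuous_image continuous_on_subset[OF c]) auto
  then obtain N where N: "\<And>t. t \<in> {0..T} \<Longrightarrow> \<bar>c t\<bar> \<le> N"
    using compact_imp_bounded bounded_iff by (metis image_eqI real_norm_def)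
  have "\<bar>c t * f x t\<bar> \<le> (N * M) * wt m x" if "t \<in> {0..T}" for x t
    using that N[OF that] M(2)[of t x] M(1) unfolding abs_mult mult.assoc
    by (intro mult_mono) auto
  then show "\<exists>M. \<forall>x. \<forall>t\<in>{0..T}. \<bar>c t * f x t\<bar> \<le> M * wt m x" by blast
qed

lemma tame_shift:
  assumes f: "tame m f" and c: "continuous_on {0..} c"
    and c0: "\<And>t. 0 \<le> t \<Longrightarrow> 0 \<le> c t" and mono: "\<And>s t. 0 \<le> s \<Longrightarrow> s \<le> t \<Longrightarrow> c s \<le> c t"
  shows "tame m (\<lambda>x t. f x (c t))"
  unfolding tame_def
proof (intro conjI allI)
  show "continuous_on (UNIV \<times> {0..}) (\<lambda>(x, t). f x (c t))"
    unfolding case_prod_beta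
  proof (rule tame_continuous_compose[OF f])
    show "continuous_on (UNIV \<times> {0..}) (\<lambda>z. c (snd z))"
      by (rule continuous_on_compose2[OF c continuous_on_snd]) (auto intro: continuous_intros)
  qed (auto intro!: continuous_intros c0)
  fix T
  obtain M where M: "\<And>x t. 0 \<le> t \<Longrightarrow> t \<le> c T \<Longrightarrow> \<bar>f x t\<bar> \<le> M * wt m x"
    using tame_bound[OF f] by metis
  show "\<exists>M. \<forall>x. \<forall>t\<in>{0..T}. \<bar>f x (c t)\<bar> \<le> M * wt m x"
    by (intro exI[of _ M] allI ballI M c0 mono) auto
qed

lemma tame_cong:
  assumes "tame m f" "\<And>x t. 0 \<le> t \<Longrightarrow> f x t = g x t"
  shows "tame m g"
proof -
  have "continuous_on (UNIV \<times> {0..}) (\<lambda>(x, t). g x t)"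
    using assms by (subst continuous_on_cong[OF refl, of _ _ "\<lambda>(x, t). f x t"]) (auto simp: tame_def)
  then show ?thesis
    using assms by (auto simp: tame_def)
qed

lemma tame_integral:
  assumes f: "tame m f"
  shows "tame m (\<lambda>x t. LINT v:{0..t}|lborel. f x v)"
  unfolding tame_def
proof (intro conjI allI)
  \<comment> \<open>Rescaling to the fixed interval from 0 to 1 reduces joint continuity in
    \<open>x\<close> and \<open>t\<close> to that of a parameter integral.\<close>
  have eq: "(LINT v:{0..t}|lborel. f x v) = t * integral {0..1} (\<lambda>v. f x (t * v))" if t: "0 \<le> t" for x t
  proof (cases "t = 0")
    case False
    with t have t: "0 < t" by simp
    have "(LINT v:{0..t}|lborel. f x v) = integral {0..t} (f x)"
      by (intro set_borel_integral_eq_integral borel_integrable_atLeastAtMost' tame_continuous_time[OF f]) auto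
    moreover have "((\<lambda>v. f x (t * v + 0)) has_integral (1 / \<bar>t\<bar>) *\<^sub>R integral {0..t} (f x)) ((\<lambda>x. (1 / t) *\<^sub>R x + - ((1 / t) *\<^sub>R 0)) ` {0..t})"
      using has_integral_affinity[of "f x" "integral {0..t} (f x)" 0 t t 0] t
        integrable_integral[OF integrable_continuous_interval[OF tame_continuous_time[OF f, of "{0..t}"]]]
      by (simp add: image_mult_atLeastAtMost)
    ultimately show ?thesis
      using t by (simp add: integral_unique image_mult_atLeastAtMost)
  next
    case True
    have "(LINT v:{0..0}|lborel. f x v) = 0"
      by (subst set_integral_FTC[where F="\<lambda>_. 0"]) auto
    with True show ?thesis by simp
  qed
  have "continuous_on (UNIV \<times> {0..}) (\<lambda>z. integral (cbox 0 1) (\<lambda>v. f (fst z) (snd z * v)))"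
    unfolding atLeastAtMost_iff
    by (intro integral_continuous_on_param) (auto simp: case_prod_beta intro!: tame_continuous_compose[OF f] continuous_intros)
  then have "continuous_on (UNIV \<times> {0..}) (\<lambda>z. snd z * integral (cbox 0 1) (\<lambda>v. f (fst z) (snd z * v)))"
    by (intro continuous_intros)
  then show "continuous_on (UNIV \<times> {0..}) (\<lambda>(x, t). LINT v:{0..t}|lborel. f x v)"
    by (subst continuous_on_cong[OF refl]) (auto simp: eq)
  fix T
  obtain M where M: "0 < M" "\<And>x t. 0 \<le> t \<Longrightarrow> t \<le> T \<Longrightarrow> \<bar>f x t\<bar> \<le> M * wt m x"
    using tame_bound[OF f] by metis
  have "\<bar>LINT v:{0..t}|lborel. f x v\<bar> \<le> (M * T) * wt m x" if t: "t \<in> {0..T}" for x t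
  proof -
    have c: "continuous_on {0..t} (f x)" by (rule tame_continuous_time[OF f]) auto
    define C where "C = M * wt m x"
    have C: "0 \<le> C" using M by (simp add: C_def)
    have b: "\<bar>f x v\<bar> \<le> C" if "0 \<le> v" "v \<le> t" for v using M that t by (auto simp: C_def)
    have "(LINT v:{0..t}|lborel. f x v) \<le> C * t - C * 0"
      using b t by (intro set_integral_le_FTC[where F'="\<lambda>_. C"] c) (auto intro!: continuous_intros derivative_eq_intros simp: abs_le_iff)
    moreover have "(- C) * t - (- C) * 0 \<le> (LINT v:{0..t}|lborel. f x v)"
      using b t by (intro set_integral_ge_FTC[where F'="\<lambda>_. - C"] c) (auto intro!: continuous_intros derivative_eq_intros simp: abs_le_iff, force)
    ultimately have "\<bar>LINT v:{0..t}|lborel. f x v\<bar> \<le> C * t" by simp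
    also have "\<dots> \<le> C * T" using t C by (intro mult_left_mono) auto
    finally show ?thesis by (simp add: C_def mult_ac)
  qed
  then show "\<exists>M. \<forall>x. \<forall>t\<in>{0..T}. \<bar>LINT v:{0..t}|lborel. f x v\<bar> \<le> M * wt m x" by blast
qed

section \<open>The weighted spaces \<open>BC a\<close> and \<open>Zinf a\<close>\<close>

text \<open>Membership in \<open>BC a\<close> controls only large \<open>norm x\<close>; on the
  remaining ball continuity and compactness supply the bound, and there the weight is at least
  1.\<close>

lemma BC_bound:
  assumes "\<phi> \<in> BC a" "0 \<le> a"
  obtains C where "\<And>x. \<bar>\<phi> x\<bar> \<le> C * wt a x"
proof -
  obtain C R where CR: "\<And>x. norm x \<ge> R \<Longrightarrow> \<bar>\<phi> x\<bar> \<le> C * rpow (norm x) a" and c: "continuous_on UNIV \<phi>"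
    using assms by (auto simp: BC_def)
  have "compact (\<phi> ` cball 0 R)"
    by (intro compact_continuous_image continuous_on_subset[OF c]) auto
  then obtain N where N: "\<And>x. norm x \<le> R \<Longrightarrow> \<bar>\<phi> x\<bar> \<le> N"
    by (metis compact_imp_bounded bounded_iff image_eqI real_norm_def mem_cball_0)
  have "\<bar>\<phi> x\<bar> \<le> (\<bar>C\<bar> + \<bar>N\<bar>) * wt a x" for x
  proof (cases "norm x \<le> R")
    case True
    have "\<bar>N\<bar> * 1 \<le> (\<bar>C\<bar> + \<bar>N\<bar>) * wt a x"
      using assms(2) by (intro mult_mono ge_one_powr_ge_zero) auto
    with N[OF True] show ?thesis by linarith
  next
    case False
    have "C * rpow (norm x) a \<le> (\<bar>C\<bar> + \<bar>N\<bar>) * wt a x"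
      using assms(2) by (intro mult_mono rpow_le) auto
    with CR[of x] False show ?thesis by linarith
  qed
  then show thesis by (rule that)
qed

lemma BC_I:
  fixes \<phi> :: "real^'n \<Rightarrow> real"
  assumes "continuous_on UNIV \<phi>" "\<And>x. \<bar>\<phi> x\<bar> \<le> C * wt a x" "0 \<le> a"
  shows "\<phi> \<in> BC a"
  unfolding BC_def
proof (intro CollectI conjI assms exI allI impI)
  fix x :: "real^'n" assume x: "1 \<le> norm x"
  have "wt a x \<le> (2 * norm x) powr a" using x assms by (intro powr_mono2) auto
  also have "\<dots> = 2 powr a * rpow (norm x) a" using x by (auto simp: powr_mult rpow_def)
  finally have "\<bar>C\<bar> * wt a x \<le> \<bar>C\<bar> * (2 powr a * rpow (norm x) a)" by (rule mult_left_mono) simp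
  moreover have "C * wt a x \<le> \<bar>C\<bar> * wt a x" by (intro mult_right_mono) auto
  ultimately show "\<bar>\<phi> x\<bar> \<le> (\<bar>C\<bar> * 2 powr a) * rpow (norm x) a"
    using assms(2)[of x] unfolding mult.assoc by linarith
qed

lemma BC_norm_ge:
  fixes \<phi> \<psi> :: "real^'n \<Rightarrow> real"
  assumes "\<phi> \<in> BC a" "\<psi> \<in> BC a" "0 \<le> a"
  shows "\<bar>\<phi> x - \<psi> x\<bar> \<le> BC_norm a (\<lambda>x. \<phi> x - \<psi> x) * wt a x"
proof -
  obtain C where C: "\<And>x. \<bar>\<phi> x\<bar> \<le> C * wt a x" using BC_bound assms by metis
  obtain D where D: "\<And>x. \<bar>\<psi> x\<bar> \<le> D * wt a x" using BC_bound assms by metis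
  have "bdd_above (range (\<lambda>x. \<bar>\<phi> x - \<psi> x\<bar> / wt a x))"
  proof (rule bdd_aboveI2)
    fix x
    have "\<bar>\<phi> x - \<psi> x\<bar> \<le> (C + D) * wt a x"
      using C[of x] D[of x] by (simp add: distrib_right)
    then show "\<bar>\<phi> x - \<psi> x\<bar> / wt a x \<le> C + D" by (simp add: divide_le_eq)
  qed
  then have "\<bar>\<phi> x - \<psi> x\<bar> / wt a x \<le> BC_norm a (\<lambda>x. \<phi> x - \<psi> x)"
    unfolding BC_norm_def by (rule cSUP_upper[OF UNIV_I])
  then show ?thesis by (simp add: divide_le_eq)
qed

text \<open>The weighted distance \<open>d s t\<close> controls the change in time and continuity of
  \<open>f\<close> at a fixed time controls the change in space. The uniform bound is shown by
  contradiction: times \<open>v k\<close> at which the bound with factor \<open>k\<close> fails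
  accumulate at some \<open>t\<close>, but near \<open>t\<close> the function stays within weighted
  distance 1 of its value at \<open>t\<close>, which has a finite bound \<open>C\<close>.\<close>

lemma tame_if_Zinf:
  fixes f :: "real^'n \<Rightarrow> real \<Rightarrow> real"
  assumes f: "f \<in> Zinf a" and a: "0 \<le> a"
  shows "tame a f"
proof -
  have BC: "(\<lambda>x. f x t) \<in> BC a" if "0 \<le> t" for t using f that by (auto simp: Zinf_def)
  define d where "d = (\<lambda>s t. BC_norm a (\<lambda>x. f x s - f x t))"
  have lim: "((\<lambda>s. d s t) \<longlongrightarrow> 0) (at t within {0..})" if "0 \<le> t" for t
    using f that by (auto simp: Zinf_def d_def)
  have le: "\<bar>f x s - f x t\<bar> \<le> d s t * wt a x" if "0 \<le> s" "0 \<le> t" for x s t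
    unfolding d_def by (rule BC_norm_ge[OF BC BC]) (use that a in auto)
  have d0: "d t t = 0" for t by (simp add: d_def BC_norm_def)
  show ?thesis
    unfolding tame_def
  proof (intro conjI allI)
    show "continuous_on (UNIV \<times> {0..}) (\<lambda>(x, t). f x t)"
      unfolding continuous_on_def
    proof
      fix z :: "(real^'n) \<times> real" assume z: "z \<in> UNIV \<times> {0..}"
      obtain x t where xt: "z = (x, t)" by (cases z)
      with z have t: "t \<in> {0..}" by simp
      let ?F = "at (x, t) within UNIV \<times> {0..}"
      have Fsnd: "filterlim snd (nhds t) ?F" by (auto intro!: tendsto_eq_intros)
      have "((\<lambda>s. d s t) \<longlongrightarrow> 0) (at t within {0..})" using lim t by simp
      then have "((\<lambda>s. d s t) \<longlongrightarrow> d t t) (at t within {0..})" by (simp add: d0)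
      then have cont: "continuous (at t within {0..}) (\<lambda>s. d s t)" by (simp add: continuous_within)
      have "((\<lambda>z. d (snd z) t) \<longlongrightarrow> d t t) ?F"
        by (rule continuous_within_tendsto_compose[OF cont _ Fsnd]) (auto simp: eventually_at_filter intro!: always_eventually)
      then have 1: "((\<lambda>z. d (snd z) t * wt a (fst z)) \<longlongrightarrow> 0 * wt a x) ?F"
        using add_pos_nonneg[of 1 "norm x"] by (auto simp: d0 intro!: tendsto_eq_intros)
      have "((\<lambda>z. f (fst z) (snd z) - f (fst z) t) \<longlongrightarrow> 0) ?F"
      proof (rule tendsto_rabs_zero_cancel, rule tendsto_sandwich[OF _ _ tendsto_const])
        show "\<forall>\<^sub>F z in ?F. \<bar>f (fst z) (snd z) - f (fst z) t\<bar> \<le> d (snd z) t * wt a (fst z)"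
          unfolding eventually_at_filter using t by (intro always_eventually) (auto intro!: le)
        show "((\<lambda>z. d (snd z) t * wt a (fst z)) \<longlongrightarrow> 0) ?F" using 1 by simp
      qed auto
      moreover have "((\<lambda>z. f (fst z) t) \<longlongrightarrow> f x t) ?F"
      proof -
        have "isCont (\<lambda>x. f x t) x"
          using BC[of t] t by (simp add: BC_def continuous_on_eq_continuous_at)
        then show ?thesis by (rule isCont_tendsto_compose) (auto intro!: tendsto_eq_intros)
      qed
      ultimately have "((\<lambda>z. (f (fst z) (snd z) - f (fst z) t) + f (fst z) t) \<longlongrightarrow> 0 + f x t) ?F"
        by (rule tendsto_add)
      then show "((\<lambda>(x, t). f x t) \<longlongrightarrow> (case z of (x, t) \<Rightarrow> f x t)) (at z within UNIV \<times> {0..})"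
        by (simp add: case_prod_beta' xt)
    qed
    fix T
    show "\<exists>M. \<forall>x. \<forall>t\<in>{0..T}. \<bar>f x t\<bar> \<le> M * wt a x"
    proof (rule ccontr)
      assume unbdd: "\<not> ?thesis"
      have "\<forall>k::nat. \<exists>x t. t \<in> {0..T} \<and> real k * wt a x < \<bar>f x t\<bar>"
      proof
        fix k :: nat
        have "\<not> (\<forall>x. \<forall>t\<in>{0..T}. \<bar>f x t\<bar> \<le> real k * wt a x)"
          by (rule contrapos_nn[OF unbdd]) (rule exI[of _ "real k"])
        then obtain x t where "t \<in> {0..T}" "\<not> \<bar>f x t\<bar> \<le> real k * wt a x"
          by auto
        then show "\<exists>x t. t \<in> {0..T} \<and> real k * wt a x < \<bar>f x t\<bar>"
          by (intro exI[of _ x] exI[of _ t]) simp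
      qed
      then obtain X v where v: "\<And>k. v k \<in> {0..T}" and big: "\<And>k. real k * wt a (X k) < \<bar>f (X k) (v k)\<bar>"
        by metis
      obtain t r where t: "t \<in> {0..T}" and r: "strict_mono (r :: nat \<Rightarrow> nat)" and conv: "(v \<circ> r) \<longlonglongrightarrow> t"
        using compact_Icc[of 0 T] v unfolding compact_def by metis
      obtain C where C: "\<And>x. \<bar>f x t\<bar> \<le> C * wt a x"
        using BC_bound[OF BC a] t by (metis atLeastAtMost_iff)
      have cont: "continuous (at t within {0..}) (\<lambda>s. d s t)"
        using lim[of t] t by (simp add: continuous_within d0)
      have "(\<lambda>k. d ((v \<circ> r) k) t) \<longlonglongrightarrow> d t t"
        by (rule continuous_within_tendsto_compose[OF cont _ conv]) (use v in auto)
      then have "\<forall>\<^sub>F k in sequentially. d (v (r k)) t < 1" using order_tendstoD(2)[of _ "d t t" sequentially 1] by (simp add: d0)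
      moreover have "\<forall>\<^sub>F k in sequentially. C + 1 \<le> real k"
        using filterlim_real_sequentially by (simp add: filterlim_at_top)
      ultimately have "\<forall>\<^sub>F k in sequentially. False"
      proof eventually_elim
        fix k assume k: "d (v (r k)) t < 1" "C + 1 \<le> real k"
        define W where "W = wt a (X (r k))"
        have W: "0 \<le> W" by (simp add: W_def)
        have "k \<le> r k" by (rule seq_suble[OF r])
        then have rk: "C + 1 \<le> real (r k)" using k by linarith
        have "\<bar>f (X (r k)) (v (r k))\<bar> \<le> d (v (r k)) t * W + C * W"
          using le[of "v (r k)" t "X (r k)"] C[of "X (r k)"] v[of "r k"] t by (simp add: W_def)
        also have "\<dots> \<le> 1 * W + C * W" using k W by (intro add_right_mono mult_right_mono) auto
        also have "\<dots> \<le> real (r k) * W" using mult_right_mono[OF rk W] by (simp add: algebra_simps)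
        finally show False using big[of "r k"] by (simp add: W_def)
      qed
      then show False by simp
    qed
  qed
qed

text \<open>The way back from \<open>tame\<close> to \<open>Zinf\<close>. It applies to solutions of
  the integral equation, whose time derivative is bounded by the weight on compact time
  intervals.\<close>

lemma Zinf_if_lipschitz:
  fixes f :: "real^'n \<Rightarrow> real \<Rightarrow> real"
  assumes f: "tame a f" and a: "0 \<le> a"
    and lip: "\<And>T. \<exists>M. \<forall>x. \<forall>s\<in>{0..T}. \<forall>t\<in>{0..T}. \<bar>f x s - f x t\<bar> \<le> M * \<bar>s - t\<bar> * wt a x"
  shows "f \<in> Zinf a"
  unfolding Zinf_def
proof (intro CollectI conjI allI impI)
  fix t :: real assume t: "0 \<le> t"
  obtain M where M: "\<And>x t'. 0 \<le> t' \<Longrightarrow> t' \<le> t \<Longrightarrow> \<bar>f x t'\<bar> \<le> M * wt a x"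
    using tame_bound[OF f] by metis
  show "(\<lambda>x. f x t) \<in> BC a" by (rule BC_I[OF tame_continuous_space[OF f t] M a]) (use t in auto)
  obtain M where M: "\<And>x s t'. s \<in> {0..t+1} \<Longrightarrow> t' \<in> {0..t+1} \<Longrightarrow> \<bar>f x s - f x t'\<bar> \<le> M * \<bar>s - t'\<bar> * wt a x"
    using lip[of "t + 1"] by blast
  have q: "\<bar>f x s - f x t\<bar> / wt a x \<le> M * \<bar>s - t\<bar>" if "s \<in> {0..t+1}" for s x
    using M[OF that, of t x] t by (simp add: divide_le_eq)
  have up: "BC_norm a (\<lambda>x. f x s - f x t) \<le> M * \<bar>s - t\<bar>" if "s \<in> {0..t+1}" for s
    unfolding BC_norm_def using q[OF that] by (intro cSUP_least) auto
  have lo: "0 \<le> BC_norm a (\<lambda>x. f x s - f x t)" if "s \<in> {0..t+1}" for s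
  proof -
    have "bdd_above (range (\<lambda>x. \<bar>f x s - f x t\<bar> / wt a x))"
      using q[OF that] by (intro bdd_aboveI2)
    then have "\<bar>f 0 s - f 0 t\<bar> / wt a (0 :: real^'n) \<le> BC_norm a (\<lambda>x. f x s - f x t)"
      unfolding BC_norm_def by (rule cSUP_upper[OF UNIV_I])
    then show ?thesis by (rule order_trans[rotated]) simp
  qed
  have ev: "\<forall>\<^sub>F s in at t within {0..}. s \<in> {0..t+1}"
  proof -
    have "\<forall>\<^sub>F s in nhds t. s \<in> {..<t+1}" by (intro eventually_nhds_in_open) auto
    then show ?thesis unfolding eventually_at_filter by eventually_elim auto
  qed
  show "((\<lambda>s. BC_norm a (\<lambda>x. f x s - f x t)) \<longlongrightarrow> 0) (at t within {0..})"
  proof (rule tendsto_sandwich[OF _ _ tendsto_const])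
    show "\<forall>\<^sub>F s in at t within {0..}. 0 \<le> BC_norm a (\<lambda>x. f x s - f x t)"
      using ev by eventually_elim (rule lo)
    show "\<forall>\<^sub>F s in at t within {0..}. BC_norm a (\<lambda>x. f x s - f x t) \<le> M * \<bar>s - t\<bar>"
      using ev by eventually_elim (rule up)
    show "((\<lambda>s. M * \<bar>s - t\<bar>) \<longlongrightarrow> 0) (at t within {0..})" by (auto intro!: tendsto_eq_intros)
  qed
qed

section \<open>Convolution kernels\<close>

lemma lborel_distr_reflect: "distr lborel borel (\<lambda>y::'a::euclidean_space. x - y) = lborel"
proof -
  have "lborel = density (distr lborel borel (\<lambda>y::'a. x + (-1) *\<^sub>R y)) (\<lambda>_. ennreal (\<bar>- 1\<bar> ^ DIM('a)))"
    by (rule lborel_affine) simp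
  also have "\<dots> = distr lborel borel (\<lambda>y::'a. x - y)" by (simp add: density_1)
  finally show ?thesis by simp
qed

lemma integral_reflect_lborel:
  fixes f :: "'a::euclidean_space \<Rightarrow> real"
  assumes [measurable]: "f \<in> borel_measurable borel"
  shows "(LBINT y. f (x - y)) = (LBINT y. f y)"
  by (subst (2) lborel_distr_reflect[of x, symmetric], subst integral_distr) simp_all

lemma AE_lborel_reflect:
  fixes P :: "'a::euclidean_space \<Rightarrow> bool"
  assumes "AE y in lborel. P y"
  shows "AE y in lborel. P (x - y)"
proof -
  obtain N where N: "{y \<in> space lborel. \<not> P y} \<subseteq> N" "emeasure lborel N = 0" "N \<in> sets lborel"
    using assms by (rule AE_E)
  then have "AE y in distr lborel borel (\<lambda>y::'a. x - y). y \<notin> N"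
    unfolding lborel_distr_reflect by (intro AE_not_in) auto
  then have "AE y in lborel. x - y \<notin> N"
    using N by (subst (asm) AE_distr_iff) auto
  then show ?thesis using N by (auto elim!: eventually_mono)
qed

lemma one_plus_norm_powr_diff_le:
  fixes x y :: "'a::real_normed_vector"
  assumes "0 \<le> m"
  shows "wt m (x - y) \<le> wt m x * wt m y"
proof -
  have "1 + norm (x - y) \<le> (1 + norm x) * (1 + norm y)"
    using norm_triangle_ineq4[of x y] mult_nonneg_nonneg[OF norm_ge_zero[of x] norm_ge_zero[of y]]
    by (simp add: algebra_simps del: mult_nonneg_nonneg zero_le_mult_iff)
  then have "wt m (x - y) \<le> ((1 + norm x) * (1 + norm y)) powr m"
    using assms by (intro powr_mono2) auto
  then show ?thesis by (simp add: powr_mult)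
qed

definition grows :: "real \<Rightarrow> (real^'n \<Rightarrow> real) \<Rightarrow> bool" where
  "grows m \<phi> \<longleftrightarrow> 0 \<le> m \<and> \<phi> \<in> borel_measurable borel \<and> (\<exists>M. \<forall>x. \<bar>\<phi> x\<bar> \<le> M * wt m x)"

lemma growsI:
  "0 \<le> m \<Longrightarrow> \<phi> \<in> borel_measurable borel \<Longrightarrow> (\<And>x. \<bar>\<phi> x\<bar> \<le> M * wt m x) \<Longrightarrow> grows m \<phi>"
  by (auto simp: grows_def)

lemma grows_measurable: "grows m \<phi> \<Longrightarrow> \<phi> \<in> borel_measurable borel"
  by (simp add: grows_def)

lemma grows_if_tame:
  assumes "tame m f" "0 \<le> m" "0 \<le> t"
  shows "grows m (\<lambda>x. f x t)"
proof -
  obtain M where "\<And>x s. 0 \<le> s \<Longrightarrow> s \<le> t \<Longrightarrow> \<bar>f x s\<bar> \<le> M * wt m x"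
    using tame_bound[OF assms(1)] by metis
  then show ?thesis
    using assms by (intro growsI[where M=M] tame_measurable[OF assms(1)]) auto
qed

lemma grows_diff:
  assumes "grows m \<phi>" "grows m \<psi>"
  shows "grows m (\<lambda>x. \<phi> x - \<psi> x)"
proof -
  obtain M N where MN: "\<And>x. \<bar>\<phi> x\<bar> \<le> M * wt m x" "\<And>x. \<bar>\<psi> x\<bar> \<le> N * wt m x"
    using assms unfolding grows_def by blast
  have "\<bar>\<phi> x - \<psi> x\<bar> \<le> (M + N) * wt m x" for x
    using MN[of x] by (simp add: distrib_right)
  then show ?thesis using assms by (intro growsI[where M="M + N"]) (auto simp: grows_def)
qed

lemma grows_abs: "grows m \<phi> \<Longrightarrow> grows m (\<lambda>x. \<bar>\<phi> x\<bar>)"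
  by (auto simp: grows_def)

lemma grows_cmult:
  assumes "grows m \<phi>" shows "grows m (\<lambda>x. k * \<phi> x)"
proof -
  obtain M where M: "\<And>x. \<bar>\<phi> x\<bar> \<le> M * wt m x"
    using assms unfolding grows_def by blast
  have "\<bar>k * \<phi> x\<bar> \<le> (\<bar>k\<bar> * M) * wt m x" for x
    using mult_left_mono[OF M[of x], of "\<bar>k\<bar>"] by (simp add: abs_mult)
  then show ?thesis using assms by (intro growsI[where M="\<bar>k\<bar> * M"]) (auto simp: grows_def)
qed

lemma grows_weight:
  assumes "0 \<le> m" "1 \<le> R" shows "grows m (\<lambda>x. (R + norm x) powr m)"
proof (rule growsI[where M="R powr m"])
  show "\<bar>(R + norm x) powr m\<bar> \<le> R powr m * wt m x" for x :: "real^'n"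
    using weight_le_wt[OF assms] by simp
qed (use assms in auto)

lemma grows_bounded:
  fixes \<phi> :: "real^'n \<Rightarrow> real"
  assumes "\<phi> \<in> borel_measurable borel" "\<And>x. \<bar>\<phi> x\<bar> \<le> M" shows "grows 0 \<phi>"
  by (rule growsI[where M=M]) (use assms in auto)

section \<open>Convolution with a kernel having exponential moments\<close>

text \<open>These are the properties extracted from the Bessel kernel. The lower bound drives the
  spreading of positivity, the unit mass the contraction, and the exponential moment makes all
  polynomial weights integrable.\<close>

locale conv_kernel =
  fixes K :: "real^'n \<Rightarrow> real" and c lam eps :: real
  assumes K_measurable [measurable]: "K \<in> borel_measurable borel"
    and c_pos: "0 < c" and lam_pos: "0 < lam" and K_ge: "\<And>x. c * exp (- lam * norm x) \<le> K x"
    and K_integral: "(LBINT x. K x) = 1"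
    and eps_pos: "0 < eps" and K_exp: "integrable lborel (\<lambda>x. K x * exp (eps * norm x))"
begin

lemma K_nonneg [simp]: "0 \<le> K x"
  using K_ge[of x] c_pos by (smt (verit) mult_pos_pos exp_gt_zero)

text \<open>Raise \<open>1 + r \<le> (1 + m / eps) * (1 + eps * r / m)\<close> to the power
  \<open>m\<close> and use \<open>1 + z \<le> exp z\<close>; this is the origin of
  \<open>C\<close>.\<close>

lemma K_moment:
  assumes m: "0 \<le> m"
  shows "integrable lborel (\<lambda>y. K y * wt m y)"
proof -
  define C where "C = (1 + m / eps) powr m"
  have C: "0 \<le> C" by (simp add: C_def)
  have le: "wt m y \<le> C * exp (eps * norm y)" for y :: "real^'n"
  proof (cases "m = 0")
    case True
    then show ?thesis using eps_pos by (simp add: C_def)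
  next
    case False
    with m have m: "0 < m" by simp
    have "1 + norm y \<le> (1 + m / eps) * (1 + eps * norm y / m)"
      using m eps_pos by (simp add: field_simps) 
    also have "\<dots> \<le> (1 + m / eps) * exp (eps * norm y / m)"
      using m eps_pos by (intro mult_left_mono exp_ge_add_one_self) auto
    finally have "wt m y \<le> ((1 + m / eps) * exp (eps * norm y / m)) powr m"
      using m by (intro powr_mono2) auto
    also have "\<dots> = C * exp (eps * norm y)"
      using m eps_pos by (simp add: C_def powr_mult exp_powr_real)
    finally show ?thesis .
  qed
  have "integrable lborel (\<lambda>y. C * (K y * exp (eps * norm y)))" using K_exp by simp
  then show ?thesis
  proof (rule Bochner_Integration.integrable_bound)
    show "AE y in lborel. norm (K y * wt m y) \<le> norm (C * (K y * exp (eps * norm y)))"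
      using mult_left_mono[OF le K_nonneg] C by (intro AE_I2) (simp add: abs_mult mult_ac)
  qed measurable
qed

text \<open>The variable \<open>x\<close> is kept out of the kernel, so that one integrable majorant
  built from \<open>K\<close> serves for all \<open>x\<close> in a bounded set.\<close>

definition cv :: "(real^'n \<Rightarrow> real) \<Rightarrow> real^'n \<Rightarrow> real" where
  "cv \<phi> x = (LBINT y. K y * \<phi> (x - y))"

lemma cv_integrable:
  assumes "grows m \<phi>"
  shows "integrable lborel (\<lambda>y. K y * \<phi> (x - y))"
proof -
  obtain M where m: "0 \<le> m" and [measurable]: "\<phi> \<in> borel_measurable borel"
    and M: "\<And>x. \<bar>\<phi> x\<bar> \<le> M * wt m x"
    using assms by (auto simp: grows_def)
  have M0: "0 \<le> M" using M[of 0] by simp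
  have "integrable lborel (\<lambda>y. M * wt m x * (K y * wt m y))"
    using K_moment[OF m] by simp
  then show ?thesis
  proof (rule Bochner_Integration.integrable_bound)
    show "AE y in lborel. norm (K y * \<phi> (x - y)) \<le> norm (M * wt m x * (K y * wt m y))"
    proof (rule AE_I2)
      fix y
      have "\<bar>\<phi> (x - y)\<bar> \<le> M * (wt m x * wt m y)"
        by (rule order_trans[OF M mult_left_mono[OF one_plus_norm_powr_diff_le[OF m] M0]])
      then have "K y * \<bar>\<phi> (x - y)\<bar> \<le> K y * (M * (wt m x * wt m y))"
        by (rule mult_left_mono) simp
      then show "norm (K y * \<phi> (x - y)) \<le> norm (M * wt m x * (K y * wt m y))"
        using M0 by (simp add: abs_mult mult_ac)
    qed
  qed measurable
qed

lemma cv_mono: "grows m \<phi> \<Longrightarrow> grows m' \<psi> \<Longrightarrow> (\<And>y. \<phi> y \<le> \<psi> y) \<Longrightarrow> cv \<phi> x \<le> cv \<psi> x"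
  unfolding cv_def by (intro integral_mono cv_integrable mult_left_mono) auto

lemma cv_nonneg: "(\<And>y. 0 \<le> \<phi> y) \<Longrightarrow> 0 \<le> cv \<phi> x"
  unfolding cv_def by (intro integral_nonneg_AE) auto

lemma cv_cmult: "cv (\<lambda>y. k * \<phi> y) x = k * cv \<phi> x"
  unfolding cv_def by (subst integral_mult_right_zero[symmetric]) (simp add: mult.left_commute)

lemma cv_zero [simp]: "cv (\<lambda>y. 0) x = 0"
  by (simp add: cv_def)

lemma abs_cv_diff_le:
  assumes "grows m \<phi>" "grows m' \<psi>"
  shows "\<bar>cv \<phi> x - cv \<psi> x\<bar> \<le> cv (\<lambda>y. \<bar>\<phi> y - \<psi> y\<bar>) x"
proof -
  have "cv \<phi> x - cv \<psi> x = (LBINT y. K y * \<phi> (x - y) - K y * \<psi> (x - y))"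
    unfolding cv_def using assms by (intro Bochner_Integration.integral_diff[symmetric] cv_integrable)
  also have "\<bar>\<dots>\<bar> \<le> (LBINT y. \<bar>K y * \<phi> (x - y) - K y * \<psi> (x - y)\<bar>)"
    by (rule integral_abs_bound)
  also have "\<dots> = cv (\<lambda>y. \<bar>\<phi> y - \<psi> y\<bar>) x"
    unfolding cv_def by (simp add: right_diff_distrib[symmetric] abs_mult)
  finally show ?thesis .
qed

lemma cv_weight_le:
  assumes m: "0 \<le> m"
  obtains C where "0 < C" "\<And>x. cv (\<lambda>y. wt m y) x \<le> C * wt m x"
proof
  let ?C = "(LBINT y. K y * wt m y)"
  have "0 \<le> ?C" by (intro integral_nonneg_AE) auto
  then show "0 < ?C + 1" by linarith
  fix x
  have "cv (\<lambda>y. wt m y) x \<le> (LBINT y. wt m x * (K y * wt m y))"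
    unfolding cv_def
  proof (intro integral_mono cv_integrable[OF grows_weight] integrable_mult_right K_moment)
    fix y
    show "K y * wt m (x - y) \<le> wt m x * (K y * wt m y)"
      using mult_left_mono[OF one_plus_norm_powr_diff_le[OF m, of x y] K_nonneg[of y]] by (simp add: mult_ac)
  qed (use m in auto)
  also have "\<dots> = ?C * wt m x" by (simp add: mult.commute)
  also have "\<dots> \<le> (?C + 1) * wt m x" by (intro mult_right_mono) auto
  finally show "cv (\<lambda>y. wt m y) x \<le> (?C + 1) * wt m x" .
qed

text \<open>A large \<open>R\<close> makes the weight nearly constant on the scale of the kernel:
  the quotient of its values at \<open>x - y\<close> and \<open>x\<close> is at most
  \<open>(1 + norm y / R) powr m\<close>, whose average against \<open>K\<close> tends to the total
  mass 1.\<close>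

lemma cv_weight_almost_contractive:
  assumes m: "0 \<le> m" and q: "1 < q"
  obtains R where "1 \<le> R" "\<And>x. cv (\<lambda>y. (R + norm y) powr m) x \<le> q * (R + norm x) powr m"
proof -
  define I where "I = (\<lambda>k. LBINT y. K y * (1 + norm y / real (Suc k)) powr m)"
  have le: "(1 + norm y / real (Suc k)) powr m \<le> wt m y" for y :: "real^'n" and k
    using m by (intro powr_mono2) (auto simp: divide_le_eq mult_left_mono algebra_simps)
  have int: "integrable lborel (\<lambda>y. K y * (1 + norm y / real (Suc k)) powr m)" for k
    by (rule Bochner_Integration.integrable_bound[OF K_moment[OF m]])
       (use le in \<open>auto simp: abs_mult intro!: mult_left_mono\<close>)
  have "I \<longlonglongrightarrow> (LBINT y. K y * 1)"
    unfolding I_def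
  proof (rule integral_dominated_convergence[where w="\<lambda>y. K y * wt m y"])
    show "AE y in lborel. (\<lambda>k. K y * (1 + norm y / real (Suc k)) powr m) \<longlonglongrightarrow> K y * 1"
    proof (rule AE_I2)
      fix y :: "real^'n"
      have "(\<lambda>k. norm y / real (Suc k)) \<longlonglongrightarrow> 0"
        using LIMSEQ_Suc[OF lim_const_over_n[of "norm y"]] by simp
      then have "(\<lambda>k. K y * (1 + norm y / real (Suc k)) powr m) \<longlonglongrightarrow> K y * (1 + 0) powr m"
        by (intro tendsto_intros) auto
      then show "(\<lambda>k. K y * (1 + norm y / real (Suc k)) powr m) \<longlonglongrightarrow> K y * 1" by simp
    qed
    show "AE y in lborel. norm (K y * (1 + norm y / real (Suc k)) powr m) \<le> K y * wt m y" for k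
      using mult_left_mono[OF le K_nonneg] by (intro AE_I2) (simp add: abs_mult)
  qed (use K_moment[OF m] in auto)
  then have "I \<longlonglongrightarrow> 1" by (simp add: K_integral)
  then have "\<forall>\<^sub>F k in sequentially. I k < q" using q by (rule order_tendstoD)
  then obtain k where k: "I k < q" by (auto dest: eventually_happens)
  define R where "R = real (Suc k)"
  have R: "1 \<le> R" by (simp add: R_def)
  have "cv (\<lambda>y. (R + norm y) powr m) x \<le> q * (R + norm x) powr m" for x
  proof -
    have "cv (\<lambda>y. (R + norm y) powr m) x \<le> (LBINT y. (R + norm x) powr m * (K y * (1 + norm y / real (Suc k)) powr m))"
      unfolding cv_def
    proof (intro integral_mono cv_integrable[OF grows_weight] integrable_mult_right int)
      fix y
      have "R + norm (x - y) \<le> R + norm x + norm y" using norm_triangle_ineq4[of x y] by simp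
      also have "\<dots> \<le> (R + norm x) * (1 + norm y / R)"
        using R by (simp add: field_simps)
      finally have "(R + norm (x - y)) powr m \<le> ((R + norm x) * (1 + norm y / R)) powr m"
        using m R by (intro powr_mono2) auto
      also have "\<dots> = (R + norm x) powr m * (1 + norm y / R) powr m"
        using R by (simp add: powr_mult)
      finally show "K y * (R + norm (x - y)) powr m \<le> (R + norm x) powr m * (K y * (1 + norm y / real (Suc k)) powr m)"
        using mult_left_mono[OF _ K_nonneg[of y]] by (simp add: R_def mult.left_commute)
    qed (use m R in auto)
    also have "\<dots> = I k * (R + norm x) powr m" by (simp add: I_def mult.commute)
    also have "\<dots> \<le> q * (R + norm x) powr m" using k by (intro mult_right_mono) auto
    finally show ?thesis .
  qed
  with R show thesis by (rule that)
qed

text \<open>On a bounded piece the integrands share the majorant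
  \<open>M * (1 + r) powr m * (K y * wt m y)\<close>, so continuity is dominated
  convergence.\<close>

lemma tame_cv:
  assumes f: "tame m f" and m: "0 \<le> m"
  shows "tame m (\<lambda>x t. cv (\<lambda>y. f y t) x)"
  unfolding tame_def
proof (intro conjI allI)
  show "continuous_on (UNIV \<times> {0..}) (\<lambda>(x, t). cv (\<lambda>y. f y t) x)"
  proof (rule continuous_on_half_spaceI)
    fix r :: real assume "0 \<le> r"
    obtain M where M: "0 < M" "\<And>x t. 0 \<le> t \<Longrightarrow> t \<le> r \<Longrightarrow> \<bar>f x t\<bar> \<le> M * wt m x"
      using tame_bound[OF f] by metis
    show "continuous_on (cball 0 r \<times> {0..r}) (\<lambda>(x, t). cv (\<lambda>y. f y t) x)"
      unfolding continuous_on_sequentially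
    proof (intro allI ballI impI)
      fix z :: "nat \<Rightarrow> (real^'n) \<times> real" and l
      assume l: "l \<in> cball 0 r \<times> {0..r}" and z: "(\<forall>k. z k \<in> cball 0 r \<times> {0..r}) \<and> z \<longlonglongrightarrow> l"
      have fst: "(\<lambda>k. fst (z k)) \<longlonglongrightarrow> fst l" and snd: "(\<lambda>k. snd (z k)) \<longlonglongrightarrow> snd l"
        using z by (auto intro: tendsto_fst tendsto_snd)
      have zk: "norm (fst (z k)) \<le> r" "0 \<le> snd (z k)" "snd (z k) \<le> r" for k
        using z by (force simp: mem_Times_iff)+
      have l': "0 \<le> snd l" using l by auto
      have "(\<lambda>k. LBINT y. K y * f (fst (z k) - y) (snd (z k))) \<longlonglongrightarrow> (LBINT y. K y * f (fst l - y) (snd l))"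
      proof (rule integral_dominated_convergence[where w="\<lambda>y. M * (1 + r) powr m * (K y * wt m y)"])
        show "AE y in lborel. (\<lambda>k. K y * f (fst (z k) - y) (snd (z k))) \<longlonglongrightarrow> K y * f (fst l - y) (snd l)"
        proof (rule AE_I2)
          fix y
          have "continuous_on (UNIV \<times> {0..}) (\<lambda>z. f (fst z - y) (snd z))"
            by (rule tame_continuous_compose[OF f]) (auto intro!: continuous_intros)
          then have "((\<lambda>z. f (fst z - y) (snd z)) \<circ> z) \<longlonglongrightarrow> f (fst l - y) (snd l)"
            using z zk(2) l' unfolding continuous_on_sequentially by (auto simp: mem_Times_iff)
          then show "(\<lambda>k. K y * f (fst (z k) - y) (snd (z k))) \<longlonglongrightarrow> K y * f (fst l - y) (snd l)"
            by (intro tendsto_intros) (simp add: comp_def)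
        qed
        show "AE y in lborel. norm (K y * f (fst (z k) - y) (snd (z k))) \<le> M * (1 + r) powr m * (K y * wt m y)" for k
        proof (rule AE_I2)
          fix y
          have "\<bar>f (fst (z k) - y) (snd (z k))\<bar> \<le> M * (wt m (fst (z k)) * wt m y)"
            using M(1) by (intro order_trans[OF M(2)[OF zk(2,3)]] mult_left_mono one_plus_norm_powr_diff_le m) auto
          also have "\<dots> \<le> M * ((1 + r) powr m * wt m y)"
            using M(1) zk(1)[of k] m by (intro mult_left_mono mult_right_mono powr_mono2) auto
          finally have "K y * \<bar>f (fst (z k) - y) (snd (z k))\<bar> \<le> K y * (M * ((1 + r) powr m * wt m y))"
            by (rule mult_left_mono) simp
          then show "norm (K y * f (fst (z k) - y) (snd (z k))) \<le> M * (1 + r) powr m * (K y * wt m y)"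
            by (simp add: abs_mult mult_ac)
        qed
        show "integrable lborel (\<lambda>y. M * (1 + r) powr m * (K y * wt m y))"
          using K_moment[OF m] by simp
        show "(\<lambda>y. K y * f (fst l - y) (snd l)) \<in> borel_measurable lborel"
          using borel_measurable_integrable[OF cv_integrable[OF grows_if_tame[OF f m l']]] .
        show "(\<lambda>y. K y * f (fst (z k) - y) (snd (z k))) \<in> borel_measurable lborel" for k
          using borel_measurable_integrable[OF cv_integrable[OF grows_if_tame[OF f m zk(2)]]] .
      qed
      then show "((\<lambda>(x, t). cv (\<lambda>y. f y t) x) \<circ> z) \<longlonglongrightarrow> (\<lambda>(x, t). cv (\<lambda>y. f y t) x) l"
        by (simp add: comp_def case_prod_beta cv_def)
    qed
  qed
  fix T
  obtain M where M: "0 < M" "\<And>x t. 0 \<le> t \<Longrightarrow> t \<le> T \<Longrightarrow> \<bar>f x t\<bar> \<le> M * wt m x"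
    using tame_bound[OF f] by metis
  obtain C where C: "\<And>x. cv (\<lambda>y. wt m y) x \<le> C * wt m x"
    using cv_weight_le[OF m] by metis
  have "\<bar>cv (\<lambda>y. f y t) x\<bar> \<le> (M * C) * wt m x" if t: "t \<in> {0..T}" for x t
  proof -
    have t': "0 \<le> t" "t \<le> T" using t by auto
    have g: "grows m (\<lambda>y. f y t)" by (rule grows_if_tame[OF f m t'(1)])
    have "\<bar>cv (\<lambda>y. f y t) x\<bar> \<le> cv (\<lambda>y. \<bar>f y t\<bar>) x"
      using abs_cv_diff_le[OF g grows_bounded[of "\<lambda>_. 0" 0]] by simp
    also have "\<dots> \<le> cv (\<lambda>y. M * wt m y) x"
      using M t' m by (intro cv_mono[OF grows_abs[OF g] grows_cmult[OF grows_weight]]) auto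
    also have "\<dots> \<le> M * (C * wt m x)"
      unfolding cv_cmult using C M by (intro mult_left_mono) auto
    finally show ?thesis by (simp add: mult.assoc)
  qed
  then show "\<exists>M. \<forall>x. \<forall>t\<in>{0..T}. \<bar>cv (\<lambda>y. f y t) x\<bar> \<le> M * wt m x" by blast
qed

text \<open>Almost everywhere equality is reflected to \<open>x - y\<close> and carried to the
  completed measure before passing to the Borel kernel; the two orders of the arguments are matched
  by y -> x - y.\<close>

lemma bconv_eq_cv:
  assumes BK: "AE x in lborel. B x = K x" and [measurable]: "\<phi> \<in> borel_measurable borel"
  shows "bconv B \<phi> x = cv \<phi> x"
proof -
  have ae: "AE y in lebesgue. K (x - y) * \<phi> y = B (x - y) * \<phi> y"
    using AE_completion[OF AE_lborel_reflect[OF BK, of x]] by eventually_elim simp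
  have m: "(\<lambda>y. K (x - y) * \<phi> y) \<in> borel_measurable lebesgue"
    by (rule measurable_completion) measurable
  have "bconv B \<phi> x = (\<integral>y. K (x - y) * \<phi> y \<partial>lebesgue)"
    unfolding bconv_def by (rule integral_cong_AE[OF borel_measurable_AE[OF m ae] m]) (use ae in \<open>auto elim: eventually_mono\<close>)
  also have "\<dots> = (LBINT y. K (x - y) * \<phi> y)"
    by (rule integral_completion) measurable
  also have "\<dots> = cv \<phi> x"
    unfolding cv_def using integral_reflect_lborel[of "\<lambda>y. K y * \<phi> (x - y)" x] by simp
  finally show ?thesis .
qed

text \<open>For \<open>y\<close> in the ball around \<open>x - z\<close> the point
  \<open>x - y\<close> lies in the ball around \<open>z\<close>, and \<open>norm y\<close> is at
  most \<open>norm (x - z) + r\<close>. Thus positivity on one ball spreads to the whole space with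
  at most exponential loss.\<close>

lemma cv_ge_ball:
  assumes g: "grows m \<phi>" and \<phi>0: "\<And>y. 0 \<le> \<phi> y" and r: "0 < r" and \<delta>: "0 \<le> \<delta>" "\<And>y. y \<in> cball z r \<Longrightarrow> \<delta> \<le> \<phi> y"
  shows "\<delta> * c * exp (- lam * (norm (x - z) + r)) * measure lborel (cball (0 :: real^'n) r) \<le> cv \<phi> x"
proof -
  define k where "k = c * exp (- lam * (norm (x - z) + r)) * \<delta>"
  have k: "0 \<le> k" using c_pos \<delta> by (simp add: k_def)
  have "k * measure lborel (cball (x - z) r) = (LBINT y. k * indicator (cball (x - z) r) y)"
    by simp
  also have "\<dots> \<le> cv \<phi> x"
    unfolding cv_def
  proof (intro integral_mono cv_integrable[OF g])
    show "integrable lborel (\<lambda>y. k * indicat_real (cball (x - z) r) y)"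
      by (intro integrable_mult_right integrable_real_indicator) (use emeasure_bounded_finite[OF bounded_cball] in \<open>auto simp: less_top\<close>)
    fix y
    show "k * indicator (cball (x - z) r) y \<le> K y * \<phi> (x - y)"
    proof (cases "y \<in> cball (x - z) r")
      case True
      then have d: "norm ((x - z) - y) \<le> r" by (simp add: dist_norm)
      have "norm y \<le> norm (x - z) + norm ((x - z) - y)" using norm_triangle_sub[of y "x - z"] by (simp add: norm_minus_commute)
      then have ny: "norm y \<le> norm (x - z) + r" using d by linarith
      have "x - y \<in> cball z r" using d by (simp add: dist_norm norm_minus_commute algebra_simps)
      then have 1: "\<delta> \<le> \<phi> (x - y)" by (rule \<delta>)
      have "c * exp (- lam * (norm (x - z) + r)) \<le> c * exp (- lam * norm y)"
        using ny c_pos lam_pos by (intro mult_left_mono) auto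
      also have "\<dots> \<le> K y" by (rule K_ge)
      finally have "k \<le> K y * \<phi> (x - y)" unfolding k_def using 1 \<delta> by (intro mult_mono) auto
      with True show ?thesis by simp
    qed (use \<phi>0 in auto)
  qed
  also have "measure lborel (cball (x - z) r) = measure lborel (cball (0 :: real^'n) r)"
    using r by (simp add: content_cball)
  finally show ?thesis by (simp add: k_def mult_ac)
qed

end

section \<open>Lower bounds for nontrivial solutions\<close>

lemma set_integral_ge_0:
  fixes f :: "'a \<Rightarrow> real"
  shows "(\<And>x. x \<in> S \<Longrightarrow> 0 \<le> f x) \<Longrightarrow> 0 \<le> (LINT x:S|M. f x)"
  unfolding set_lebesgue_integral_def by (intro integral_nonneg_AE AE_I2) (auto simp: indicator_def)

lemma set_integral_subinterval_le:
  fixes f :: "real \<Rightarrow> real"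
  assumes "a \<le> s" "s \<le> s'" "s' \<le> b" and f: "continuous_on {a..b} f" and f0: "\<And>x. a \<le> x \<Longrightarrow> x \<le> b \<Longrightarrow> 0 \<le> f x"
  shows "(LINT x:{s..s'}|lborel. f x) \<le> (LINT x:{a..b}|lborel. f x)"
proof -
  have nn: "0 \<le> (LINT x:{u..v}|lborel. f x)" if "a \<le> u" "v \<le> b" for u v
    using that f0 by (intro set_integral_ge_0) auto
  have "(LINT x:{a..b}|lborel. f x) = (LINT x:{a..s}|lborel. f x) + (LINT x:{s..b}|lborel. f x)"
    using assms by (intro set_integral_combine) auto
  moreover have "(LINT x:{s..b}|lborel. f x) = (LINT x:{s..s'}|lborel. f x) + (LINT x:{s'..b}|lborel. f x)"
    using assms by (intro set_integral_combine) (auto intro: continuous_on_subset)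
  ultimately show ?thesis using nn[of a s] nn[of s' b] assms by simp
qed

section \<open>The integral operator and its admissible functions\<close>

text \<open>In \<open>\<epsilon>0prop\<close> the variable has been reflected, so that the cut-off
  sits on the argument of the profile. It removes exactly the unit ball, inside which
  \<open>V\<close> has no positive lower bound.\<close>

locale semilinear = conv_kernel K c lam eps for K :: "real^'n \<Rightarrow> real" and c lam eps +
  fixes V :: "real^'n \<Rightarrow> real" and \<sigma> vl vu p \<epsilon>0 a :: real
  assumes \<sigma>: "0 \<le> \<sigma>" and vl: "0 < vl" and vu: "0 < vu"
    and Vcont: "continuous_on UNIV V" and Vnn: "\<And>x. 0 \<le> V x"
    and Vlow: "\<And>x. 1 \<le> norm x \<Longrightarrow> vl * rpow (norm x) \<sigma> \<le> V x"
    and Vupp: "\<And>x. V x \<le> vu * rpow (norm x) \<sigma>"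
    and \<epsilon>0: "0 < \<epsilon>0"
    and \<epsilon>0prop: "\<And>x d. 0 \<le> d \<Longrightarrow> d \<le> \<sigma> * p / (1 - p) \<Longrightarrow>
      \<epsilon>0 * rpow (norm x) (\<sigma> + d) \<le> cv (\<lambda>y. indicator {y. 1 \<le> norm y} y * rpow (norm y) (\<sigma> + d)) x"
    and p: "0 < p" "p < 1" "p * vu < \<epsilon>0 * vl"
    and a: "\<sigma> / (1 - p) \<le> a"
begin

text \<open>The exponent of the nonzero solution of \<open>f' = f powr p\<close>,
  \<open>f 0 = 0\<close>. The balance \<open>b * p = b - 1\<close> is used throughout.\<close>

definition b :: real where "b = 1 / (1 - p)"

lemma b: "1 < b" "(1 - p) * b = 1" "b * (1 - p) = 1" "b * p = b - 1" "0 < b"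
  using p by (simp_all add: b_def field_simps)

lemma a_nonneg: "0 \<le> a"
  using a \<sigma> p by (smt (verit) divide_nonneg_pos)

lemma \<sigma>_b_le: "\<sigma> * b \<le> a"
  using a by (simp add: b_def)

text \<open>This is the lower bound on \<open>a\<close> in another form: if \<mu> has growth order
  \<open>a\<close>, then \<open>V * \<mu> powr p\<close> has order \<open>\<sigma> + a * p\<close>
  and stays in the same class.\<close>

lemma \<sigma>_a_p_le: "\<sigma> + a * p \<le> a"
  using a p by (simp add: field_simps)

lemma \<sigma>_le_a: "\<sigma> \<le> a"
  using \<sigma>_a_p_le mult_nonneg_nonneg[OF a_nonneg, of p] p(1) by linarith

abbreviation E :: "real \<Rightarrow> real" where
  "E t \<equiv> exp ((1 - p) * t)"

abbreviation nl :: "(real^'n \<Rightarrow> real \<Rightarrow> real) \<Rightarrow> real \<Rightarrow> real^'n \<Rightarrow> real" where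
  "nl \<mu> t \<equiv> \<lambda>y. V y * \<mu> y t powr p"

definition src :: "(real^'n \<Rightarrow> real \<Rightarrow> real) \<Rightarrow> real^'n \<Rightarrow> real \<Rightarrow> real" where
  "src \<mu> x t = cv (\<lambda>y. \<mu> y t) x + E t * cv (nl \<mu> t) x"

definition duhamel :: "(real^'n \<Rightarrow> real \<Rightarrow> real) \<Rightarrow> real^'n \<Rightarrow> real \<Rightarrow> real" where
  "duhamel \<mu> x t = (LINT v:{0..t}|lborel. src \<mu> x v)"

definition adm :: "(real^'n \<Rightarrow> real \<Rightarrow> real) \<Rightarrow> bool" where
  "adm \<mu> \<longleftrightarrow> tame a \<mu> \<and> (\<forall>x. \<forall>t\<ge>0. 0 \<le> \<mu> x t)"

definition sol :: "(real^'n \<Rightarrow> real \<Rightarrow> real) \<Rightarrow> bool" where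
  "sol \<mu> \<longleftrightarrow> adm \<mu> \<and> (\<forall>x. \<forall>t\<ge>0. \<mu> x t = duhamel \<mu> x t)"

lemma V_powr_le:
  assumes "0 \<le> m" "m \<le> M * wt a x" "0 \<le> M"
  shows "V x * m powr p \<le> vu * M powr p * wt a x"
proof -
  have 1: "V x \<le> vu * (1 + norm x) powr \<sigma>"
    using vu \<sigma> by (intro order_trans[OF Vupp] mult_left_mono rpow_le) auto
  have "m powr p \<le> (M * wt a x) powr p"
    using assms p by (intro powr_mono2) auto
  then have 2: "m powr p \<le> M powr p * (1 + norm x) powr (a * p)"
    using assms by (simp add: powr_mult powr_powr)
  have "V x * m powr p \<le> (vu * (1 + norm x) powr \<sigma>) * (M powr p * (1 + norm x) powr (a * p))"
    using vu by (intro mult_mono 1 2) auto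
  also have "\<dots> = vu * M powr p * (1 + norm x) powr (\<sigma> + a * p)"
    by (simp add: powr_add)
  also have "\<dots> \<le> vu * M powr p * wt a x"
    using vu by (intro mult_left_mono powr_mono \<sigma>_a_p_le) auto
  finally show ?thesis .
qed

lemma V_measurable [measurable]: "V \<in> borel_measurable borel"
  by (rule borel_measurable_continuous_onI[OF Vcont])

lemma grows_V_powr:
  assumes [measurable]: "\<phi> \<in> borel_measurable borel" and "\<And>y. 0 \<le> \<phi> y" "\<And>y. \<phi> y \<le> M * wt a y" "0 \<le> M"
  shows "grows a (\<lambda>y. V y * \<phi> y powr p)"
  by (rule growsI[where M="vu * M powr p"]) (use assms V_powr_le Vnn a_nonneg in \<open>auto simp: abs_mult\<close>)

lemma adm_tame: "adm \<mu> \<Longrightarrow> tame a \<mu>"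
  and adm_nonneg: "adm \<mu> \<Longrightarrow> 0 \<le> t \<Longrightarrow> 0 \<le> \<mu> x t"
  by (auto simp: adm_def)

lemma tame_V_powr:
  assumes \<mu>: "adm \<mu>"
  shows "tame a (\<lambda>x t. V x * \<mu> x t powr p)"
  unfolding tame_def
proof (intro conjI allI)
  note t = adm_tame[OF \<mu>]
  have "continuous_on (UNIV \<times> {0..}) (\<lambda>z. V (fst z))"
    by (rule continuous_on_compose2[OF Vcont]) (auto intro: continuous_intros)
  moreover have "continuous_on (UNIV \<times> {0..}) (\<lambda>z. \<mu> (fst z) (snd z))"
    by (rule tame_continuous_compose[OF t]) (auto intro: continuous_intros)
  ultimately show "continuous_on (UNIV \<times> {0..}) (\<lambda>(x, t). V x * \<mu> x t powr p)"
    unfolding case_prod_beta using adm_nonneg[OF \<mu>] p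
    by (intro continuous_on_mult continuous_on_powr' continuous_on_const) auto
  fix T
  obtain M where M: "0 < M" "\<And>x t. 0 \<le> t \<Longrightarrow> t \<le> T \<Longrightarrow> \<bar>\<mu> x t\<bar> \<le> M * wt a x"
    using tame_bound[OF t] by metis
  have "\<bar>V x * \<mu> x t powr p\<bar> \<le> vu * M powr p * wt a x" if "t \<in> {0..T}" for x t
    using V_powr_le[of "\<mu> x t" M x] M(1) M(2)[of t x] that adm_nonneg[OF \<mu>, of t x] Vnn[of x] by (simp add: abs_mult)
  then show "\<exists>M. \<forall>x. \<forall>t\<in>{0..T}. \<bar>V x * \<mu> x t powr p\<bar> \<le> M * wt a x" by blast
qed

lemma grows_adm:
  assumes "adm \<mu>" "0 \<le> t"
  shows "grows a (\<lambda>y. \<mu> y t)" "grows a (nl \<mu> t)"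
  using grows_if_tame[OF adm_tame[OF assms(1)] a_nonneg assms(2)]
    grows_if_tame[OF tame_V_powr[OF assms(1)] a_nonneg assms(2)] by auto

lemma tame_exp_cv:
  assumes \<mu>: "adm \<mu>"
  shows "tame a (\<lambda>x t. E t * cv (nl \<mu> t) x)"
  by (rule tame_mult_time[OF tame_cv[OF tame_V_powr[OF \<mu>] a_nonneg]]) (auto intro!: continuous_intros)

lemma tame_src:
  assumes \<mu>: "adm \<mu>"
  shows "tame a (src \<mu>)"
  unfolding src_def[abs_def]
  by (rule tame_add[OF tame_cv[OF adm_tame[OF \<mu>] a_nonneg] tame_exp_cv[OF \<mu>]])

lemma src_nonneg: "adm \<mu> \<Longrightarrow> 0 \<le> t \<Longrightarrow> 0 \<le> src \<mu> x t"
  unfolding src_def using cv_nonneg[of "\<lambda>y. \<mu> y t" x] cv_nonneg[of "nl \<mu> t" x]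
  by (simp add: adm_nonneg Vnn)

lemma src_continuous: "adm \<mu> \<Longrightarrow> S \<subseteq> {0..} \<Longrightarrow> continuous_on S (\<lambda>v. src \<mu> x v)"
  by (rule tame_continuous_time[OF tame_src])

lemma adm_duhamel:
  assumes "adm \<mu>"
  shows "adm (duhamel \<mu>)"
proof -
  have "tame a (duhamel \<mu>)"
    unfolding duhamel_def[abs_def] by (rule tame_integral[OF tame_src[OF assms]])
  moreover have "0 \<le> duhamel \<mu> x t" for x t
    unfolding duhamel_def by (rule set_integral_ge_0) (use src_nonneg[OF assms] in auto)
  ultimately show ?thesis by (auto simp: adm_def)
qed

lemma src_mono:
  assumes \<mu>: "adm \<mu>" and \<nu>: "adm \<nu>" and t: "0 \<le> t" and le: "\<And>y. \<mu> y t \<le> \<nu> y t"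
  shows "src \<mu> x t \<le> src \<nu> x t"
proof -
  have "cv (\<lambda>y. \<mu> y t) x \<le> cv (\<lambda>y. \<nu> y t) x"
    by (rule cv_mono[OF grows_adm(1)[OF \<mu> t] grows_adm(1)[OF \<nu> t] le])
  moreover have "cv (nl \<mu> t) x \<le> cv (nl \<nu> t) x"
    by (rule cv_mono[OF grows_adm(2)[OF \<mu> t] grows_adm(2)[OF \<nu> t]])
       (use le adm_nonneg[OF \<mu> t] Vnn p in \<open>auto intro!: mult_left_mono powr_mono2\<close>)
  ultimately show ?thesis
    unfolding src_def by (intro add_mono mult_left_mono) auto
qed

lemma duhamel_mono:
  assumes "adm \<mu>" "adm \<nu>" "0 \<le> t" "\<And>y s. 0 \<le> s \<Longrightarrow> s \<le> t \<Longrightarrow> \<mu> y s \<le> \<nu> y s"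
  shows "duhamel \<mu> x t \<le> duhamel \<nu> x t"
  unfolding duhamel_def
  by (rule set_integral_mono[OF borel_integrable_atLeastAtMost'[OF src_continuous[OF assms(1)]]
        borel_integrable_atLeastAtMost'[OF src_continuous[OF assms(2)]]])
     (use assms in \<open>auto intro!: src_mono\<close>)

text \<open>The power \<open>(F s t)\<^sup>b\<close> solves \<open>f' = e\<^bsup>(1-p)t\<^esup> f\<^sup>p\<close> with \<open>f(s) = 0\<close>: it is the time profile of all lower bounds.\<close>

definition F :: "real \<Rightarrow> real \<Rightarrow> real" where
  "F s t = E t - E s"

lemma F_nonneg: "s \<le> t \<Longrightarrow> 0 \<le> F s t"
  and F_pos: "s < t \<Longrightarrow> 0 < F s t"
  and F_mono: "t \<le> t' \<Longrightarrow> F s t \<le> F s t'"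
  using p by (simp_all add: F_def mult_left_mono)

lemma F_powr_continuous: "0 < r \<Longrightarrow> continuous_on {s..t} (\<lambda>v. F s v powr r)"
  using F_nonneg[of s] by (intro continuous_on_powr') (auto simp: F_def[abs_def] intro!: continuous_intros)

lemma F_powr_derivative:
  assumes "s < v"
  shows "((\<lambda>v. k * F s v powr b) has_real_derivative k * (E v * F s v powr (b * p))) (at v)"
proof -
  have D: "(F s has_real_derivative (1 - p) * E v) (at v)"
    unfolding F_def[abs_def] by (auto intro!: derivative_eq_intros)
  have "((\<lambda>v. F s v powr b) has_real_derivative (b * F s v powr (b - 1)) * ((1 - p) * E v)) (at v)"
    by (rule DERIV_chain2[OF has_real_derivative_powr[OF F_pos[OF assms]] D])
  also have "(b * F s v powr (b - 1)) * ((1 - p) * E v)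
    = (b * (1 - p)) * (E v * F s v powr (b * p))" unfolding b(4) by (simp add: mult_ac)
  finally show ?thesis unfolding b(3) by (auto intro: DERIV_cmult)
qed

section \<open>Iteration of lower bounds\<close>

text \<open>Only the nonlinear part of \<open>src\<close> is kept. The p-th power turns
  \<open>F s v powr b\<close> into \<open>F s v powr (b * p)\<close>, and integrating this against
  \<open>E v\<close> restores \<open>F s t powr b\<close>; the constant \<open>C\<close> becomes
  \<open>\<kappa> * C powr p\<close>.\<close>

lemma duhamel_lower:
  assumes \<mu>: "adm \<mu>" and s: "0 \<le> s" "s \<le> t" and C: "0 \<le> C"
    and lb: "\<And>y v. s \<le> v \<Longrightarrow> v \<le> t \<Longrightarrow> C * F s v powr b * \<phi> y \<le> \<mu> y v"
    and [measurable]: "\<phi> \<in> borel_measurable borel" and \<phi>: "\<And>y. 0 \<le> \<phi> y" "\<And>y. \<phi> y \<le> wt a y"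
    and \<psi>: "\<kappa> * \<psi> x \<le> cv (\<lambda>y. V y * \<phi> y powr p) x"
  shows "\<kappa> * C powr p * F s t powr b * \<psi> x \<le> duhamel \<mu> x t"
proof -
  define k where "k = C powr p * (\<kappa> * \<psi> x)"
  have cont: "continuous_on {0..t} (\<lambda>v. src \<mu> x v)" by (rule src_continuous[OF \<mu>]) auto
  have "k * F s t powr b - k * F s s powr b \<le> (LINT v:{s..t}|lborel. src \<mu> x v)"
  proof (rule set_integral_ge_FTC[where F'="\<lambda>v. k * (E v * F s v powr (b * p))", OF s(2)])
    show "continuous_on {s..t} (\<lambda>v. k * F s v powr b)"
      by (intro continuous_intros F_powr_continuous b)
    show "continuous_on {s..t} (\<lambda>v. k * (E v * F s v powr (b * p)))"
      using b p by (intro continuous_intros F_powr_continuous) auto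
    show "continuous_on {s..t} (\<lambda>v. src \<mu> x v)" using cont s by (auto intro: continuous_on_subset)
    show "((\<lambda>v. k * F s v powr b) has_real_derivative k * (E v * F s v powr (b * p))) (at v)"
      if "s < v" for v by (rule F_powr_derivative[OF that])
    fix v assume v: "s \<le> v" "v \<le> t"
    then have v0: "0 \<le> v" using s by simp
    have "C powr p * F s v powr (b * p) * (\<kappa> * \<psi> x) \<le> C powr p * F s v powr (b * p) * cv (\<lambda>y. V y * \<phi> y powr p) x"
      by (intro mult_left_mono \<psi>) auto
    also have "\<dots> = cv (\<lambda>y. C powr p * F s v powr (b * p) * (V y * \<phi> y powr p)) x"
      by (simp add: cv_cmult)
    also have "\<dots> \<le> cv (nl \<mu> v) x"
    proof (rule cv_mono[OF grows_cmult[OF grows_V_powr[where M=1]] grows_adm(2)[OF \<mu> v0]])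
      fix y
      have "(C * F s v powr b * \<phi> y) powr p \<le> \<mu> y v powr p"
        using p C \<phi> by (intro powr_mono2 lb v) auto
      then have "C powr p * F s v powr (b * p) * \<phi> y powr p \<le> \<mu> y v powr p"
        using C \<phi> by (simp add: powr_mult powr_powr)
      then have "V y * (C powr p * F s v powr (b * p) * \<phi> y powr p) \<le> V y * \<mu> y v powr p"
        by (intro mult_left_mono Vnn)
      then show "C powr p * F s v powr (b * p) * (V y * \<phi> y powr p) \<le> V y * \<mu> y v powr p"
        by (simp add: mult_ac)
    qed (use \<phi> in auto)
    finally have "E v * (C powr p * F s v powr (b * p) * (\<kappa> * \<psi> x)) \<le> E v * cv (nl \<mu> v) x"
      by (intro mult_left_mono) auto
    also have "\<dots> \<le> src \<mu> x v"
      unfolding src_def using cv_nonneg[of "\<lambda>y. \<mu> y v" x] adm_nonneg[OF \<mu> v0] by simp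
    finally show "k * (E v * F s v powr (b * p)) \<le> src \<mu> x v"
      by (simp add: k_def mult_ac)
  qed
  also have "\<dots> \<le> duhamel \<mu> x t"
    unfolding duhamel_def using s cont src_nonneg[OF \<mu>] by (intro set_integral_subinterval_le) auto
  finally show ?thesis by (simp add: k_def F_def mult_ac)
qed

lemma sol_lower_iterate:
  assumes \<mu>: "sol \<mu>" and s: "0 \<le> s" and C: "0 < C" and \<kappa>: "0 < \<kappa>"
    and [measurable]: "\<And>k. \<phi> k \<in> borel_measurable borel"
    and \<phi>: "\<And>k y. 0 \<le> \<phi> k y" "\<And>k y. \<phi> k y \<le> wt a y"
    and step: "\<And>k x. \<kappa> * \<phi> (Suc k) x \<le> cv (\<lambda>y. V y * \<phi> k y powr p) x"
    and start: "\<And>y v. s \<le> v \<Longrightarrow> v \<le> T \<Longrightarrow> C * F s v powr b * \<phi> 0 y \<le> \<mu> y v"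
    and lim: "(\<lambda>k. \<phi> k x) \<longlonglongrightarrow> \<psi>" and t: "s \<le> t" "t \<le> T"
  shows "\<kappa> powr b * F s t powr b * \<psi> \<le> \<mu> x t"
proof -
  \<comment> \<open>The closed form of \<open>D (Suc k) = \<kappa> * D k powr p\<close> with
    \<open>D 0 = C\<close>. The exponent of \<kappa> is the partial geometric sum
    \<open>(1 - p ^ k) / (1 - p)\<close>, which tends to \<open>b\<close>, while the exponent
    \<open>p ^ k\<close> of \<open>C\<close> tends to 0.\<close>
  define D where "D = (\<lambda>k. \<kappa> powr (b * (1 - p ^ k)) * C powr (p ^ k))"
  have D_Suc: "D (Suc k) = \<kappa> * D k powr p" for k
  proof -
    have "b * (1 - p ^ Suc k) = 1 + b * (1 - p ^ k) * p"
      using b(4) by (simp add: algebra_simps)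
    then have "\<kappa> powr (b * (1 - p ^ Suc k)) = \<kappa> * \<kappa> powr (b * (1 - p ^ k) * p)"
      using \<kappa> by (simp add: powr_add)
    then show ?thesis
      unfolding D_def using \<kappa> C by (simp add: powr_mult powr_powr mult_ac)
  qed
  have bound: "s \<le> v \<Longrightarrow> v \<le> T \<Longrightarrow> D k * F s v powr b * \<phi> k y \<le> \<mu> y v" for k y v
  proof (induction k arbitrary: y v)
    case 0
    then show ?case using start C \<kappa> by (simp add: D_def)
  next
    case (Suc k)
    have "\<kappa> * D k powr p * F s v powr b * \<phi> (Suc k) y \<le> duhamel \<mu> y v"
      using \<mu> s Suc.prems by (intro duhamel_lower[where \<phi>="\<phi> k"] Suc.IH \<phi> step) (auto simp: sol_def D_def)
    then show ?case using \<mu> s Suc.prems by (simp add: D_Suc sol_def)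
  qed
  have "D \<longlonglongrightarrow> \<kappa> powr (b * (1 - 0)) * C powr 0"
    unfolding D_def using \<kappa> C p by (intro tendsto_intros LIMSEQ_power_zero) auto
  then have "D \<longlonglongrightarrow> \<kappa> powr b" using C by simp
  then have "(\<lambda>k. D k * F s t powr b * \<phi> k x) \<longlonglongrightarrow> \<kappa> powr b * F s t powr b * \<psi>"
    by (intro tendsto_intros lim)
  then show ?thesis
    by (rule LIMSEQ_le_const2) (use bound[OF t] in blast)
qed

text \<open>Since \<open>V\<close> may vanish near the origin, the mass is collected on a unit ball
  around a nearby \<open>z\<close> that stays outside the unit ball. The constant is uniform in
  \<open>q\<close> because the rate shrinks during the iteration.\<close>

lemma cv_V_exp_ge:
  obtains \<kappa> where "0 < \<kappa>" "\<And>q x. 0 \<le> q \<Longrightarrow> q \<le> lam \<Longrightarrow> \<kappa> * exp (- q * norm x) \<le> cv (\<lambda>y. V y * exp (- q * norm y)) x"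
proof
  let ?v = "measure lborel (cball (0 :: real^'n) 1)"
  \<comment> \<open>The factor \<open>exp (- 3 * lam)\<close> pays for
    \<open>norm y \<le> norm x + 3\<close>, and \<open>exp (- 5 * lam)\<close> for the kernel at
    distance at most 4 + 1.\<close>
  define \<kappa> where "\<kappa> = vl * exp (- 3 * lam) * c * exp (- 5 * lam) * ?v"
  show "0 < \<kappa>" using vl c_pos by (simp add: \<kappa>_def)
  fix q :: real and x :: "real^'n" assume q: "0 \<le> q" "q \<le> lam"
  obtain z where z: "norm (x - z) \<le> 4" "2 \<le> norm z" "norm z \<le> norm x + 2"
  proof (cases "2 \<le> norm x")
    case True then show thesis by (intro that[of x]) auto
  next
    case False
    obtain e :: "real^'n" where e: "norm e = 1" using vector_choose_size[of 1] by auto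
    show thesis
      using False e norm_triangle_ineq4[of x "2 *\<^sub>R e"] by (intro that[of "2 *\<^sub>R e"]) auto
  qed
  let ?\<delta> = "vl * exp (- 3 * lam) * exp (- q * norm x)"
  have g: "grows a (\<lambda>y. V y * exp (- q * norm y))"
  proof (rule growsI[where M=vu])
    fix y
    have "V y \<le> vu * wt a y"
      using vu \<sigma> \<sigma>_le_a by (intro order_trans[OF Vupp] mult_left_mono rpow_norm_le_wt) auto
    then have "V y * exp (- q * norm y) \<le> (vu * wt a y) * 1"
      using vu q by (intro mult_mono) auto
    then show "\<bar>V y * exp (- q * norm y)\<bar> \<le> vu * wt a y" using Vnn[of y] by (simp add: abs_mult)
  qed (auto simp: a_nonneg)
  have "?\<delta> * c * exp (- lam * (norm (x - z) + 1)) * ?v \<le> cv (\<lambda>y. V y * exp (- q * norm y)) x"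
  proof (rule cv_ge_ball[OF g])
    fix y assume "y \<in> cball z 1"
    then have d: "norm (z - y) \<le> 1" by (simp add: dist_norm)
    have y1: "1 \<le> norm y" using norm_triangle_ineq2[of z y] d z by linarith
    have y2: "norm y \<le> norm x + 3" using norm_triangle_ineq2[of y z] d z by (simp add: norm_minus_commute)
    have "vl * 1 \<le> vl * rpow (norm y) \<sigma>" using y1 vl \<sigma> by (intro mult_left_mono rpow_ge_1) auto
    also have "\<dots> \<le> V y" by (rule Vlow[OF y1])
    finally have V1: "vl \<le> V y" by simp
    have "q * norm y \<le> q * norm x + 3 * lam"
      using mult_left_mono[OF y2 q(1)] q by (simp add: algebra_simps)
    then have "exp (- 3 * lam) * exp (- q * norm x) \<le> exp (- q * norm y)"
      by (simp add: mult_exp_exp)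
    then have "vl * (exp (- 3 * lam) * exp (- q * norm x)) \<le> V y * exp (- q * norm y)"
      using V1 vl Vnn[of y] by (intro mult_mono) auto
    then show "?\<delta> \<le> V y * exp (- q * norm y)" by (simp add: mult.assoc)
  qed (use Vnn vl in auto)
  moreover have "\<kappa> * exp (- q * norm x) \<le> ?\<delta> * c * exp (- lam * (norm (x - z) + 1)) * ?v"
  proof -
    have "exp (- 5 * lam) \<le> exp (- lam * (norm (x - z) + 1))"
      using mult_left_mono[OF z(1), of lam] lam_pos by (simp add: algebra_simps)
    then have "?\<delta> * c * exp (- 5 * lam) * ?v \<le> ?\<delta> * c * exp (- lam * (norm (x - z) + 1)) * ?v"
      using vl c_pos by (intro mult_right_mono mult_left_mono) auto
    then show ?thesis by (simp add: \<kappa>_def mult_ac)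
  qed
  ultimately show "\<kappa> * exp (- q * norm x) \<le> cv (\<lambda>y. V y * exp (- q * norm y)) x" by linarith
qed

text \<open>By continuity the solution exceeds \<open>m\<close> on a ball during a time interval
  ending at \<open>s0\<close>. The linear convolution spreads this over the whole space, and the
  nonnegative integrand preserves the gain at all later times.\<close>

lemma sol_initial_lower:
  assumes \<mu>: "sol \<mu>" and s0: "0 < s0" and pos: "0 < \<mu> x0 s0"
  obtains \<delta> where "0 < \<delta>" "\<And>x t. s0 \<le> t \<Longrightarrow> \<delta> * exp (- lam * norm x) \<le> \<mu> x t"
proof -
  have ad: "adm \<mu>" and eq: "\<And>x t. 0 \<le> t \<Longrightarrow> \<mu> x t = duhamel \<mu> x t" using \<mu> by (auto simp: sol_def)
  define m where "m = \<mu> x0 s0 / 2"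
  have m: "0 < m" using pos by (simp add: m_def)
  have "continuous_on (UNIV \<times> {0..}) (\<lambda>(x, t). \<mu> x t)" using adm_tame[OF ad] by (simp add: tame_def)
  then obtain \<rho> where \<rho>: "0 < \<rho>" "\<And>y r. 0 \<le> r \<Longrightarrow> dist (y, r) (x0, s0) < \<rho> \<Longrightarrow> dist (\<mu> y r) (\<mu> x0 s0) < m"
    using s0 m unfolding continuous_on_iff by (fastforce simp: mem_Times_iff)
  \<comment> \<open>A third of \<open>\<rho>\<close> keeps the sum of the space and time distances,
    at most \<open>2 * r\<close>, below \<open>\<rho>\<close>; the bound by \<open>s0\<close> keeps
    the times nonnegative.\<close>
  define r where "r = min (\<rho> / 3) s0"
  have r: "0 < r" "r \<le> s0" "r \<le> \<rho> / 3" using \<rho> s0 by (auto simp: r_def)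
  have near: "m \<le> \<mu> y v" if "y \<in> cball x0 r" "s0 - r \<le> v" "v \<le> s0" for y v
  proof -
    have "dist (y, v) (x0, s0) \<le> dist y x0 + dist v s0"
      unfolding dist_Pair_Pair by (rule sqrt_sum_squares_le_sum_abs[THEN order_trans]) simp
    also have "\<dots> \<le> r + r" using that by (intro add_mono) (auto simp: dist_commute dist_real_def)
    also have "\<dots> < \<rho>" using r \<rho> by simp
    finally have "dist (\<mu> y v) (\<mu> x0 s0) < m" using that r by (intro \<rho>) auto
    then show ?thesis unfolding dist_real_def m_def by linarith
  qed
  let ?v = "measure lborel (cball (0 :: real^'n) r)"
  define \<delta> where "\<delta> = r * (m * c * exp (- lam * (norm x0 + r)) * ?v)"
  have "0 < \<delta>" using r m c_pos by (simp add: \<delta>_def)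
  moreover have "\<delta> * exp (- lam * norm x) \<le> \<mu> x t" if t: "s0 \<le> t" for x t
  proof -
    define k where "k = m * c * exp (- lam * (norm (x - x0) + r)) * ?v"
    have cont: "continuous_on {0..t} (\<lambda>v. src \<mu> x v)" by (rule src_continuous[OF ad]) auto
    have "norm (x - x0) \<le> norm x + norm x0" by (rule norm_triangle_ineq4)
    then have "lam * norm (x - x0) \<le> lam * (norm x + norm x0)" using lam_pos by (intro mult_left_mono) auto
    then have "exp (- lam * (norm x0 + r)) * exp (- lam * norm x) \<le> exp (- lam * (norm (x - x0) + r))"
      by (simp add: mult_exp_exp algebra_simps)
    then have "(r * m * c * ?v) * (exp (- lam * (norm x0 + r)) * exp (- lam * norm x)) \<le> (r * m * c * ?v) * exp (- lam * (norm (x - x0) + r))"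
      using r m c_pos by (intro mult_left_mono) auto
    then have "\<delta> * exp (- lam * norm x) \<le> k * s0 - k * (s0 - r)"
      by (simp add: \<delta>_def k_def algebra_simps)
    also have "\<dots> \<le> (LINT v:{s0 - r..s0}|lborel. src \<mu> x v)"
    proof (rule set_integral_ge_FTC[where F'="\<lambda>_. k"])
      show "continuous_on {s0 - r..s0} (\<lambda>v. src \<mu> x v)" by (rule src_continuous[OF ad]) (use r in auto)
      fix v assume v: "s0 - r \<le> v" "v \<le> s0"
      then have v0: "0 \<le> v" using r by simp
      have "k \<le> cv (\<lambda>y. \<mu> y v) x"
        unfolding k_def using near v m r adm_nonneg[OF ad v0]
        by (intro cv_ge_ball[OF grows_adm(1)[OF ad v0]]) auto
      also have "\<dots> \<le> src \<mu> x v"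
        unfolding src_def using cv_nonneg[of "nl \<mu> v" x] Vnn by simp
      finally show "k \<le> src \<mu> x v" .
    qed (use r in \<open>auto intro!: continuous_intros derivative_eq_intros\<close>)
    also have "\<dots> \<le> duhamel \<mu> x t"
      unfolding duhamel_def using r t s0 cont src_nonneg[OF ad] by (intro set_integral_subinterval_le) auto
    finally show ?thesis using eq t s0 by simp
  qed
  ultimately show thesis by (rule that)
qed

definition A :: real where "A = \<epsilon>0 * vl"

lemma A_pos: "0 < A" using \<epsilon>0 vl by (simp add: A_def)

text \<open>Outside the unit ball \<open>V\<close> contributes the exponent \<sigma>, so the
  hypothesis on \<open>\<epsilon>0\<close> is applied with \<open>d * p\<close> in place of
  \<open>d\<close>; the condition \<open>d \<le> \<sigma> * b\<close> is what keeps
  \<open>d * p\<close> in its range.\<close>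

lemma cv_V_rpow_ge:
  assumes d: "0 \<le> d" "d \<le> \<sigma> * b"
  shows "A * rpow (norm x) (\<sigma> + d * p) \<le> cv (\<lambda>y. V y * rpow (norm y) d powr p) x"
proof -
  have dp: "0 \<le> d * p" "d * p \<le> \<sigma> * p / (1 - p)"
    using d p mult_right_mono[OF d(2), of p] by (auto simp: b_def)
  have da: "d \<le> a" using d \<sigma>_b_le by simp
  have sdp: "\<sigma> + d * p \<le> a" using mult_right_mono[OF da, of p] p(1) \<sigma>_a_p_le by linarith
  have ind: "(indicator {y::real^'n. 1 \<le> norm y} :: _ \<Rightarrow> real) \<in> borel_measurable borel"
    by measurable
  have "A * rpow (norm x) (\<sigma> + d * p) = vl * (\<epsilon>0 * rpow (norm x) (\<sigma> + d * p))" by (simp add: A_def)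
  also have "\<dots> \<le> vl * cv (\<lambda>y. indicator {y. 1 \<le> norm y} y * rpow (norm y) (\<sigma> + d * p)) x"
    using vl by (intro mult_left_mono \<epsilon>0prop dp) auto
  also have "\<dots> = cv (\<lambda>y. vl * (indicator {y. 1 \<le> norm y} y * rpow (norm y) (\<sigma> + d * p))) x"
    by (simp add: cv_cmult)
  also have "\<dots> \<le> cv (\<lambda>y. V y * rpow (norm y) d powr p) x"
  proof (rule cv_mono[OF grows_cmult grows_V_powr[where M=1]])
    show "grows a (\<lambda>y::real^'n. indicator {y. 1 \<le> norm y} y * rpow (norm y) (\<sigma> + d * p))"
      using \<sigma> dp sdp
      by (intro growsI[where M=1] borel_measurable_times ind borel_measurable_rpow_norm)
         (auto simp: a_nonneg indicator_def rpow_norm_le_wt)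
    fix y :: "real^'n"
    show "vl * (indicator {y. 1 \<le> norm y} y * rpow (norm y) (\<sigma> + d * p)) \<le> V y * rpow (norm y) d powr p"
    proof (cases "1 \<le> norm y")
      case True
      have "vl * rpow (norm y) \<sigma> * rpow (norm y) (d * p) \<le> V y * rpow (norm y) (d * p)"
        by (intro mult_right_mono Vlow True) auto
      with True show ?thesis using \<sigma> dp p by (simp add: rpow_add rpow_powr mult.assoc)
    qed (simp add: Vnn)
  qed (use d da in \<open>auto simp: rpow_norm_le_wt borel_measurable_rpow_norm\<close>)
  finally show ?thesis .
qed

definition w :: "real^'n \<Rightarrow> real \<Rightarrow> real" where
  "w x t = A powr b * F 0 t powr b * rpow (norm x) (\<sigma> * b)"

lemma w_nonneg: "0 \<le> w x t"
  by (simp add: w_def)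

lemma \<sigma>_b_nonneg: "0 \<le> \<sigma> * b"
  using \<sigma> b by simp

text \<open>All bounds are run from a time \<open>s > 0\<close> with time profile
  \<open>F s\<close>, because a positive bound is available only after some positive time. Since
  \<open>s0\<close> can be taken below every \<open>s\<close>, the limit s -> 0 may be taken at the
  end.\<close>

theorem sol_ge_w:
  assumes \<mu>: "sol \<mu>" and nz: "\<And>s. 0 < s \<Longrightarrow> \<exists>x0 s0. 0 < s0 \<and> s0 \<le> s \<and> 0 < \<mu> x0 s0" and t: "0 \<le> t"
  shows "w x t \<le> \<mu> x t"
proof (cases "t = 0")
  case True
  then show ?thesis using \<mu> adm_nonneg[of \<mu> 0 x] by (simp add: w_def F_def sol_def del: adm_nonneg)
next
  case False
  with t have t: "0 < t" by simp
  have main: "A powr b * F s t powr b * rpow (norm x) (\<sigma> * b) \<le> \<mu> x t" if s: "0 < s" "s \<le> t" for s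
  proof -
    obtain x0 s0 where s0: "0 < s0" "s0 \<le> s" "0 < \<mu> x0 s0" using nz s by blast
    obtain \<delta> where \<delta>: "0 < \<delta>" "\<And>x t. s0 \<le> t \<Longrightarrow> \<delta> * exp (- lam * norm x) \<le> \<mu> x t"
      using sol_initial_lower[OF \<mu> s0(1,3)] by metis
    obtain \<kappa> where \<kappa>: "0 < \<kappa>" "\<And>q x. 0 \<le> q \<Longrightarrow> q \<le> lam \<Longrightarrow> \<kappa> * exp (- q * norm x) \<le> cv (\<lambda>y. V y * exp (- q * norm y)) x"
      using cv_V_exp_ge by metis
    \<comment> \<open>The initial constant divides \<delta> by \<open>F s t powr b + 1\<close>,
      which makes \<open>C * F s v powr b \<le> \<delta>\<close> up to time \<open>t\<close>; the
      summand 1 avoids division by 0 when \<open>s = t\<close>.\<close>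
    have Q: "0 < F s t powr b + 1" by (rule add_nonneg_pos) auto
    have wt1: "1 \<le> wt a y" for y :: "real^'n" using a_nonneg by (intro ge_one_powr_ge_zero) auto
    \<comment> \<open>The p-th power multiplies the decay rate by \<open>p\<close>, so the
      exponential profiles flatten to the constant 1.\<close>
    have const: "\<kappa> powr b * F s v powr b * 1 \<le> \<mu> y v" if v: "s \<le> v" "v \<le> t" for y v
    proof (rule sol_lower_iterate[OF \<mu>, where \<phi>="\<lambda>k y. exp (- (lam * p ^ k) * norm y)" and T=t and C="\<delta> / (F s t powr b + 1)"])
      show "0 < \<delta> / (F s t powr b + 1)" using \<delta> Q by simp
      show "exp (- (lam * p ^ k) * norm y) \<le> wt a y" for k and y :: "real^'n"
      proof -
        have "exp (- (lam * p ^ k) * norm y) \<le> 1" using lam_pos p by simp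
        with wt1[of y] show ?thesis by linarith
      qed
      show "\<kappa> * exp (- (lam * p ^ Suc k) * norm x) \<le> cv (\<lambda>y. V y * exp (- (lam * p ^ k) * norm y) powr p) x" for k x
      proof -
        have "lam * p ^ Suc k \<le> lam" using lam_pos p power_le_one[of p "Suc k"] by (intro mult_left_le) auto
        moreover have "exp (- (lam * p ^ k) * norm y) powr p = exp (- (lam * p ^ Suc k) * norm y)" for y :: "real^'n"
          by (simp add: exp_powr_real mult_ac)
        ultimately show ?thesis using \<kappa>(2)[of "lam * p ^ Suc k" x] lam_pos p by simp
      qed
      show "\<delta> / (F s t powr b + 1) * F s v powr b * exp (- (lam * p ^ 0) * norm y) \<le> \<mu> y v" if "s \<le> v" "v \<le> t" for y v
      proof -
        have "F s v powr b \<le> F s t powr b" using that b by (intro powr_mono2 F_mono F_nonneg) auto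
        then have "\<delta> * F s v powr b \<le> \<delta> * (F s t powr b + 1)" using \<delta> by (intro mult_left_mono) auto
        then have "\<delta> / (F s t powr b + 1) * F s v powr b \<le> \<delta>" using Q by (simp add: divide_le_eq)
        then have "\<delta> / (F s t powr b + 1) * F s v powr b * exp (- lam * norm y) \<le> \<delta> * exp (- lam * norm y)"
          by (rule mult_right_mono) simp
        also have "\<dots> \<le> \<mu> y v" using that s0 by (intro \<delta>) auto
        finally show ?thesis by simp
      qed
      have "(\<lambda>k. exp (- (lam * p ^ k) * norm y)) \<longlonglongrightarrow> exp (- (lam * 0) * norm y)"
        using p by (intro tendsto_intros LIMSEQ_power_zero) auto
      then show "(\<lambda>k. exp (- (lam * p ^ k) * norm y)) \<longlonglongrightarrow> 1" by simp
    qed (use s \<kappa> v in auto)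
    \<comment> \<open>The closed form of \<open>d (Suc k) = \<sigma> + d k * p\<close> with
      \<open>d 0 = 0\<close>; it increases to the fixed point \<open>\<sigma> * b\<close>.\<close>
    define d where "d = (\<lambda>k::nat. \<sigma> * b * (1 - p ^ k))"
    have pk: "0 \<le> p ^ k" "p ^ k \<le> 1" for k using p by (auto intro: power_le_one)
    have d0: "0 \<le> d k" "d k \<le> \<sigma> * b" for k
      unfolding d_def using \<sigma>_b_nonneg pk[of k] by (auto intro!: mult_nonneg_nonneg mult_left_le)
    have d_Suc: "d (Suc k) = \<sigma> + d k * p" for k
    proof -
      have "d (Suc k) - d k * p = \<sigma> * (b - b * p)" by (simp add: d_def algebra_simps)
      then show ?thesis using b(4) by simp
    qed
    show ?thesis
    proof (rule sol_lower_iterate[OF \<mu>, where \<phi>="\<lambda>k y. rpow (norm y) (d k)" and T=t and C="\<kappa> powr b"])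
      show "rpow (norm y) (d k) \<le> wt a y" for k and y :: "real^'n"
        using d0[of k] \<sigma>_b_le by (intro rpow_norm_le_wt) auto
      show "(\<lambda>y::real^'n. rpow (norm y) (d k)) \<in> borel_measurable borel" for k
        by (rule borel_measurable_rpow_norm[OF d0(1)])
      show "A * rpow (norm x) (d (Suc k)) \<le> cv (\<lambda>y. V y * rpow (norm y) (d k) powr p) x" for k x
        unfolding d_Suc by (rule cv_V_rpow_ge[OF d0])
      show "\<kappa> powr b * F s v powr b * rpow (norm y) (d 0) \<le> \<mu> y v" if "s \<le> v" "v \<le> t" for y v
        using const[OF that, of y] by (simp add: d_def)
      show "(\<lambda>k. rpow (norm x) (d k)) \<longlonglongrightarrow> rpow (norm x) (\<sigma> * b)"
      proof (cases "\<sigma> = 0")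
        case False
        then have pos: "0 < \<sigma> * b" using \<sigma> b by simp
        show ?thesis
        proof (cases "x = 0")
          case True
          \<comment> \<open>At the origin \<open>rpow\<close> jumps at exponent 0: the term with
            \<open>k = 0\<close> is 1 and all later ones are 0, so the sequence is shifted by
            one.\<close>
          have "0 < d (Suc k)" for k
            unfolding d_def using pos p power_Suc_less_one[of p k] by simp
          then have "(\<lambda>k. rpow (norm x) (d (Suc k))) = (\<lambda>k. 0)"
            using True by (auto simp: rpow_eq_powr)
          then have "(\<lambda>k. rpow (norm x) (d (Suc k))) \<longlonglongrightarrow> rpow (norm x) (\<sigma> * b)"
            using True pos by (simp add: rpow_eq_powr)
          then show ?thesis by (rule LIMSEQ_imp_Suc)
        next
          case False
          then have "(\<lambda>k. norm x powr d k) \<longlonglongrightarrow> norm x powr (\<sigma> * b * (1 - 0))"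
            unfolding d_def using p by (intro tendsto_intros LIMSEQ_power_zero) auto
          then show ?thesis using False by (simp add: rpow_def)
        qed
      qed (simp add: d_def)
    qed (use s \<kappa> A_pos in auto)
  qed
  have "((\<lambda>s. A powr b * F s t powr b * rpow (norm x) (\<sigma> * b)) \<longlongrightarrow> w x t) (at_right 0)"
    unfolding w_def F_def using F_pos[OF t, unfolded F_def] by (intro tendsto_intros) auto
  moreover have "\<forall>\<^sub>F s in at_right 0. A powr b * F s t powr b * rpow (norm x) (\<sigma> * b) \<le> \<mu> x t"
    using eventually_at_right_less[of 0] eventually_at_rightI[of 0 t "\<lambda>s. s \<le> t"] t
    by (auto simp: eventually_at_right intro!: exI[of _ t] main)
  ultimately show ?thesis
    by (intro tendsto_upperbound) auto
qed

end

section \<open>Contraction and uniqueness\<close>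

lemma powr_diff_le:
  fixes w x y p :: real
  assumes "0 < w" "w \<le> x" "w \<le> y" "0 < p" "p < 1"
  shows "\<bar>x powr p - y powr p\<bar> \<le> p * w powr (p - 1) * \<bar>x - y\<bar>"
proof -
  have main: "v powr p - u powr p \<le> p * w powr (p - 1) * (v - u)" if uv: "w \<le> u" "u < v" for u v
  proof -
    have "\<exists>z>u. z < v \<and> v powr p - u powr p = (v - u) * (p * z powr (p - 1))"
      using uv assms by (intro MVT2 has_real_derivative_powr) auto
    then obtain z where z: "u < z" "z < v" "v powr p - u powr p = (v - u) * (p * z powr (p - 1))"
      by blast
    have "z powr (p - 1) \<le> w powr (p - 1)"
      using z uv assms by (intro powr_mono2') auto
    then have "(v - u) * (p * z powr (p - 1)) \<le> (v - u) * (p * w powr (p - 1))"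
      using uv assms by (intro mult_left_mono) auto
    with z show ?thesis by (simp add: mult_ac)
  qed
  have mono: "u powr p \<le> v powr p" if "w \<le> u" "u \<le> v" for u v
    using that assms by (intro powr_mono2) auto
  consider "x < y" | "x = y" | "y < x" by linarith
  then show ?thesis
  proof cases
    case 1 then show ?thesis using main[of x y] mono[of x y] assms by (simp add: abs_if)
  next
    case 3 then show ?thesis using main[of y x] mono[of y x] assms by (simp add: abs_if)
  qed simp
qed

context semilinear
begin

text \<open>Because \<open>b * (p - 1) = - 1\<close>, the power \<open>w powr (p - 1)\<close>
  carries \<open>norm x\<close> to the exponent \<open>- \<sigma>\<close>, which cancels the growth
  of \<open>V\<close> exactly.\<close>

lemma w_powr_neg:
  assumes "0 < t" "rpow (norm x) (\<sigma> * b) \<noteq> 0"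
  shows "V x * w x t powr (p - 1) \<le> vu / (A * F 0 t)" and "0 < w x t"
proof -
  have F: "0 < F 0 t" using F_pos assms by simp
  have r: "0 < rpow (norm x) (\<sigma> * b)" using assms(2) rpow_nonneg[of "norm x" "\<sigma> * b"] by linarith
  show "0 < w x t" using F r A_pos by (simp add: w_def)
  have bp: "b * (p - 1) = - 1" using b(3) by (simp add: algebra_simps)
  have x: "rpow (norm x) \<sigma> * rpow (norm x) (\<sigma> * b) powr (p - 1) = 1"
  proof (cases "x = 0")
    case True
    then have "\<sigma> = 0" using assms(2) b by (auto simp: rpow_def split: if_splits)
    then show ?thesis by simp
  next
    case False
    have "\<sigma> * b * (p - 1) = - \<sigma>" using bp by (simp add: mult.assoc)
    then show ?thesis using False by (simp add: rpow_def powr_powr powr_minus)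
  qed
  have "w x t powr (p - 1) = (A * F 0 t) powr - 1 * rpow (norm x) (\<sigma> * b) powr (p - 1)"
    unfolding w_def using A_pos F r bp by (simp add: powr_mult powr_powr)
  also have "\<dots> = rpow (norm x) (\<sigma> * b) powr (p - 1) / (A * F 0 t)"
    using A_pos F by (simp add: powr_minus divide_simps)
  finally have wp: "w x t powr (p - 1) = rpow (norm x) (\<sigma> * b) powr (p - 1) / (A * F 0 t)" .
  have "V x * w x t powr (p - 1) \<le> vu * rpow (norm x) \<sigma> * w x t powr (p - 1)"
    by (intro mult_right_mono Vupp) auto
  also have "\<dots> = vu * (rpow (norm x) \<sigma> * rpow (norm x) (\<sigma> * b) powr (p - 1)) / (A * F 0 t)"
    by (simp add: wp)
  also have "\<dots> = vu / (A * F 0 t)" by (simp add: x)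
  finally show "V x * w x t powr (p - 1) \<le> vu / (A * F 0 t)" .
qed

definition q :: real where "q = p * vu / A"

lemma q: "0 < q" "q < 1"
  using p vu A_pos by (auto simp: q_def A_def)

text \<open>The mean value theorem above \<open>w\<close> gives the constant
  \<open>q / F 0 t\<close>, and \<open>E t / F 0 t = 1 + 1 / F 0 t\<close> with
  \<open>F 0 t \<ge> (1 - p) * t\<close>. Where \<open>w\<close> vanishes in space, at the origin
  for \<sigma> > 0, the factor \<open>V\<close> vanishes too.\<close>

lemma nonlinearity_lipschitz:
  assumes t: "0 < t" and m: "w x t \<le> m1" "w x t \<le> m2"
  shows "E t * \<bar>V x * m1 powr p - V x * m2 powr p\<bar> \<le> q * (1 + b / t) * \<bar>m1 - m2\<bar>"
proof (cases "rpow (norm x) (\<sigma> * b) = 0")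
  case True
  then have "x = 0" "\<sigma> \<noteq> 0" by (auto simp: rpow_def split: if_splits)
  then have "V x = 0" using Vupp[of x] Vnn[of x] by (simp add: rpow_def)
  then show ?thesis using q b t by simp
next
  case False
  note w = w_powr_neg[OF t False]
  have F: "0 < F 0 t" using F_pos t by simp
  have "\<bar>V x * m1 powr p - V x * m2 powr p\<bar> = V x * \<bar>m1 powr p - m2 powr p\<bar>"
    using Vnn[of x] by (simp add: right_diff_distrib[symmetric] abs_mult)
  also have "\<dots> \<le> V x * (p * w x t powr (p - 1) * \<bar>m1 - m2\<bar>)"
    using p m w by (intro mult_left_mono Vnn powr_diff_le) auto
  also have "\<dots> = p * (V x * w x t powr (p - 1)) * \<bar>m1 - m2\<bar>" by (simp add: mult_ac)
  also have "\<dots> \<le> p * (vu / (A * F 0 t)) * \<bar>m1 - m2\<bar>"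
    using p w by (intro mult_right_mono mult_left_mono) auto
  also have "\<dots> = q / F 0 t * \<bar>m1 - m2\<bar>" by (simp add: q_def)
  finally have "E t * \<bar>V x * m1 powr p - V x * m2 powr p\<bar> \<le> E t * (q / F 0 t * \<bar>m1 - m2\<bar>)"
    by (rule mult_left_mono) simp
  also have "\<dots> = q * (E t / F 0 t) * \<bar>m1 - m2\<bar>" by simp
  also have "\<dots> \<le> q * (1 + b / t) * \<bar>m1 - m2\<bar>"
  proof -
    have F0: "F 0 t = E t - 1" by (simp add: F_def)
    then have "(1 - p) * t \<le> F 0 t" using exp_ge_add_one_self[of "(1 - p) * t"] by linarith
    then have "b / t * ((1 - p) * t) \<le> b / t * F 0 t" using b t by (intro mult_left_mono) auto
    moreover have "b / t * ((1 - p) * t) = 1" using t b(3) by simp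
    ultimately have "1 \<le> b / t * F 0 t" by simp
    moreover have "E t = 1 + F 0 t" by (simp add: F0)
    ultimately have "E t \<le> (1 + b / t) * F 0 t" by (simp add: distrib_right)
    then have "E t / F 0 t \<le> 1 + b / t" using F by (simp add: divide_le_eq)
    then show ?thesis using q by (intro mult_right_mono mult_left_mono) auto
  qed
  finally show ?thesis .
qed

section \<open>Contraction in the weighted norm\<close>

abbreviation tp :: "real \<Rightarrow> real \<Rightarrow> real" where
  "tp L t \<equiv> t powr b * exp (L * t)"

text \<open>The horizon \<open>T\<close> and the size \<open>N\<close> are quantified after
  \<open>R\<close>, \<open>L\<close> and \<theta>, so one choice of weight gives a contraction on
  every time interval. Both functions have to lie above \<open>w\<close>.\<close>

definition contracts :: "real \<Rightarrow> real \<Rightarrow> real \<Rightarrow> bool" where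
  "contracts R L \<theta> \<longleftrightarrow> 1 \<le> R \<and> 0 \<le> L \<and> 0 \<le> \<theta> \<and> \<theta> < 1 \<and>
    (\<forall>T N \<mu> \<nu>. adm \<mu> \<longrightarrow> adm \<nu> \<longrightarrow> 0 \<le> N \<longrightarrow>
      (\<forall>x t. 0 \<le> t \<longrightarrow> t \<le> T \<longrightarrow> w x t \<le> \<mu> x t \<and> w x t \<le> \<nu> x t) \<longrightarrow>
      (\<forall>x t. 0 \<le> t \<longrightarrow> t \<le> T \<longrightarrow> \<bar>\<mu> x t - \<nu> x t\<bar> \<le> N * tp L t * (R + norm x) powr a) \<longrightarrow>
      (\<forall>x t. 0 \<le> t \<longrightarrow> t \<le> T \<longrightarrow>
         \<bar>duhamel \<mu> x t - duhamel \<nu> x t\<bar> \<le> \<theta> * N * tp L t * (R + norm x) powr a))"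

lemma contractsD:
  assumes "contracts R L \<theta>" "adm \<mu>" "adm \<nu>" "0 \<le> N"
    "\<And>x t. 0 \<le> t \<Longrightarrow> t \<le> T \<Longrightarrow> w x t \<le> \<mu> x t" "\<And>x t. 0 \<le> t \<Longrightarrow> t \<le> T \<Longrightarrow> w x t \<le> \<nu> x t"
    "\<And>x t. 0 \<le> t \<Longrightarrow> t \<le> T \<Longrightarrow> \<bar>\<mu> x t - \<nu> x t\<bar> \<le> N * tp L t * (R + norm x) powr a"
    "0 \<le> t" "t \<le> T"
  shows "\<bar>duhamel \<mu> x t - duhamel \<nu> x t\<bar> \<le> \<theta> * N * tp L t * (R + norm x) powr a"
proof -
  note c = assms(1)[unfolded contracts_def, THEN conjunct2, THEN conjunct2, THEN conjunct2, THEN conjunct2]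
  show ?thesis
    by (rule c[rule_format, OF assms(2-4) _ _ assms(8,9)]) (use assms(5-7) in auto)
qed

text \<open>The linear part has Lipschitz constant 1 and the nonlinear part
  \<open>q * (1 + b / t)\<close>; multiplied by \<open>t powr b\<close>, the singularity becomes the
  integrable \<open>t powr (b - 1)\<close>. At \<open>t = 0\<close> the assumed bound forces the two
  functions to coincide.\<close>

lemma src_diff_le:
  assumes \<mu>: "adm \<mu>" and \<nu>: "adm \<nu>" and t: "0 \<le> t" and N: "0 \<le> N" and R: "1 \<le> R"
    and Q: "\<And>x. cv (\<lambda>y. (R + norm y) powr a) x \<le> Q * (R + norm x) powr a"
    and w: "\<And>y. w y t \<le> \<mu> y t" "\<And>y. w y t \<le> \<nu> y t"
    and d: "\<And>y. \<bar>\<mu> y t - \<nu> y t\<bar> \<le> N * tp L t * (R + norm y) powr a"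
  shows "\<bar>src \<mu> x t - src \<nu> x t\<bar> \<le> Q * N * (R + norm x) powr a * (((1 + q) * t powr b + q * b * t powr (b - 1)) * exp (L * t))"
proof (cases "t = 0")
  case True
  then have "\<mu> y t = \<nu> y t" for y using d[of y] by simp
  then show ?thesis using True by (simp add: src_def)
next
  case False
  with t have tp: "0 < t" by simp
  define D where "D = (\<lambda>y. \<bar>\<mu> y t - \<nu> y t\<bar>)"
  have gD: "grows a D" unfolding D_def by (intro grows_abs grows_diff grows_adm \<mu> \<nu> t)
  define k where "k = N * tp L t"
  have k: "0 \<le> k" using N by (simp add: k_def)
  have cvD: "cv D x \<le> k * (Q * (R + norm x) powr a)"
  proof -
    have "cv D x \<le> cv (\<lambda>y. k * (R + norm y) powr a) x"
      using d R by (intro cv_mono[OF gD grows_cmult[OF grows_weight[OF a_nonneg]]]) (auto simp: D_def k_def)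
    also have "\<dots> \<le> k * (Q * (R + norm x) powr a)"
      unfolding cv_cmult using Q k by (intro mult_left_mono) auto
    finally show ?thesis .
  qed
  have 1: "\<bar>cv (\<lambda>y. \<mu> y t) x - cv (\<lambda>y. \<nu> y t) x\<bar> \<le> cv D x"
    unfolding D_def by (intro abs_cv_diff_le[OF grows_adm(1) grows_adm(1)] \<mu> \<nu> t)
  let ?G = "\<lambda>y. \<bar>V y * \<mu> y t powr p - V y * \<nu> y t powr p\<bar>"
  have gG: "grows a ?G" by (intro grows_abs grows_diff grows_adm \<mu> \<nu> t)
  have "E t * \<bar>cv (nl \<mu> t) x - cv (nl \<nu> t) x\<bar>
      \<le> E t * cv ?G x"
    by (intro mult_left_mono abs_cv_diff_le[OF grows_adm(2) grows_adm(2)] \<mu> \<nu> t) auto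
  also have "\<dots> = cv (\<lambda>y. E t * ?G y) x" by (simp add: cv_cmult)
  also have "\<dots> \<le> cv (\<lambda>y. q * (1 + b / t) * D y) x"
    unfolding D_def
    by (rule cv_mono[OF grows_cmult[OF gG] grows_cmult[OF gD[unfolded D_def]]]) (rule nonlinearity_lipschitz[OF tp w])
  also have "\<dots> = q * (1 + b / t) * cv D x" by (simp add: cv_cmult)
  finally have 2: "E t * \<bar>cv (nl \<mu> t) x - cv (nl \<nu> t) x\<bar> \<le> q * (1 + b / t) * cv D x" .
  have "\<bar>src \<mu> x t - src \<nu> x t\<bar> \<le> \<bar>cv (\<lambda>y. \<mu> y t) x - cv (\<lambda>y. \<nu> y t) x\<bar>
     + E t * \<bar>cv (nl \<mu> t) x - cv (nl \<nu> t) x\<bar>"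
  proof -
    have "src \<mu> x t - src \<nu> x t = (cv (\<lambda>y. \<mu> y t) x - cv (\<lambda>y. \<nu> y t) x)
       + E t * (cv (nl \<mu> t) x - cv (nl \<nu> t) x)"
      by (simp add: src_def algebra_simps)
    then show ?thesis
      using abs_triangle_ineq[of "cv (\<lambda>y. \<mu> y t) x - cv (\<lambda>y. \<nu> y t) x"
          "E t * (cv (nl \<mu> t) x - cv (nl \<nu> t) x)"]
      by (simp add: abs_mult)
  qed
  also have "\<dots> \<le> cv D x + q * (1 + b / t) * cv D x" using 1 2 by (rule add_mono)
  also have "\<dots> = ((1 + q) + q * b / t) * cv D x" by (simp add: algebra_simps)
  also have "\<dots> \<le> ((1 + q) + q * b / t) * (k * (Q * (R + norm x) powr a))"
    using q b tp by (intro mult_left_mono cvD) auto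
  also have "\<dots> = Q * N * (R + norm x) powr a * (((1 + q) * t powr b + q * b * (t powr b / t)) * exp (L * t))"
    by (simp add: k_def algebra_simps)
  also have "t powr b / t = t powr (b - 1)" using tp by (simp add: powr_diff)
  finally show ?thesis .
qed

lemma powr_exp_derivative:
  assumes "0 < t"
  shows "((\<lambda>t. k * tp L t) has_real_derivative k * ((b * t powr (b - 1) + L * t powr b) * exp (L * t))) (at t)"
proof -
  have "((\<lambda>t. t powr b * exp (L * t)) has_real_derivative (b * t powr (b - 1)) * exp (L * t) + (exp (L * t) * L) * t powr b) (at t)"
    by (intro DERIV_mult has_real_derivative_powr assms) (auto intro!: derivative_eq_intros)
  from DERIV_cmult[OF this, of k] show ?thesis by (simp add: algebra_simps)
qed

text \<open>The bound in \<open>src_diff_le\<close> is compared with the derivative of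
  \<open>tp L\<close>. The term in \<open>v powr (b - 1)\<close> is a fraction \<open>q\<close> of
  its counterpart and the term in \<open>v powr b\<close> only a fraction
  \<open>(1 + q) / L\<close>, which \<open>L\<close> makes small.\<close>

lemma ex_contracts: "\<exists>R L \<theta>. contracts R L \<theta>"
proof -
  \<comment> \<open>The convolution loss \<open>Q > 1\<close> is chosen with
    \<open>Q * q = (1 + q) / 2\<close>, halfway between \<open>q\<close> and 1.\<close>
  define Q where "Q = (1 + q) / (2 * q)"
  have Q1: "1 < Q" using q by (simp add: Q_def)
  have Qq: "Q * q = (1 + q) / 2" using q by (simp add: Q_def)
  obtain R where R: "1 \<le> R" "\<And>x. cv (\<lambda>y. (R + norm y) powr a) x \<le> Q * (R + norm x) powr a"
    using cv_weight_almost_contractive[OF a_nonneg Q1] by metis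
  \<comment> \<open>This makes \<open>Q * (1 + q) / L = (1 - q) / 4\<close>, so that \<theta>
    becomes \<open>(3 + q) / 4\<close>, still below 1.\<close>
  define L where "L = 4 * Q * (1 + q) / (1 - q)"
  have L: "0 < L" using Q1 q by (simp add: L_def)
  define \<theta> where "\<theta> = Q * (q + (1 + q) / L)"
  have "Q * (1 + q) \<noteq> 0" using Q1 q by simp
  moreover have "L = Q * (1 + q) * (4 / (1 - q))" by (simp add: L_def mult_ac)
  ultimately have "Q * (1 + q) / L = (1 - q) / 4" by simp
  moreover have "\<theta> = Q * q + Q * (1 + q) / L" by (simp add: \<theta>_def distrib_left)
  ultimately have "\<theta> = (1 + q) / 2 + (1 - q) / 4" by (simp only: Qq)
  then have \<theta>: "\<theta> = (3 + q) / 4" by (simp add: field_simps)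
  have main: "\<bar>duhamel \<mu> x t - duhamel \<nu> x t\<bar> \<le> \<theta> * N * tp L t * (R + norm x) powr a"
    if \<mu>: "adm \<mu>" and \<nu>: "adm \<nu>" and N: "0 \<le> N"
      and w: "\<forall>x t. 0 \<le> t \<longrightarrow> t \<le> T \<longrightarrow> w x t \<le> \<mu> x t \<and> w x t \<le> \<nu> x t"
      and d: "\<forall>x t. 0 \<le> t \<longrightarrow> t \<le> T \<longrightarrow> \<bar>\<mu> x t - \<nu> x t\<bar> \<le> N * tp L t * (R + norm x) powr a"
      and t: "0 \<le> t" "t \<le> T" for T N \<mu> \<nu> x t
  proof -
    define W where "W = N * (R + norm x) powr a"
    have W: "0 \<le> W" using N by (simp add: W_def)
    define k where "k = \<theta> * W"
    let ?F' = "\<lambda>v. k * ((b * v powr (b - 1) + L * v powr b) * exp (L * v))"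
    have le: "\<bar>src \<mu> x v - src \<nu> x v\<bar> \<le> ?F' v" if v: "0 \<le> v" "v \<le> t" for v
    proof -
      have "\<bar>src \<mu> x v - src \<nu> x v\<bar> \<le> Q * N * (R + norm x) powr a * (((1 + q) * v powr b + q * b * v powr (b - 1)) * exp (L * v))"
        using w d v t by (intro src_diff_le \<mu> \<nu> N R) auto
      also have "\<dots> \<le> Q * N * (R + norm x) powr a * ((q + (1 + q) / L) * ((b * v powr (b - 1) + L * v powr b) * exp (L * v)))"
      proof (intro mult_left_mono)
        \<comment> \<open>Expanding the product leaves the desired expression plus two nonnegative
          cross terms.\<close>
        have e: "(q + (1 + q) / L) * (b * v powr (b - 1) + L * v powr b)
            = ((1 + q) * v powr b + q * b * v powr (b - 1)) + (q * L * v powr b + (1 + q) / L * b * v powr (b - 1))"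
          using L by (simp add: field_simps)
        have "0 \<le> q * L * v powr b + (1 + q) / L * b * v powr (b - 1)"
          using q L b by (intro add_nonneg_nonneg mult_nonneg_nonneg) auto
        then have "(1 + q) * v powr b + q * b * v powr (b - 1) \<le> (q + (1 + q) / L) * (b * v powr (b - 1) + L * v powr b)"
          using e by linarith
        then have "((1 + q) * v powr b + q * b * v powr (b - 1)) * exp (L * v)
            \<le> (q + (1 + q) / L) * (b * v powr (b - 1) + L * v powr b) * exp (L * v)"
          by (rule mult_right_mono) simp
        then show "((1 + q) * v powr b + q * b * v powr (b - 1)) * exp (L * v)
            \<le> (q + (1 + q) / L) * ((b * v powr (b - 1) + L * v powr b) * exp (L * v))"
          by (simp only: mult.assoc)
      qed (use Q1 N in auto)
      also have "\<dots> = ?F' v" by (simp add: k_def W_def \<theta>_def mult_ac)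
      finally show ?thesis .
    qed
    have cont: "continuous_on {0..t} (\<lambda>v. src \<mu> x v)" "continuous_on {0..t} (\<lambda>v. src \<nu> x v)"
      using \<mu> \<nu> by (auto intro: src_continuous)
    have cF: "continuous_on {0..t} (\<lambda>v. k * tp L v)"
      using b by (intro continuous_intros continuous_on_powr') auto
    have cF': "continuous_on {0..t} ?F'"
      using b by (intro continuous_intros continuous_on_powr') auto
    have D: "((\<lambda>v. k * tp L v) has_real_derivative ?F' v) (at v)" if "0 < v" "v < t" for v
      by (rule powr_exp_derivative[OF that(1)])
    have eq: "duhamel \<mu> x t - duhamel \<nu> x t = (LINT v:{0..t}|lborel. src \<mu> x v - src \<nu> x v)"
      "duhamel \<nu> x t - duhamel \<mu> x t = (LINT v:{0..t}|lborel. src \<nu> x v - src \<mu> x v)"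
      unfolding duhamel_def using cont by (auto intro!: set_integral_diff(2)[symmetric] borel_integrable_atLeastAtMost')
    have "duhamel \<mu> x t - duhamel \<nu> x t \<le> k * tp L t - k * tp L 0"
      unfolding eq(1) using le by (intro set_integral_le_FTC[OF t(1) cF _ cF' D] continuous_intros cont) (auto simp: abs_le_iff)
    moreover have "duhamel \<nu> x t - duhamel \<mu> x t \<le> k * tp L t - k * tp L 0"
      unfolding eq(2) using le by (intro set_integral_le_FTC[OF t(1) cF _ cF' D] continuous_intros cont) (auto simp: abs_le_iff)
    ultimately show ?thesis by (simp add: abs_le_iff k_def W_def mult_ac)
  qed
  have "0 \<le> \<theta>" "\<theta> < 1" using \<theta> q by auto
  then have "contracts R L \<theta>"
    unfolding contracts_def using R(1) L by (intro conjI allI impI) (simp_all add: main)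
  then show ?thesis by blast
qed

lemma src_le:
  obtains C D where "0 < C" "0 < D"
    "\<And>\<mu> t M x. adm \<mu> \<Longrightarrow> 0 \<le> t \<Longrightarrow> 0 \<le> M \<Longrightarrow> (\<And>y. \<mu> y t \<le> M * wt a y) \<Longrightarrow>
       src \<mu> x t \<le> (C * M + exp t * D * M powr p) * wt a x"
proof -
  obtain C where C: "0 < C" "\<And>x. cv (\<lambda>y. wt a y) x \<le> C * wt a x"
    using cv_weight_le[OF a_nonneg] by metis
  have "src \<mu> x t \<le> (C * M + exp t * (vu * C) * M powr p) * wt a x"
    if \<mu>: "adm \<mu>" and t: "0 \<le> t" and M: "0 \<le> M" "\<And>y. \<mu> y t \<le> M * wt a y" for \<mu> t M x
  proof -
    have cvk: "cv (\<lambda>y. k * wt a y) x \<le> k * (C * wt a x)" if "0 \<le> k" for k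
      unfolding cv_cmult using C that by (intro mult_left_mono) auto
    have gk: "grows a (\<lambda>y::real^'n. k * wt a y)" for k
      by (rule grows_cmult[OF grows_weight[OF a_nonneg]]) simp
    have "cv (\<lambda>y. \<mu> y t) x \<le> cv (\<lambda>y. M * wt a y) x"
      by (rule cv_mono[OF grows_adm(1)[OF \<mu> t] gk M(2)])
    also have "\<dots> \<le> M * (C * wt a x)" by (rule cvk[OF M(1)])
    finally have 1: "cv (\<lambda>y. \<mu> y t) x \<le> C * M * wt a x" by (simp add: mult_ac)
    have "cv (nl \<mu> t) x \<le> cv (\<lambda>y. (vu * M powr p) * wt a y) x"
      by (rule cv_mono[OF grows_adm(2)[OF \<mu> t] gk]) (rule V_powr_le[OF adm_nonneg[OF \<mu> t] M(2,1)])
    also have "\<dots> \<le> (vu * M powr p) * (C * wt a x)" using vu by (intro cvk) auto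
    finally have 2: "cv (nl \<mu> t) x \<le> (vu * M powr p) * (C * wt a x)" .
    have "E t \<le> exp t" using p t by (simp add: algebra_simps)
    then have "E t * cv (nl \<mu> t) x \<le> exp t * ((vu * M powr p) * (C * wt a x))"
      using Vnn by (intro mult_mono 2 cv_nonneg) auto
    with 1 show ?thesis unfolding src_def by (simp add: algebra_simps)
  qed
  then show thesis using C vu by (intro that[of C "vu * C"]) auto
qed

section \<open>Small-time behaviour and uniqueness\<close>

text \<open>If \<open>m\<close> is the weighted supremum up to \<open>t0\<close>, the equation gives
  \<open>m \<le> t0 * (C * m + D' * m powr p)\<close>. For small \<open>t0\<close> the linear term
  is absorbed on the left, and \<open>m powr (1 - p) \<le> 2 * D' * t0\<close> is raised to the
  power \<open>b\<close>.\<close>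

lemma sol_small_time:
  assumes \<mu>: "sol \<mu>"
  obtains M where "0 \<le> M" "\<And>x t. 0 \<le> t \<Longrightarrow> t \<le> T \<Longrightarrow> \<mu> x t \<le> M * t powr b * wt a x"
proof -
  have ad: "adm \<mu>" and eq: "\<And>x t. 0 \<le> t \<Longrightarrow> \<mu> x t = duhamel \<mu> x t" using \<mu> by (auto simp: sol_def)
  obtain C D where CD: "0 < C" "0 < D" and src: "\<And>t M x. 0 \<le> t \<Longrightarrow> 0 \<le> M \<Longrightarrow> (\<And>y. \<mu> y t \<le> M * wt a y) \<Longrightarrow>
       src \<mu> x t \<le> (C * M + exp t * D * M powr p) * wt a x"
    using src_le[of thesis] ad by metis
  obtain M0 where M0: "0 < M0" "\<And>x t. 0 \<le> t \<Longrightarrow> t \<le> T \<Longrightarrow> \<bar>\<mu> x t\<bar> \<le> M0 * wt a x"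
    using tame_bound[OF adm_tame[OF ad]] by metis
  define D' where "D' = exp \<bar>T\<bar> * D"
  have D': "0 < D'" using CD by (simp add: D'_def)
  \<comment> \<open>Up to this time the linear term is at most half of the left-hand side.\<close>
  define t1 where "t1 = 1 / (2 * C)"
  have t1: "0 < t1" "C * t1 = 1 / 2" using CD by (simp_all add: t1_def)
  have small: "\<mu> x t0 \<le> (2 * D') powr b * t0 powr b * wt a x" if t0: "0 \<le> t0" "t0 \<le> T" "t0 \<le> t1" for x t0
  proof -
    define S where "S = (\<lambda>(x, t). \<mu> x t / wt a x) ` (UNIV \<times> {0..t0})"
    have ne: "S \<noteq> {}" using t0 by (auto simp: S_def)
    have bdd: "bdd_above S"
    proof (rule bdd_aboveI[where M=M0])
      fix s assume "s \<in> S"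
      then obtain x t where s: "s = \<mu> x t / wt a x" "0 \<le> t" "t \<le> t0" by (auto simp: S_def)
      then show "s \<le> M0" using M0(2)[of t x] t0 by (simp add: divide_le_eq abs_le_iff)
    qed
    define m where "m = Sup S"
    have le_m: "\<mu> y t \<le> m * wt a y" if "0 \<le> t" "t \<le> t0" for y t
    proof -
      have "\<mu> y t / wt a y \<le> m"
        unfolding m_def by (rule cSup_upper[OF _ bdd]) (use that in \<open>auto simp: S_def\<close>)
      then show ?thesis by (simp add: divide_le_eq)
    qed
    have m0: "0 \<le> m" using le_m[of 0 0] t0 adm_nonneg[OF ad, of 0 0] by (simp del: mult_cancel_right)
    have "s \<le> t0 * (C * m + D' * m powr p)" if sS: "s \<in> S" for s
    proof -
      obtain x t where s: "s = \<mu> x t / wt a x" "0 \<le> t" "t \<le> t0" using sS by (auto simp: S_def)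
      define k where "k = (C * m + D' * m powr p) * wt a x"
      have k: "0 \<le> k" using CD D' m0 by (simp add: k_def)
      have "\<mu> x t = duhamel \<mu> x t" by (rule eq[OF s(2)])
      also have "\<dots> \<le> k * t - k * 0"
        unfolding duhamel_def
      proof (rule set_integral_le_FTC[where F'="\<lambda>_. k", OF s(2)])
        show "continuous_on {0..t} (\<lambda>v. src \<mu> x v)" by (rule src_continuous[OF ad]) auto
        fix v assume v: "0 \<le> v" "v \<le> t"
        have "src \<mu> x v \<le> (C * m + exp v * D * m powr p) * wt a x"
          using v s m0 by (intro src le_m) auto
        also have "\<dots> \<le> k"
          unfolding k_def D'_def using v s t0 CD by (intro mult_right_mono add_left_mono) auto
        finally show "src \<mu> x v \<le> k" .
      qed (auto intro!: continuous_intros derivative_eq_intros)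
      also have "\<dots> \<le> k * t0" using s k by (simp add: mult_left_mono)
      finally show ?thesis using s(1) by (simp add: divide_le_eq k_def mult_ac)
    qed
    then have "m \<le> t0 * (C * m + D' * m powr p)"
      unfolding m_def by (intro cSup_least ne)
    also have "\<dots> = (C * t0) * m + t0 * D' * m powr p" by (simp add: algebra_simps)
    also have "\<dots> \<le> (1 / 2) * m + t0 * D' * m powr p"
      using mult_left_mono[OF t0(3), of C] t1 CD m0 by (intro add_right_mono mult_right_mono) auto
    finally have m2: "m \<le> 2 * D' * t0 * m powr p" by (simp add: mult_ac)
    have "m \<le> (2 * D') powr b * t0 powr b"
    proof (cases "m = 0")
      case False
      with m0 have mp: "0 < m" by simp
      have "m powr (1 - p) \<le> 2 * D' * t0"
        using m2 mp by (simp add: powr_diff divide_le_eq)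
      then have "(m powr (1 - p)) powr b \<le> (2 * D' * t0) powr b" using b by (intro powr_mono2) auto
      then show ?thesis using mp D' t0 b(2) by (simp add: powr_powr powr_mult)
    qed simp
    then have "m * wt a x \<le> (2 * D') powr b * t0 powr b * wt a x"
      by (rule mult_right_mono) simp
    with le_m[OF t0(1) order_refl, of x] show ?thesis by linarith
  qed
  \<comment> \<open>After \<open>t1\<close> the plain bound \<open>M0\<close> suffices, since
    \<open>t powr b\<close> is then at least \<open>t1 powr b\<close>.\<close>
  define M where "M = (2 * D') powr b + M0 / t1 powr b"
  have "0 \<le> M" using M0 by (simp add: M_def)
  moreover have "\<mu> x t \<le> M * t powr b * wt a x" if t: "0 \<le> t" "t \<le> T" for x t
  proof (cases "t \<le> t1")
    case True
    have "(2 * D') powr b * t powr b * wt a x \<le> M * t powr b * wt a x"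
      using M0 by (intro mult_right_mono) (auto simp: M_def)
    with small[OF t True, of x] show ?thesis by linarith
  next
    case False
    have "t1 powr b \<le> t powr b" using False t1 b by (intro powr_mono2) auto
    then have "M0 * t1 powr b \<le> M0 * t powr b" using M0 by (intro mult_left_mono) auto
    then have "M0 \<le> M0 / t1 powr b * t powr b" using t1 by (simp add: field_simps)
    also have "\<dots> \<le> M * t powr b" by (intro mult_right_mono) (auto simp: M_def)
    finally have "M0 * wt a x \<le> M * t powr b * wt a x" by (rule mult_right_mono) simp
    with M0(2)[OF t, of x] show ?thesis by linarith
  qed
  ultimately show thesis by (rule that)
qed

text \<open>\<open>sol_small_time\<close> makes the weighted norm of the difference finite. As both
  functions are fixed points of \<open>duhamel\<close>, the difference then carries the factor
  \<open>\<theta> ^ k\<close> for every \<open>k\<close>.\<close>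

theorem sol_unique:
  assumes \<mu>: "sol \<mu>" and \<nu>: "sol \<nu>" and w: "\<And>x t. 0 \<le> t \<Longrightarrow> w x t \<le> \<mu> x t" "\<And>x t. 0 \<le> t \<Longrightarrow> w x t \<le> \<nu> x t"
    and t: "0 \<le> t"
  shows "\<mu> x t = \<nu> x t"
proof -
  obtain R L \<theta> where c: "contracts R L \<theta>" using ex_contracts by blast
  then have R: "1 \<le> R" and L: "0 \<le> L" and \<theta>: "0 \<le> \<theta>" "\<theta> < 1" by (auto simp: contracts_def)
  obtain M where M: "0 \<le> M" "\<And>x s. 0 \<le> s \<Longrightarrow> s \<le> t \<Longrightarrow> \<mu> x s \<le> M * s powr b * wt a x"
    using sol_small_time[OF \<mu>] by metis
  obtain N where N: "0 \<le> N" "\<And>x s. 0 \<le> s \<Longrightarrow> s \<le> t \<Longrightarrow> \<nu> x s \<le> N * s powr b * wt a x"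
    using sol_small_time[OF \<nu>] by metis
  have ad: "adm \<mu>" "adm \<nu>" using \<mu> \<nu> by (auto simp: sol_def)
  have iter: "0 \<le> s \<Longrightarrow> s \<le> t \<Longrightarrow> \<bar>\<mu> y s - \<nu> y s\<bar> \<le> (\<theta> ^ k * (M + N)) * tp L s * (R + norm y) powr a" for k y s
  proof (induction k arbitrary: y s)
    case 0
    have "\<bar>\<mu> y s - \<nu> y s\<bar> \<le> \<mu> y s + \<nu> y s"
      using adm_nonneg[OF ad(1) 0(1), of y] adm_nonneg[OF ad(2) 0(1), of y] by simp
    also have "\<dots> \<le> (M + N) * (s powr b * 1) * wt a y"
      using M(2)[OF 0, of y] N(2)[OF 0, of y] by (simp add: algebra_simps)
    also have "\<dots> \<le> (M + N) * tp L s * (R + norm y) powr a"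
      using M N L R 0 a_nonneg by (intro mult_mono mult_left_mono powr_mono2) auto
    finally show ?case by simp
  next
    case (Suc k)
    have "\<bar>duhamel \<mu> y s - duhamel \<nu> y s\<bar> \<le> \<theta> * (\<theta> ^ k * (M + N)) * tp L s * (R + norm y) powr a"
      using M N \<theta> by (intro contractsD[OF c ad, where T=t] w Suc) auto
    then show ?case using \<mu> \<nu> Suc.prems by (simp add: sol_def mult.assoc)
  qed
  have "(\<lambda>k. (\<theta> ^ k * (M + N)) * tp L t * (R + norm x) powr a) \<longlonglongrightarrow> (0 * (M + N)) * tp L t * (R + norm x) powr a"
    using \<theta> by (intro tendsto_intros LIMSEQ_power_zero) auto
  then have "\<bar>\<mu> x t - \<nu> x t\<bar> \<le> 0"
    by (intro LIMSEQ_le_const[where x=0 and X="\<lambda>k. (\<theta> ^ k * (M + N)) * tp L t * (R + norm x) powr a"])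
       (use iter[OF t order_refl] in auto)
  then show ?thesis by simp
qed

end

section \<open>Existence\<close>

context semilinear
begin

section \<open>The subsolution \<open>w\<close>\<close>

lemma continuous_w: "continuous_on (UNIV \<times> {0..}) (\<lambda>(x, t). w x t)"
proof -
  have F: "continuous_on (UNIV \<times> {0..}) (\<lambda>z::(real^'n) \<times> real. F 0 (snd z) powr b)"
    using b F_nonneg[of 0] by (intro continuous_on_powr') (auto simp: F_def[abs_def] intro!: continuous_intros)
  have r: "continuous_on (UNIV \<times> {0..}) (\<lambda>z::(real^'n) \<times> real. rpow (norm (fst z)) (\<sigma> * b))"
    using \<sigma>_b_nonneg by (intro continuous_on_rpow) (auto intro!: continuous_intros)
  show ?thesis
    unfolding w_def case_prod_beta by (intro continuous_on_mult continuous_on_const F r)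
qed

lemma F0_le:
  assumes "0 \<le> t"
  shows "F 0 t powr b \<le> exp t * t powr b"
proof -
  let ?z = "(1 - p) * t"
  have z: "0 \<le> ?z" "?z \<le> t" using p assms by (auto simp: mult_left_le_one_le)
  have "1 - ?z \<le> exp (- ?z)" using exp_ge_add_one_self[of "- ?z"] by simp
  then have "exp ?z * (1 - ?z) \<le> exp ?z * exp (- ?z)" by (rule mult_left_mono) simp
  also have "\<dots> = 1" by (simp add: mult_exp_exp)
  finally have "F 0 t \<le> exp ?z * ?z" by (simp add: F_def right_diff_distrib)
  also have "\<dots> \<le> exp ?z * t" using z by (intro mult_left_mono) auto
  finally have "F 0 t powr b \<le> (exp ?z * t) powr b"
    using F_nonneg[OF assms] b by (intro powr_mono2) auto
  also have "\<dots> = exp (?z * b) * t powr b" using assms by (simp add: powr_mult exp_powr_real)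
  also have "?z * b = t" using b(2) by (simp add: mult_ac)
  finally show ?thesis .
qed

lemma w_le:
  assumes "0 \<le> t" "t \<le> T"
  shows "w x t \<le> (A powr b * exp T) * t powr b * wt a x"
proof -
  have 1: "F 0 t powr b \<le> exp T * t powr b"
    using assms by (intro order_trans[OF F0_le] mult_right_mono) auto
  have 2: "rpow (norm x) (\<sigma> * b) \<le> wt a x"
    by (rule rpow_norm_le_wt[OF \<sigma>_b_nonneg \<sigma>_b_le])
  have "w x t \<le> A powr b * (exp T * t powr b) * wt a x"
    unfolding w_def using 1 2 by (intro mult_mono mult_left_mono) auto
  then show ?thesis by (simp add: mult_ac)
qed

lemma adm_w: "adm w"
  unfolding adm_def tame_def
proof (intro conjI allI impI)
  fix T
  have "\<bar>w x t\<bar> \<le> (A powr b * exp T * T powr b) * wt a x" if t: "t \<in> {0..T}" for x t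
  proof -
    have "t powr b \<le> T powr b" using t b by (intro powr_mono2) auto
    then have "(A powr b * exp T) * t powr b * wt a x \<le> (A powr b * exp T) * T powr b * wt a x"
      by (intro mult_right_mono mult_left_mono) auto
    then show ?thesis using w_le[of t T x] t w_nonneg[of x t] by (simp add: mult.assoc)
  qed
  then show "\<exists>M. \<forall>x. \<forall>t\<in>{0..T}. \<bar>w x t\<bar> \<le> M * wt a x" by blast
qed (use continuous_w w_nonneg in auto)

text \<open>The constants in \<open>w\<close> are fixed points of the improvement step:
  \<open>A powr b\<close> of \<open>C -> A * C powr p\<close>, and \<open>\<sigma> * b\<close> of
  \<open>d -> \<sigma> + d * p\<close>.\<close>

lemma w_le_duhamel:
  assumes t: "0 \<le> t"
  shows "w x t \<le> duhamel w x t"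
proof -
  have "A * (A powr b) powr p * F 0 t powr b * rpow (norm x) (\<sigma> * b) \<le> duhamel w x t"
  proof (rule duhamel_lower[OF adm_w order_refl t, where \<phi>="\<lambda>y. rpow (norm y) (\<sigma> * b)" and \<psi>="\<lambda>y. rpow (norm y) (\<sigma> * b)"])
    show "(\<lambda>y::real^'n. rpow (norm y) (\<sigma> * b)) \<in> borel_measurable borel"
      by (rule borel_measurable_rpow_norm[OF \<sigma>_b_nonneg])
    show "rpow (norm y) (\<sigma> * b) \<le> wt a y" for y :: "real^'n"
      by (rule rpow_norm_le_wt[OF \<sigma>_b_nonneg \<sigma>_b_le])
    have "\<sigma> + \<sigma> * b * p = \<sigma> * (1 + b * p)" by (simp add: algebra_simps)
    then have "\<sigma> + \<sigma> * b * p = \<sigma> * b" unfolding b(4) by simp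
    then show "A * rpow (norm x) (\<sigma> * b) \<le> cv (\<lambda>y. V y * rpow (norm y) (\<sigma> * b) powr p) x"
      using cv_V_rpow_ge[OF \<sigma>_b_nonneg order_refl, of x] by simp
  qed (auto simp: w_def)
  moreover have "A * (A powr b) powr p = A powr b"
  proof -
    have "A * (A powr b) powr p = A powr 1 * A powr (b * p)" using A_pos by (simp add: powr_powr)
    also have "\<dots> = A powr (1 + b * p)" by (rule powr_add[symmetric])
    also have "\<dots> = A powr b" unfolding b(4) by simp
    finally show ?thesis .
  qed
  ultimately show ?thesis by (simp add: w_def)
qed

text \<open>This makes the first step of the iteration finite in the weighted norm: inserting a
  function of order \<open>t powr b\<close> gives a source of order
  \<open>t powr (b - 1)\<close>.\<close>

lemma duhamel_w_le:
  obtains M where "0 \<le> M" "\<And>x t. 0 \<le> t \<Longrightarrow> t \<le> T \<Longrightarrow> duhamel w x t \<le> M * t powr b * wt a x"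
proof -
  obtain C D where CD: "0 < C" "0 < D" and src: "\<And>\<mu> t M x. adm \<mu> \<Longrightarrow> 0 \<le> t \<Longrightarrow> 0 \<le> M \<Longrightarrow> (\<And>y. \<mu> y t \<le> M * wt a y) \<Longrightarrow>
       src \<mu> x t \<le> (C * M + exp t * D * M powr p) * wt a x"
    using src_le by metis
  define k where "k = A powr b * exp T"
  \<comment> \<open>The first summand comes from the linear term through
    \<open>v powr b \<le> \<bar>T\<bar> * v powr (b - 1)\<close>, the second from the nonlinear
    one.\<close>
  define M where "M = C * k * \<bar>T\<bar> + exp T * D * k powr p"
  have k: "0 \<le> k" by (simp add: k_def)
  have M: "0 \<le> M" using CD k by (simp add: M_def)
  have "duhamel w x t \<le> M * t powr b * wt a x" if t: "0 \<le> t" "t \<le> T" for x t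
  proof -
    define W where "W = M * wt a x"
    have W: "0 \<le> W" using M by (simp add: W_def)
    \<comment> \<open>The trivial factor with rate 0 lets \<open>powr_exp_derivative\<close> apply
      with \<open>L = 0\<close>.\<close>
    have "duhamel w x t \<le> W * (t powr b * exp (0 * t)) - W * (0 powr b * exp (0 * 0))"
      unfolding duhamel_def
    proof (rule set_integral_le_FTC[where F'="\<lambda>v. W * ((b * v powr (b - 1) + 0 * v powr b) * exp (0 * v))", OF t(1)])
      show "continuous_on {0..t} (\<lambda>v. src w x v)" by (rule src_continuous[OF adm_w]) auto
      show "continuous_on {0..t} (\<lambda>v. W * (v powr b * exp (0 * v)))"
        using b by (intro continuous_intros continuous_on_powr') auto
      show "continuous_on {0..t} (\<lambda>v. W * ((b * v powr (b - 1) + 0 * v powr b) * exp (0 * v)))"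
        using b by (intro continuous_intros continuous_on_powr') auto
      show "((\<lambda>v. W * (v powr b * exp (0 * v))) has_real_derivative W * ((b * v powr (b - 1) + 0 * v powr b) * exp (0 * v))) (at v)"
        if "0 < v" "v < t" for v by (rule powr_exp_derivative[OF that(1)])
      fix v assume v: "0 \<le> v" "v \<le> t"
      have e: "(k * v powr b) powr p = k powr p * v powr (b - 1)"
        using k b(4) by (simp add: powr_mult powr_powr)
      have "src w x v \<le> (C * (k * v powr b) + exp v * D * (k * v powr b) powr p) * wt a x"
        using k v t w_le[of v T] by (intro src adm_w) (auto simp: k_def)
      also have "\<dots> \<le> (M * v powr (b - 1)) * wt a x"
      proof (rule mult_right_mono)
        have "v powr b = v * v powr (b - 1)" using v by (cases "v = 0") (auto simp: powr_diff)
        also have "\<dots> \<le> \<bar>T\<bar> * v powr (b - 1)" using v t by (intro mult_right_mono) auto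
        finally have "C * (k * v powr b) \<le> C * (k * (\<bar>T\<bar> * v powr (b - 1)))"
          using CD k by (intro mult_left_mono) auto
        moreover have "exp v * D * (k powr p * v powr (b - 1)) \<le> exp T * D * (k powr p * v powr (b - 1))"
          using CD v t by (intro mult_right_mono) auto
        ultimately show "C * (k * v powr b) + exp v * D * (k * v powr b) powr p \<le> M * v powr (b - 1)"
          unfolding e M_def by (simp add: algebra_simps)
      qed simp
      also have "\<dots> \<le> W * (b * v powr (b - 1))"
      proof -
        have "W * (1 * v powr (b - 1)) \<le> W * (b * v powr (b - 1))"
          using W b by (intro mult_left_mono mult_right_mono) auto
        then show ?thesis by (simp add: W_def mult_ac)
      qed
      finally show "src w x v \<le> W * ((b * v powr (b - 1) + 0 * v powr b) * exp (0 * v))" by simp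
    qed
    then show ?thesis by (simp add: W_def mult_ac)
  qed
  with M show thesis by (rule that)
qed

section \<open>Picard iteration from the subsolution\<close>

text \<open>Monotonicity of \<open>duhamel\<close> keeps all iterates above \<open>w\<close>, where
  the contraction estimate is valid. The limit is taken pointwise; its explicit geometric rate is
  uniform on bounded pieces and yields joint continuity and the growth bound.\<close>

theorem ex_sol_ge_w: "\<exists>\<mu>. sol \<mu> \<and> (\<forall>x. \<forall>t\<ge>0. w x t \<le> \<mu> x t)"
proof -
  obtain R L \<theta> where c: "contracts R L \<theta>" using ex_contracts by blast
  then have R: "1 \<le> R" and L: "0 \<le> L" and \<theta>: "0 \<le> \<theta>" "\<theta> < 1" by (auto simp: contracts_def)
  define P where "P = (\<lambda>k. (duhamel ^^ k) w)"
  have P_Suc: "P (Suc k) = duhamel (P k)" for k by (simp add: P_def)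
  have P0: "P 0 = w" by (simp add: P_def)
  have ad: "adm (P k)" for k
    by (induction k) (simp_all add: P0 P_Suc adm_w adm_duhamel)
  have Pw: "0 \<le> t \<Longrightarrow> w x t \<le> P k x t" for k x t
  proof (induction k arbitrary: x t)
    case (Suc k)
    have "w x t \<le> duhamel w x t" by (rule w_le_duhamel[OF Suc.prems])
    also have "\<dots> \<le> duhamel (P k) x t" by (rule duhamel_mono[OF adm_w ad Suc.prems]) (rule Suc.IH)
    finally show ?case by (simp add: P_Suc)
  qed (simp add: P0)
  define G where "G = (\<lambda>x t. t powr b * exp (L * t) * (R + norm (x :: real^'n)) powr a)"
  have G0: "0 \<le> G x t" for x t by (simp add: G_def)
  have "\<exists>N\<ge>0. \<forall>k x t. 0 \<le> t \<longrightarrow> t \<le> T \<longrightarrow> \<bar>P (Suc k) x t - P k x t\<bar> \<le> \<theta> ^ k * N * G x t" for T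
  proof -
    obtain M where M: "0 \<le> M" "\<And>x t. 0 \<le> t \<Longrightarrow> t \<le> T \<Longrightarrow> duhamel w x t \<le> M * t powr b * wt a x"
      using duhamel_w_le by metis
    have "0 \<le> t \<Longrightarrow> t \<le> T \<Longrightarrow> \<bar>P (Suc k) x t - P k x t\<bar> \<le> (\<theta> ^ k * M) * tp L t * (R + norm x) powr a" for k x t
    proof (induction k arbitrary: x t)
      case 0
      have "\<bar>P (Suc 0) x t - P 0 x t\<bar> \<le> duhamel w x t"
        using w_le_duhamel[OF 0(1), of x] w_nonneg[of x t] by (simp add: P_Suc P0)
      also have "\<dots> \<le> M * (t powr b * 1) * wt a x" using M(2)[OF 0, of x] by simp
      also have "\<dots> \<le> M * tp L t * (R + norm x) powr a"
        using M R L 0 a_nonneg by (intro mult_mono mult_left_mono powr_mono2) auto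
      finally show ?case by simp
    next
      case (Suc k)
      have "\<bar>duhamel (P (Suc k)) x t - duhamel (P k) x t\<bar> \<le> \<theta> * (\<theta> ^ k * M) * tp L t * (R + norm x) powr a"
        using M \<theta> by (intro contractsD[OF c ad ad, where T=T] Pw Suc) auto
      then show ?case by (simp add: P_Suc mult.assoc)
    qed
    then show ?thesis using M(1) by (intro exI[of _ M]) (simp add: G_def mult.assoc)
  qed
  then obtain N where N: "\<And>T. 0 \<le> N T" "\<And>T k x t. 0 \<le> t \<Longrightarrow> t \<le> T \<Longrightarrow> \<bar>P (Suc k) x t - P k x t\<bar> \<le> \<theta> ^ k * N T * G x t"
    by metis
  have conv: "convergent (\<lambda>k. P k x t)" if t: "0 \<le> t" for x t
  proof -
    have "summable (\<lambda>k. \<theta> ^ k * (N t * G x t))" using \<theta> by (intro summable_mult2 summable_geometric) auto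
    then have "summable (\<lambda>k. P (Suc k) x t - P k x t)"
      by (rule summable_comparison_test'[where N=0]) (use N(2)[OF t order_refl] in \<open>simp add: mult.assoc\<close>)
    then have "convergent (\<lambda>n. P n x t - P 0 x t)"
      unfolding summable_iff_convergent sum_lessThan_telescope[where f="\<lambda>k. P k x t"] .
    then show ?thesis by (simp add: convergent_diff_const_right_iff)
  qed
  define \<mu> where "\<mu> = (\<lambda>x t. lim (\<lambda>k. P k x t))"
  have lim: "(\<lambda>k. P k x t) \<longlonglongrightarrow> \<mu> x t" if "0 \<le> t" for x t
    using conv[OF that, of x] by (simp add: \<mu>_def convergent_LIMSEQ_iff)
  have w\<mu>: "w x t \<le> \<mu> x t" if "0 \<le> t" for x t
    by (rule LIMSEQ_le_const[OF lim[OF that]]) (use Pw[OF that] in auto)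
  have rate: "\<bar>P k x t - \<mu> x t\<bar> \<le> \<theta> ^ k * (N T / (1 - \<theta>)) * G x t" if t: "0 \<le> t" "t \<le> T" for k x t T
  proof -
    \<comment> \<open>The finite geometric sum of consecutive differences; letting \<open>j\<close>
      grow gives the distance to the limit.\<close>
    have fin: "\<bar>P k x t - P (k + j) x t\<bar> \<le> \<theta> ^ k * (1 - \<theta> ^ j) / (1 - \<theta>) * (N T * G x t)" for j
    proof (induction j)
      case (Suc j)
      have "\<bar>P k x t - P (k + Suc j) x t\<bar> \<le> \<bar>P k x t - P (k + j) x t\<bar> + \<bar>P (Suc (k + j)) x t - P (k + j) x t\<bar>" by simp
      also have "\<dots> \<le> \<theta> ^ k * (1 - \<theta> ^ j) / (1 - \<theta>) * (N T * G x t) + \<theta> ^ (k + j) * (N T * G x t)"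
        using Suc N(2)[OF t, of "k + j" x] by (intro add_mono) (simp_all add: mult.assoc)
      also have "\<dots> = (\<theta> ^ k * (1 - \<theta> ^ j) / (1 - \<theta>) + \<theta> ^ (k + j)) * (N T * G x t)" by (simp add: distrib_right)
      also have "\<theta> ^ k * (1 - \<theta> ^ j) / (1 - \<theta>) + \<theta> ^ (k + j) = \<theta> ^ k * (1 - \<theta> ^ Suc j) / (1 - \<theta>)"
        using \<theta> by (simp add: field_simps power_add)
      finally show ?case .
    qed simp
    have "\<bar>P k x t - P (k + j) x t\<bar> \<le> \<theta> ^ k * (N T / (1 - \<theta>)) * G x t" for j
    proof -
      have "\<theta> ^ k * (1 - \<theta> ^ j) / (1 - \<theta>) \<le> \<theta> ^ k / (1 - \<theta>)"
        using \<theta> by (intro divide_right_mono mult_left_le) auto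
      then have "\<theta> ^ k * (1 - \<theta> ^ j) / (1 - \<theta>) * (N T * G x t) \<le> \<theta> ^ k / (1 - \<theta>) * (N T * G x t)"
        using N(1) G0 by (intro mult_right_mono) auto
      with fin[of j] show ?thesis by simp
    qed
    moreover have "(\<lambda>j. \<bar>P k x t - P (k + j) x t\<bar>) \<longlonglongrightarrow> \<bar>P k x t - \<mu> x t\<bar>"
      using LIMSEQ_ignore_initial_segment[OF lim[OF t(1), of x], of k]
      by (intro tendsto_intros) (simp add: add.commute)
    ultimately show ?thesis by (intro LIMSEQ_le_const2) auto
  qed
  have G_le: "G x t \<le> (T powr b * exp (L * T) * R powr a) * wt a x" if t: "0 \<le> t" "t \<le> T" for x t T
  proof -
    have "(R + norm x) powr a \<le> R powr a * wt a x" by (rule weight_le_wt[OF a_nonneg R])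
    moreover have "t powr b \<le> T powr b" using t b by (intro powr_mono2) auto
    moreover have "exp (L * t) \<le> exp (L * T)" using t L by (simp add: mult_left_mono)
    ultimately have "G x t \<le> tp L T * (R powr a * wt a x)"
      unfolding G_def by (intro mult_mono) auto
    then show ?thesis by (simp add: mult.assoc)
  qed
  have tame: "tame a \<mu>"
    unfolding tame_def
  proof (intro conjI allI)
    show "continuous_on (UNIV \<times> {0..}) (\<lambda>(x, t). \<mu> x t)"
    proof (rule continuous_on_half_spaceI)
      fix r :: real assume r: "0 \<le> r"
      define C where "C = N r / (1 - \<theta>) * ((r powr b * exp (L * r) * R powr a) * (1 + r) powr a)"
      show "continuous_on (cball 0 r \<times> {0..r}) (\<lambda>(x, t). \<mu> x t)"
      proof (rule uniform_limit_theorem[where f="\<lambda>k (x, t). P k x t" and F=sequentially])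
        show "\<forall>\<^sub>F k in sequentially. continuous_on (cball 0 r \<times> {0..r}) (\<lambda>(x, t). P k x t)"
        proof (intro always_eventually allI)
          fix k
          have "continuous_on (UNIV \<times> {0..}) (\<lambda>(x, t). P k x t)"
            using adm_tame[OF ad[of k]] by (simp add: tame_def)
          then show "continuous_on (cball 0 r \<times> {0..r}) (\<lambda>(x, t). P k x t)"
            by (rule continuous_on_subset) auto
        qed
        show "uniform_limit (cball 0 r \<times> {0..r}) (\<lambda>k (x, t). P k x t) (\<lambda>(x, t). \<mu> x t) sequentially"
        proof (rule uniform_limitI)
          fix e :: real assume e: "0 < e"
          have "(\<lambda>k. \<theta> ^ k * C) \<longlonglongrightarrow> 0 * C" using \<theta> by (intro tendsto_intros LIMSEQ_power_zero) auto
          then have "\<forall>\<^sub>F k in sequentially. \<theta> ^ k * C < e" using e by (intro order_tendstoD) auto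
          then show "\<forall>\<^sub>F k in sequentially. \<forall>z\<in>cball 0 r \<times> {0..r}. dist (case z of (x, t) \<Rightarrow> P k x t) (case z of (x, t) \<Rightarrow> \<mu> x t) < e"
          proof eventually_elim
            case (elim k)
            have "\<bar>P k x t - \<mu> x t\<bar> < e" if x: "norm x \<le> r" and t: "0 \<le> t" "t \<le> r" for x t
            proof -
              have "\<bar>P k x t - \<mu> x t\<bar> \<le> \<theta> ^ k * (N r / (1 - \<theta>)) * G x t" by (rule rate[OF t])
              also have "\<dots> \<le> \<theta> ^ k * (N r / (1 - \<theta>)) * ((r powr b * exp (L * r) * R powr a) * wt a x)"
                using N(1) \<theta> by (intro mult_left_mono G_le t) auto
              also have "\<dots> \<le> \<theta> ^ k * (N r / (1 - \<theta>)) * ((r powr b * exp (L * r) * R powr a) * (1 + r) powr a)"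
                using N(1) \<theta> x a_nonneg by (intro mult_left_mono powr_mono2) auto
              also have "\<dots> = \<theta> ^ k * C" by (simp add: C_def)
              finally show ?thesis using elim by simp
            qed
            then show ?case by (auto simp: dist_real_def)
          qed
        qed
      qed simp
    qed
    fix T
    obtain M where M: "\<And>x t. 0 \<le> t \<Longrightarrow> t \<le> T \<Longrightarrow> \<bar>P 0 x t\<bar> \<le> M * wt a x"
      using tame_bound[OF adm_tame[OF ad]] by metis
    have "\<bar>\<mu> x t\<bar> \<le> (M + N T / (1 - \<theta>) * (T powr b * exp (L * T) * R powr a)) * wt a x" if t: "t \<in> {0..T}" for x t
    proof -
      have t': "0 \<le> t" "t \<le> T" using t by auto
      have "N T / (1 - \<theta>) * G x t \<le> N T / (1 - \<theta>) * ((T powr b * exp (L * T) * R powr a) * wt a x)"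
        using N(1) \<theta> by (intro mult_left_mono G_le t') auto
      then show ?thesis using M[OF t', of x] rate[OF t', of 0 x] by (simp add: algebra_simps)
    qed
    then show "\<exists>M. \<forall>x. \<forall>t\<in>{0..T}. \<bar>\<mu> x t\<bar> \<le> M * wt a x" by blast
  qed
  have ad\<mu>: "adm \<mu>"
    using tame w\<mu> w_nonneg order_trans unfolding adm_def by blast
  have "\<mu> x t = duhamel \<mu> x t" if t: "0 \<le> t" for x t
  proof -
    \<comment> \<open>The passage to the limit inside \<open>duhamel\<close> uses the contraction
      estimate between \<open>P k\<close> and the limit.\<close>
    have "(\<lambda>k. P (Suc k) x t - duhamel \<mu> x t) \<longlonglongrightarrow> 0"
    proof (rule tendsto_rabs_zero_cancel, rule tendsto_sandwich[OF _ _ tendsto_const])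
      show "\<forall>\<^sub>F k in sequentially. \<bar>P (Suc k) x t - duhamel \<mu> x t\<bar> \<le> \<theta> * (\<theta> ^ k * (N t / (1 - \<theta>))) * tp L t * (R + norm x) powr a"
      proof (intro always_eventually allI)
        fix k
        show "\<bar>P (Suc k) x t - duhamel \<mu> x t\<bar> \<le> \<theta> * (\<theta> ^ k * (N t / (1 - \<theta>))) * tp L t * (R + norm x) powr a"
          unfolding P_Suc
        proof (rule contractsD[OF c ad ad\<mu>, where T=t])
          show "\<bar>P k x s - \<mu> x s\<bar> \<le> \<theta> ^ k * (N t / (1 - \<theta>)) * tp L s * (R + norm x) powr a" if "0 \<le> s" "s \<le> t" for x s
            using rate[OF that, of k x] by (simp add: G_def mult.assoc)
        qed (use \<theta> N(1) Pw w\<mu> t in auto)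
      qed
      have "(\<lambda>k. \<theta> * (\<theta> ^ k * (N t / (1 - \<theta>))) * tp L t * (R + norm x) powr a) \<longlonglongrightarrow> \<theta> * (0 * (N t / (1 - \<theta>))) * tp L t * (R + norm x) powr a"
        using \<theta> by (intro tendsto_intros LIMSEQ_power_zero) auto
      then show "(\<lambda>k. \<theta> * (\<theta> ^ k * (N t / (1 - \<theta>))) * tp L t * (R + norm x) powr a) \<longlonglongrightarrow> 0" by simp
    qed auto
    moreover have "(\<lambda>k. P (Suc k) x t - duhamel \<mu> x t) \<longlonglongrightarrow> \<mu> x t - duhamel \<mu> x t"
      by (intro tendsto_intros LIMSEQ_Suc lim t)
    ultimately show ?thesis using LIMSEQ_unique by fastforce
  qed
  then have "sol \<mu>" using ad\<mu> by (simp add: sol_def)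
  then show ?thesis using w\<mu> by blast
qed

end

section \<open>Time shifts and the classification\<close>

lemma set_integral_translate:
  fixes f :: "real \<Rightarrow> real"
  shows "(LINT v:{k..t}|lborel. f (v - k)) = (LINT v:{0..t - k}|lborel. f v)"
proof -
  have "(LINT v:{k..t}|lborel. f (v - k)) = (LINT v|lborel. indicator {k..t} (k + 1 * v) *\<^sub>R f (k + 1 * v - k))"
    unfolding set_lebesgue_integral_def by (subst lborel_integral_real_affine[of 1 _ k]) simp_all
  also have "\<dots> = (LINT v:{0..t - k}|lborel. f v)"
    unfolding set_lebesgue_integral_def by (intro Bochner_Integration.integral_cong refl) (auto simp: indicator_def)
  finally show ?thesis .
qed

context semilinear
begin

lemma solD:
  assumes "sol \<mu>"
  shows "adm \<mu>" "\<And>x t. 0 \<le> t \<Longrightarrow> 0 \<le> \<mu> x t" "\<And>x t. 0 \<le> t \<Longrightarrow> \<mu> x t = duhamel \<mu> x t"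
  using assms by (auto simp: sol_def adm_def)

lemma duhamel_0: "duhamel \<mu> x 0 = 0"
  unfolding duhamel_def set_lebesgue_integral_def
  by (rule integral_eq_zero_AE) (use AE_lborel_singleton[of "0::real"] in \<open>auto elim!: eventually_mono\<close>)

lemma sol_0: "sol \<mu> \<Longrightarrow> \<mu> x 0 = 0"
  using solD(3)[of \<mu> 0 x] by (simp add: duhamel_0)

text \<open>The definition of an s-solution has two separate time integrals; splitting is legitimate
  because both integrands are continuous in time.\<close>

lemma duhamel_split:
  assumes \<mu>: "adm \<mu>"
  shows "duhamel \<mu> x t = (LINT v:{0..t}|lborel. cv (\<lambda>y. \<mu> y v) x)
    + (LINT v:{0..t}|lborel. E v * cv (nl \<mu> v) x)"
  unfolding duhamel_def src_def
proof (rule set_integral_add(2); rule borel_integrable_atLeastAtMost')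
  show "continuous_on {0..t} (\<lambda>v. cv (\<lambda>y. \<mu> y v) x)"
    by (rule tame_continuous_time[OF tame_cv[OF adm_tame[OF \<mu>] a_nonneg]]) auto
  show "continuous_on {0..t} (\<lambda>v. E v * cv (nl \<mu> v) x)"
    by (rule tame_continuous_time[OF tame_exp_cv[OF \<mu>]]) auto
qed

lemma duhamel_diff:
  assumes \<mu>: "adm \<mu>" and "0 \<le> s" "s \<le> t"
  shows "duhamel \<mu> x t - duhamel \<mu> x s = (LINT v:{s..t}|lborel. src \<mu> x v)"
  unfolding duhamel_def
  using set_integral_combine[OF assms(2,3) src_continuous[OF \<mu>, of "{0..t}" x]] by simp

lemma sol_Zinf:
  assumes \<mu>: "sol \<mu>"
  shows "\<mu> \<in> Zinf a"
proof (rule Zinf_if_lipschitz[OF adm_tame[OF solD(1)[OF \<mu>]] a_nonneg])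
  fix T
  note ad = solD(1)[OF \<mu>]
  obtain M where M: "0 < M" "\<And>x t. 0 \<le> t \<Longrightarrow> t \<le> T \<Longrightarrow> \<bar>src \<mu> x t\<bar> \<le> M * wt a x"
    using tame_bound[OF tame_src[OF ad]] by metis
  have ord: "\<bar>\<mu> x t - \<mu> x s\<bar> \<le> M * (t - s) * wt a x" if st: "0 \<le> s" "s \<le> t" "t \<le> T" for x s t
  proof -
    define k where "k = M * wt a x"
    have c: "continuous_on {s..t} (\<lambda>v. src \<mu> x v)" by (rule src_continuous[OF ad]) (use st in auto)
    have "\<mu> x t - \<mu> x s = (LINT v:{s..t}|lborel. src \<mu> x v)"
      using duhamel_diff[OF ad st(1,2), of x] solD(3)[OF \<mu>] st by simp
    moreover have "(LINT v:{s..t}|lborel. src \<mu> x v) \<le> k * t - k * s"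
    proof (rule set_integral_le_FTC[where F'="\<lambda>_. k", OF st(2) _ c])
      fix v assume "s \<le> v" "v \<le> t"
      then show "src \<mu> x v \<le> k" using M(2)[of v x] st by (auto simp: k_def abs_le_iff)
    qed (auto intro!: continuous_intros derivative_eq_intros)
    moreover have "0 \<le> (LINT v:{s..t}|lborel. src \<mu> x v)"
      by (rule set_integral_ge_0) (use src_nonneg[OF ad] st in auto)
    ultimately show ?thesis by (simp add: k_def algebra_simps)
  qed
  show "\<exists>M. \<forall>x. \<forall>s\<in>{0..T}. \<forall>t\<in>{0..T}. \<bar>\<mu> x s - \<mu> x t\<bar> \<le> M * \<bar>s - t\<bar> * wt a x"
  proof (intro exI[of _ M] allI ballI)
    fix x s t assume s: "s \<in> {0..T}" and t: "t \<in> {0..T}"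
    show "\<bar>\<mu> x s - \<mu> x t\<bar> \<le> M * \<bar>s - t\<bar> * wt a x"
    proof (cases "s \<le> t")
      case True then show ?thesis using ord[of s t x] s t by (simp add: abs_minus_commute)
    next
      case False then show ?thesis using ord[of t s x] s t by simp
    qed
  qed
qed

text \<open>Functions are defined for all real times, but the equation only sees
  \<open>t \<ge> 0\<close>; two representatives may differ at negative times.\<close>

lemma sol_cong:
  assumes \<mu>: "sol \<mu>" and eq: "\<And>x t. 0 \<le> t \<Longrightarrow> \<mu> x t = \<nu> x t"
  shows "sol \<nu>"
proof -
  have "tame a \<nu>" using tame_cong[OF adm_tame[OF solD(1)[OF \<mu>]] eq] .
  moreover have "duhamel \<nu> x t = duhamel \<mu> x t" for x t
    unfolding duhamel_def src_def by (rule set_lebesgue_integral_cong) (auto simp: eq)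
  ultimately show ?thesis
    using solD(2,3)[OF \<mu>] eq by (auto simp: sol_def adm_def)
qed

text \<open>Admissibility has to come first in both directions, since it provides the measurability
  under which \<open>bconv B\<close> and \<open>cv\<close> agree. \<open>Zinf\<close> yields it
  through \<open>tame_if_Zinf\<close>, and \<open>sol_Zinf\<close> leads back.\<close>

lemma s_solution_iff_sol:
  assumes BK: "AE x in lborel. B x = K x"
  shows "s_solution B V p a u \<longleftrightarrow> sol (\<lambda>x t. exp t * u x t)"
proof -
  define \<mu> where "\<mu> = (\<lambda>x t. exp t * u x t)"
  have pos: "(\<forall>x. \<forall>t\<ge>0. 0 \<le> u x t) \<longleftrightarrow> (\<forall>x. \<forall>t\<ge>0. 0 \<le> \<mu> x t)"
    by (simp add: \<mu>_def zero_le_mult_iff)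
  have eq: "(LINT v:{0..t}|lborel. bconv B (\<lambda>y. \<mu> y v) x)
      + (LINT v:{0..t}|lborel. E v * bconv B (nl \<mu> v) x) = duhamel \<mu> x t"
    if ad: "adm \<mu>" for x t
    unfolding duhamel_split[OF ad]
    by (intro arg_cong2[where f="(+)"] set_lebesgue_integral_cong)
       (auto simp: bconv_eq_cv[OF BK grows_measurable[OF grows_adm(1)[OF ad]]]
          bconv_eq_cv[OF BK grows_measurable[OF grows_adm(2)[OF ad]]])
  have s: "s_solution B V p a u \<longleftrightarrow> (\<forall>x. \<forall>t\<ge>0. 0 \<le> \<mu> x t) \<and> \<mu> \<in> Zinf a \<and>
      (\<forall>x. \<forall>t\<ge>0. \<mu> x t = (LINT v:{0..t}|lborel. bconv B (\<lambda>y. \<mu> y v) x)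
      + (LINT v:{0..t}|lborel. E v * bconv B (nl \<mu> v) x))"
    unfolding s_solution_def Let_def pos by (simp only: \<mu>_def)
  show ?thesis
    unfolding \<mu>_def[symmetric]
  proof
    assume L: "s_solution B V p a u"
    then have ad: "adm \<mu>" unfolding s adm_def using tame_if_Zinf a_nonneg by blast
    then show "sol \<mu>" using L unfolding s sol_def eq[OF ad] by blast
  next
    assume R: "sol \<mu>"
    then show "s_solution B V p a u"
      unfolding s eq[OF solD(1)[OF R]] using sol_Zinf[OF R] solD(2,3)[OF R] by blast
  qed
qed

section \<open>Time shifts of solutions\<close>

text \<open>For \<open>\<mu> = exp t * u\<close> a shift of \<open>u\<close> by \<open>k\<close>
  brings the factor \<open>exp k\<close>. The nonlinearity turns it into \<open>exp (k * p)\<close>,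
  and \<open>E t * exp (k * p) = exp k * E (t - k)\<close> restores it. The shift may have either
  sign.\<close>

lemma src_translate:
  assumes "\<And>y. \<nu> y t = exp k * \<mu> y (t - k)" "\<And>y. 0 \<le> \<mu> y (t - k)"
  shows "src \<nu> x t = exp k * src \<mu> x (t - k)"
proof -
  have e: "(nl \<nu> t) = (\<lambda>y. exp (k * p) * (V y * \<mu> y (t - k) powr p))"
    using assms by (simp add: powr_mult exp_powr_real mult_ac)
  have "cv (nl \<nu> t) x = exp (k * p) * cv (nl \<mu> (t - k)) x"
    unfolding e cv_cmult ..
  moreover have "E t * exp (k * p) = exp k * E (t - k)"
    by (simp add: mult_exp_exp algebra_simps)
  ultimately have "E t * cv (nl \<nu> t) x = exp k * (E (t - k) * cv (nl \<mu> (t - k)) x)"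
    by (simp flip: mult.assoc)
  then show ?thesis
    unfolding src_def assms(1) cv_cmult by (simp add: distrib_left)
qed

text \<open>Before time \<open>k\<close> the source vanishes, so the integral starts at
  \<open>k\<close> and is a translate of the original one. The vanishing at time 0 makes the
  extension by zero continuous.\<close>

lemma sol_delay:
  assumes \<mu>: "sol \<mu>" and k: "0 \<le> k"
  shows "sol (\<lambda>x t. exp k * \<mu> x (max (t - k) 0))"
proof -
  define \<nu> where "\<nu> = (\<lambda>x t. exp k * \<mu> x (max (t - k) 0))"
  have "tame a (\<lambda>x t. \<mu> x (max (t - k) 0))"
    by (rule tame_shift[OF adm_tame[OF solD(1)[OF \<mu>]]]) (auto intro!: continuous_intros)
  then have "tame a \<nu>" unfolding \<nu>_def by (rule tame_mult_time) (auto intro!: continuous_intros)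
  then have ad: "adm \<nu>" using solD(2)[OF \<mu>] by (simp add: adm_def \<nu>_def)
  have zero: "\<nu> x t = 0" if "t \<le> k" for x t using that sol_0[OF \<mu>] by (simp add: \<nu>_def)
  have d0: "duhamel \<nu> x t = 0" if t: "t \<le> k" for x t
  proof -
    have "(LINT v:{0..t}|lborel. src \<nu> x v) = (LINT v:{0..t}|lborel. 0)"
      using t zero by (intro set_lebesgue_integral_cong) (auto simp: src_def)
    then show ?thesis by (simp add: duhamel_def set_lebesgue_integral_def)
  qed
  have "\<nu> x t = duhamel \<nu> x t" if t: "0 \<le> t" for x t
  proof (cases "t \<le> k")
    case False
    then have kt: "k \<le> t" by simp
    have "duhamel \<nu> x t = (LINT v:{k..t}|lborel. src \<nu> x v)"
      using duhamel_diff[OF ad k kt, of x] d0[of k x] by simp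
    also have "\<dots> = (LINT v:{k..t}|lborel. exp k * src \<mu> x (v - k))"
      using solD(2)[OF \<mu>] by (intro set_lebesgue_integral_cong) (auto intro!: src_translate simp: \<nu>_def)
    also have "\<dots> = exp k * duhamel \<mu> x (t - k)"
      by (simp add: duhamel_def set_integral_translate[of k t "\<lambda>v. src \<mu> x v"])
    also have "\<dots> = \<nu> x t" using solD(3)[OF \<mu>, of "t - k" x] kt by (simp add: \<nu>_def)
    finally show ?thesis by simp
  qed (simp add: zero d0)
  then show ?thesis using ad unfolding \<nu>_def[symmetric] by (simp add: sol_def)
qed

lemma sol_advance:
  assumes \<mu>: "sol \<mu>" and k: "0 \<le> k" and zero: "\<And>x t. 0 \<le> t \<Longrightarrow> t \<le> k \<Longrightarrow> \<mu> x t = 0"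
  shows "sol (\<lambda>x t. exp (- k) * \<mu> x (t + k))"
proof -
  define \<nu> where "\<nu> = (\<lambda>x t. exp (- k) * \<mu> x (t + k))"
  have "tame a (\<lambda>x t. \<mu> x (t + k))"
    by (rule tame_shift[OF adm_tame[OF solD(1)[OF \<mu>]]]) (use k in \<open>auto intro!: continuous_intros\<close>)
  then have "tame a \<nu>" unfolding \<nu>_def by (rule tame_mult_time) (auto intro!: continuous_intros)
  then have ad: "adm \<nu>" using solD(2)[OF \<mu>] k by (simp add: adm_def \<nu>_def)
  have "\<nu> x t = duhamel \<nu> x t" if t: "0 \<le> t" for x t
  proof -
    have "\<mu> x (t + k) = (LINT v:{k..t + k}|lborel. src \<mu> x v)"
      using duhamel_diff[OF solD(1)[OF \<mu>] k, of "t + k" x] solD(3)[OF \<mu>, of k x] solD(3)[OF \<mu>, of "t + k" x] zero[OF k order_refl, of x] k t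
      by simp
    also have "\<dots> = (LINT v:{0..t}|lborel. src \<mu> x (v + k))"
      using set_integral_translate[of k "t + k" "\<lambda>v. src \<mu> x (v + k)"] by simp
    finally have "\<nu> x t = (LINT v:{0..t}|lborel. exp (- k) * src \<mu> x (v + k))" by (simp add: \<nu>_def)
    also have "\<dots> = duhamel \<nu> x t"
      unfolding duhamel_def
    proof (intro set_lebesgue_integral_cong allI impI)
      fix v assume "v \<in> {0..t}"
      then show "exp (- k) * src \<mu> x (v + k) = src \<nu> x v"
        using src_translate[of \<nu> v "- k" \<mu> x] solD(2)[OF \<mu>] k by (simp add: \<nu>_def)
    qed simp
    finally show ?thesis .
  qed
  then show ?thesis using ad unfolding \<nu>_def[symmetric] by (simp add: sol_def)
qed

lemma w_pos: "0 < t \<Longrightarrow> x \<noteq> 0 \<Longrightarrow> 0 < w x t"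
  using A_pos F_pos[of 0 t] by (simp add: w_def rpow_def)

section \<open>Classification of nontrivial solutions\<close>

lemma nontrivial_sol_is_delay:
  assumes \<mu>: "sol \<mu>" and nz: "0 \<le> t0" "\<mu> x0 t0 \<noteq> 0" and \<nu>: "sol \<nu>" "\<And>x t. 0 \<le> t \<Longrightarrow> w x t \<le> \<nu> x t"
  obtains k where "0 \<le> k" "\<And>x t. 0 \<le> t \<Longrightarrow> \<mu> x t = exp k * \<nu> x (max (t - k) 0)"
proof -
  define S where "S = {t. 0 \<le> t \<and> (\<forall>x. \<forall>s\<in>{0..t}. \<mu> x s = 0)}"
  have S0: "0 \<in> S" using sol_0[OF \<mu>] by (auto simp: S_def)
  have St0: "t < t0" if "t \<in> S" for t using that nz by (force simp: S_def not_le[symmetric])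
  have bdd: "bdd_above S" using St0 by (intro bdd_aboveI[of _ t0]) (auto intro: less_imp_le)
  define k where "k = Sup S"
  have k: "0 \<le> k" unfolding k_def by (rule cSup_upper[OF S0 bdd])
  have before: "\<mu> x t = 0" if t: "0 \<le> t" "t < k" for x t
  proof -
    have "\<exists>s\<in>S. t < s" using t(2) S0 less_cSup_iff[OF _ bdd, of t] unfolding k_def by blast
    then show ?thesis using t by (auto simp: S_def)
  qed
  have zero: "\<mu> x t = 0" if t: "0 \<le> t" "t \<le> k" for x t
  \<comment> \<open>The supremum need not be attained a priori: at \<open>t = k > 0\<close>
    continuity is used, and for \<open>k = 0\<close> the zero initial value.\<close>
  proof (cases "t = k \<and> 0 < k")
    case False
    then show ?thesis using t before[of t x] sol_0[OF \<mu>, of x] by (cases "t < k") auto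
  next
    case True
    have c: "continuous_on {0..k} (\<lambda>s. \<mu> x s)"
      by (rule tame_continuous_time[OF adm_tame[OF solD(1)[OF \<mu>]]]) auto
    have "\<mu> x s = 0" if "s \<in> closure {0..<k}" for s
      by (rule continuous_constant_on_closure[OF _ _ that, of "\<lambda>s. \<mu> x s"]) (use True c before in auto)
    then show ?thesis using True by simp
  qed
  define \<rho> where "\<rho> = (\<lambda>x t. exp (- k) * \<mu> x (t + k))"
  have \<rho>: "sol \<rho>" unfolding \<rho>_def by (rule sol_advance[OF \<mu> k zero])
  \<comment> \<open>Every \<open>k + s\<close> lies beyond the supremum, so the solution is nonzero
    at some time up to \<open>k + s\<close>, and that time must exceed \<open>k\<close>.\<close>
  have pos: "\<exists>x0 s0. 0 < s0 \<and> s0 \<le> s \<and> 0 < \<rho> x0 s0" if s: "0 < s" for s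
  proof -
    have "k + s \<notin> S" using cSup_upper[OF _ bdd, of "k + s"] s by (auto simp: k_def)
    then obtain x r where r: "0 \<le> r" "r \<le> k + s" "\<mu> x r \<noteq> 0" using k s by (auto simp: S_def)
    have "k < r" using zero[OF r(1), of x] r(3) by (cases "r \<le> k") auto
    moreover have "0 < \<mu> x r" using solD(2)[OF \<mu> r(1), of x] r(3) by simp
    ultimately show ?thesis using r by (intro exI[of _ x] exI[of _ "r - k"]) (auto simp: \<rho>_def)
  qed
  have eq: "\<rho> x t = \<nu> x t" if "0 \<le> t" for x t
    by (rule sol_unique[OF \<rho> \<nu>(1) sol_ge_w[OF \<rho> pos] \<nu>(2) that])
  have "\<mu> x t = exp k * \<nu> x (max (t - k) 0)" if t: "0 \<le> t" for x t
  proof (cases "t \<le> k")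
    case True
    then show ?thesis using zero[OF t True, of x] sol_0[OF \<nu>(1), of x] by simp
  next
    case False
    then show ?thesis using eq[of "t - k" x] by (simp add: \<rho>_def exp_minus field_simps)
  qed
  with k show thesis by (rule that)
qed

theorem s_solution_iff_delay:
  assumes BK: "AE x in lborel. B x = K x" and max: "maximal_s_solution B V p a ustar"
  shows "(s_solution B V p a u \<and> (\<exists>x. \<exists>t\<ge>0. u x t \<noteq> 0)) \<longleftrightarrow>
         (\<exists>\<kappa>\<ge>0. \<forall>x. \<forall>t\<ge>0. u x t = ustar x (max (t - \<kappa>) 0))"
proof -
  define \<nu> where "\<nu> = (\<lambda>x t. exp t * ustar x t)"
  have \<nu>: "sol \<nu>" using max by (simp add: maximal_s_solution_def s_solution_iff_sol[OF BK] \<nu>_def)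
  obtain \<rho> where \<rho>: "sol \<rho>" "\<And>x t. 0 \<le> t \<Longrightarrow> w x t \<le> \<rho> x t" using ex_sol_ge_w by blast
  \<comment> \<open>Maximality enters here: the constructed solution above \<open>w\<close> lies
    below \<open>ustar\<close>, so \<open>ustar\<close> inherits the barrier that uniqueness
    requires.\<close>
  have w\<nu>: "w x t \<le> \<nu> x t" if t: "0 \<le> t" for x t
  proof -
    have "s_solution B V p a (\<lambda>x t. exp (- t) * \<rho> x t)"
      unfolding s_solution_iff_sol[OF BK] using \<rho>(1) by (simp add: mult_exp_exp flip: mult.assoc)
    then have "\<forall>x. \<forall>t\<ge>0. exp (- t) * \<rho> x t \<le> ustar x t"
      using max unfolding maximal_s_solution_def by blast
    then have "exp (- t) * \<rho> x t \<le> ustar x t" using t by blast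
    then have "exp t * (exp (- t) * \<rho> x t) \<le> \<nu> x t" unfolding \<nu>_def by (intro mult_left_mono) auto
    then show ?thesis using \<rho>(2)[OF t, of x] by (simp add: mult_exp_exp flip: mult.assoc)
  qed
  show ?thesis
  proof
    assume L: "s_solution B V p a u \<and> (\<exists>x. \<exists>t\<ge>0. u x t \<noteq> 0)"
    then obtain x0 t0 where "0 \<le> t0" "exp t0 * u x0 t0 \<noteq> 0" by auto
    moreover have "sol (\<lambda>x t. exp t * u x t)" using L by (simp add: s_solution_iff_sol[OF BK])
    ultimately obtain k where k: "0 \<le> k" "\<And>x t. 0 \<le> t \<Longrightarrow> exp t * u x t = exp k * \<nu> x (max (t - k) 0)"
      using nontrivial_sol_is_delay[OF _ _ _ \<nu> w\<nu>] by (metis (no_types, lifting))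
    have "u x t = ustar x (max (t - k) 0)" if t: "0 \<le> t" for x t
    proof (cases "t \<le> k")
      case True
      then show ?thesis using k(2)[OF t, of x] sol_0[OF \<nu>, of x] by (simp add: \<nu>_def)
    next
      case False
      then have "exp t * u x t = exp t * ustar x (t - k)"
        using k(2)[OF t, of x] by (simp add: \<nu>_def mult_exp_exp flip: mult.assoc)
      with False show ?thesis by simp
    qed
    with k(1) show "\<exists>\<kappa>\<ge>0. \<forall>x. \<forall>t\<ge>0. u x t = ustar x (max (t - \<kappa>) 0)" by blast
  next
    assume "\<exists>\<kappa>\<ge>0. \<forall>x. \<forall>t\<ge>0. u x t = ustar x (max (t - \<kappa>) 0)"
    then obtain k where k: "0 \<le> k" "\<And>x t. 0 \<le> t \<Longrightarrow> u x t = ustar x (max (t - k) 0)" by blast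
    have "sol (\<lambda>x t. exp t * u x t)"
    proof (rule sol_cong[OF sol_delay[OF \<nu> k(1)]])
      fix x t assume t: "(0::real) \<le> t"
      show "exp k * \<nu> x (max (t - k) 0) = exp t * u x t"
      proof (cases "t \<le> k")
        case True
        then show ?thesis using k(2)[OF t, of x] sol_0[OF \<nu>, of x] by (simp add: \<nu>_def)
      next
        case False
        then show ?thesis using k(2)[OF t, of x] by (simp add: \<nu>_def mult_exp_exp flip: mult.assoc)
      qed
    qed
    \<comment> \<open>Nontriviality is read off the barrier, which is positive at a unit vector one
      unit of time after the delay.\<close>
    moreover have "\<exists>x. \<exists>t\<ge>0. u x t \<noteq> 0"
    proof -
      obtain e :: "real^'n" where e: "norm e = 1" using vector_choose_size[of 1] by auto
      then have "e \<noteq> 0" by auto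
      then have "0 < \<nu> e 1" using w_pos[of 1 e] w\<nu>[of 1 e] by simp
      then have "u e (k + 1) \<noteq> 0" using k(2)[of "k + 1" e] k(1) by (auto simp: \<nu>_def)
      then show ?thesis using k(1) by (intro exI[of _ e] exI[of _ "k + 1"]) auto
    qed
    ultimately show "s_solution B V p a u \<and> (\<exists>x. \<exists>t\<ge>0. u x t \<noteq> 0)"
      by (simp add: s_solution_iff_sol[OF BK])
  qed
qed

end

section \<open>From the Bessel kernel to the abstract setting\<close>

lemma is_bessel_kernel_conv_kernel:
  assumes B: "is_bessel_kernel (B :: real^'n \<Rightarrow> real)"
  obtains K c lam eps where "conv_kernel K c lam eps" "AE x in lborel. B x = K x"
proof -
  let ?n = "real DIM(real^'n)"
  define c where "c = exp (- 2) * (1 / (8 * pi)) ^ DIM(real^'n)"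
  define lam where "lam = ?n + 2"
  \<comment> \<open>With \<open>n\<close> the dimension, this gives
    \<open>n * eps\<^sup>2 = 1 / (4 * n)\<close>, within the limit 1/2 for the exponential
    moment.\<close>
  define eps where "eps = 1 / (2 * ?n)"
  have n: "1 \<le> ?n" by (simp add: DIM_positive Suc_leI)
  have "?n * eps\<^sup>2 = 1 / (4 * ?n)" using n by (simp add: eps_def power2_eq_square)
  also have "\<dots> \<le> 1 / 2" by (rule frac_le; use n in linarith)
  finally have eps: "?n * eps\<^sup>2 \<le> 1 / 2" .
  \<comment> \<open>Taking the maximum enforces the exponential lower bound at every point and
    changes the kernel only on a null set.\<close>
  define K where "K = (\<lambda>x::real^'n. max (bessel_kernel x) (c * exp (- lam * norm x)))"
  have [measurable]: "K \<in> borel_measurable borel" unfolding K_def by measurable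
  have AE: "AE x in lborel. bessel_kernel x = K x"
    using AE_bessel_kernel_ge[where 'a="real^'n"] by eventually_elim (simp add: K_def c_def lam_def)
  have "conv_kernel K c lam eps"
  proof
    show "0 < c" by (simp add: c_def)
    show "0 < lam" "0 < eps" using n by (auto simp: lam_def eps_def)
    show "c * exp (- lam * norm x) \<le> K x" for x by (simp add: K_def)
    have "(LBINT x. K x) = (LBINT (x::real^'n). bessel_kernel x)"
      by (rule integral_cong_AE) (use AE in \<open>auto elim: eventually_mono\<close>)
    then show "(LBINT x. K x) = 1" by (simp add: integral_bessel_kernel)
    show "integrable lborel (\<lambda>x. K x * exp (eps * norm x))"
      by (rule integrable_cong_AE_imp[OF integrable_bessel_kernel_exp[OF eps]]) (use AE in \<open>auto elim!: eventually_mono\<close>)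
  qed simp
  moreover have "AE x in lborel. B x = K x"
    using is_bessel_kernel_AE_eq[OF B] AE by eventually_elim simp
  ultimately show thesis by (rule that)
qed

theorem mainTheorem6:
  fixes B V :: "real^'n \<Rightarrow> real" and \<Lambda> :: "real \<Rightarrow> real"
    and \<sigma> \<theta>l \<theta>u p \<epsilon>0 a :: real
    and ustar u :: "real^'n \<Rightarrow> real \<Rightarrow> real"
  assumes B: "is_bessel_kernel B"
    and \<sigma>: "\<sigma> \<in> Jplus CARD('n)"
    and \<Lambda>cont: "continuous_on {0..} \<Lambda>" and \<Lambda>pos: "\<forall>t\<ge>0. \<Lambda> t > 0"
    and \<theta>: "\<theta>l > 0" "\<theta>u > 0"
    and Vcont: "continuous_on UNIV V" and Vnn: "\<forall>x. V x \<ge> 0"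
    and Vlow: "\<forall>x t. norm x \<ge> 1 \<longrightarrow> t > 0 \<longrightarrow> V x \<ge> \<theta>l * \<Lambda> t * rpow (norm x) \<sigma>"
    and Vupp: "\<forall>x t. t > 0 \<longrightarrow> V x \<le> \<theta>u * \<Lambda> t * rpow (norm x) \<sigma>"
    and \<epsilon>0: "\<epsilon>0 > 0"
    and \<epsilon>0prop: "\<forall>x. \<forall>d \<in> {0 .. \<sigma> * p / (1 - p)}.
        (\<integral>\<^sup>+ y. indicator {y. dist x y \<ge> 1} y * ennreal (B y * rpow (dist x y) (\<sigma> + d)) \<partial>lebesgue)
          \<ge> ennreal (\<epsilon>0 * rpow (norm x) (\<sigma> + d))"
    and p: "0 < p" "p < 1" "p < \<epsilon>0 * \<theta>l / \<theta>u"
    and a: "a \<ge> \<sigma> / (1 - p)"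
    and ustar: "maximal_s_solution B V p a ustar"
    and u: "\<forall>x. \<forall>t\<ge>0. 0 \<le> u x t" "u \<in> Zinf a"
  shows "(s_solution B V p a u \<and> (\<exists>x. \<exists>t\<ge>0. u x t \<noteq> 0)) \<longleftrightarrow>
         (\<exists>\<kappa>\<ge>0. \<forall>x. \<forall>t\<ge>0. u x t = ustar x (max (t - \<kappa>) 0))"
proof -
  obtain K c lam eps where K: "conv_kernel K c lam eps" and BK: "AE x in lborel. B x = K x"
    using is_bessel_kernel_conv_kernel[OF B] by metis
  interpret conv_kernel K c lam eps by (rule K)
  have \<sigma>0: "0 \<le> \<sigma>" using \<sigma> by (auto simp: Jplus_def split: if_splits)
  have \<Lambda>1: "0 < \<Lambda> 1" using \<Lambda>pos by simp
  have eps0: "\<epsilon>0 * rpow (norm x) (\<sigma> + d) \<le> cv (\<lambda>y. indicator {y. 1 \<le> norm y} y * rpow (norm y) (\<sigma> + d)) x"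
    if d: "0 \<le> d" "d \<le> \<sigma> * p / (1 - p)" for x d
  proof -
    let ?\<phi> = "\<lambda>y::real^'n. indicator {y. 1 \<le> norm y} y * rpow (norm y) (\<sigma> + d)"
    have rm [measurable]: "(\<lambda>y::real^'n. rpow (norm y) (\<sigma> + d)) \<in> borel_measurable borel"
      using d \<sigma>0 by (intro borel_measurable_rpow_norm) auto
    have \<phi>m [measurable]: "?\<phi> \<in> borel_measurable borel" by measurable
    have g: "grows (\<sigma> + d) ?\<phi>"
      using \<sigma>0 d by (intro growsI[where M=1] \<phi>m) (auto simp: indicator_def rpow_le)
    \<comment> \<open>The extended nonnegative integral over Lebesgue measurable \<open>B\<close> is
      turned into a finite Borel integral: \<open>B\<close> becomes \<open>K\<close> almost
      everywhere, and the cut-off and the power are functions of \<open>x - y\<close>.\<close>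
    have "ennreal (\<epsilon>0 * rpow (norm x) (\<sigma> + d))
        \<le> (\<integral>\<^sup>+ y. indicator {y. dist x y \<ge> 1} y * ennreal (B y * rpow (dist x y) (\<sigma> + d)) \<partial>lebesgue)"
      using \<epsilon>0prop d by auto
    also have "\<dots> = (\<integral>\<^sup>+ y. ennreal (K y * ?\<phi> (x - y)) \<partial>lebesgue)"
      by (rule nn_integral_cong_AE, use AE_completion[OF BK] in eventually_elim)
         (auto simp: indicator_def dist_norm)
    also have "\<dots> = (\<integral>\<^sup>+ y. ennreal (K y * ?\<phi> (x - y)) \<partial>lborel)"
      by (rule nn_integral_completion)
    also have "\<dots> = ennreal (cv ?\<phi> x)"
      unfolding cv_def by (intro nn_integral_eq_integral cv_integrable[OF g]) auto
    finally show ?thesis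
      using cv_nonneg[of ?\<phi> x] by (subst (asm) ennreal_le_iff) auto
  qed
  \<comment> \<open>As \<open>V\<close> does not depend on time, its bounds are read at time 1, and
    the common factor \<open>\<Lambda> 1\<close> preserves the strict inequality.\<close>
  have "p * \<theta>u < \<epsilon>0 * \<theta>l" using p(3) \<theta> by (simp add: less_divide_eq)
  then have "p * \<theta>u * \<Lambda> 1 < \<epsilon>0 * \<theta>l * \<Lambda> 1" using \<Lambda>1 by (rule mult_strict_right_mono)
  then interpret semilinear K c lam eps V \<sigma> "\<theta>l * \<Lambda> 1" "\<theta>u * \<Lambda> 1" p \<epsilon>0 a
    using \<sigma>0 \<Lambda>1 \<theta> Vcont Vnn Vlow Vupp \<epsilon>0 eps0 p a by unfold_locales (auto simp: mult.assoc)
  show ?thesis by (rule s_solution_iff_delay[OF BK ustar])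
qed

end
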